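(* Let $X_u=\sum_{t\in\mathbb{Z}}a(u-t)\xi_t$, $u\in\mathbb{Z}$, where $\{\xi_t\}$ is a centered weak white noise with unit variance and $\{a(t)\}$ is a real-valued sequence with $\sum_ta(t)^2<\infty$, and let $f$ be its spectral density, $f(\lambda)=|a^*(\lambda)|^2$. Assume that $f(\lambda)=f(0)+O(|\lambda|^2)$ as $\lambda\to0$. Let $W:\mathbb{R}\to\mathbb{R}$ be a bounded function with support included in $[-1,0]$ such that, for some $\beta>2$, $\sup_{\xi\in\mathbb{R}}|\hat W(\xi)|(1+|\xi|)^{\beta}<\infty$, and such that $\int_{-\infty}^{\infty}|\hat W(\lambda)|^2\,d\lambda=1$. Let $(\gamma_n)$ be a diverging sequence of even positive integers such that $\gamma_n^{-1}n\to\infty$. Define $Z_{1,n,k}=\gamma_n^{-1/2}\sum_{u\in\mathbb{Z}}W(k-\gamma_n^{-1}u)X_u$ and the estimator $\hat f_n(0)=n_n^{-1}\sum_{k=0}^{n_n-1}Z_{1,n,k}^2$ with $n_n=[\gamma_n^{-1}(n+1)]$. Then, as $n\to\infty$, $$\mathbb{E}[\hat f_n(0)]=\mathbb{E}[Z_{1,n,0}^2]=f(0)+O(\gamma_n^{-2}).$$ If moreover $\{\xi_t\}$ is a sequence of i.i.d. real-valued random variables with $\mathbb{E}[\xi_0]=0$, $\mathbb{E}[\xi_0^2]=1$ and $\kappa_4:=\mathbb{E}[\xi_0^4]-3$ finite, and $n^{1/2}\gamma_n^{1/2-2\beta}\to0$, then $$(\gamma_n^{-1}n)^{1/2}\{\hat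 f_n(0)-\mathbb{E}[Z_{1,n,0}^2]\}\longrightarrow\mathcal{N}(0,\sigma^2)\quad\text{in law},$$ where $$\sigma^2=2\pi\,f(0)^2\int_{-\pi}^{\pi}\Big(\sum_{p\in\mathbb{Z}}|\hat W(\lambda+2p\pi)|^2\Big)^2\,d\lambda.$$
   Context: $a^*(\lambda)=(2\pi)^{-1/2}\sum_{t\in\mathbb{Z}}a(t)e^{-\mathrm{i}\lambda t}$ is the ($2\pi$-periodic) Fourier series of $a$, and $\hat W(\xi)=\int_{-\infty}^{\infty}W(t)e^{-\mathrm{i}\xi t}\,dt$. A centered weak white noise with unit variance is an uncorrelated sequence of mean-zero real random variables with variance one. $[x]$ denotes the integer part of $x$. For $n$ large, $n_n\ge1$.
   Formalization: The printed factor 2π in σ² is replaced by 4π (for Gaussian white noise the limit variance is 2f(0)², twice the printed value), and W is assumed continuous, since the other hypotheses fix W only almost everywhere while Z_{1,n,k} uses its values at rational points. *)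

theory Defs
  imports "HOL-Probability.Probability" "HOL-Library.Landau_Symbols"
begin

definition weak_white_noise :: "'a measure \<Rightarrow> (int \<Rightarrow> 'a \<Rightarrow> real) \<Rightarrow> bool" where
  "weak_white_noise M \<xi> \<longleftrightarrow>
     (\<forall>t. \<xi> t \<in> borel_measurable M \<and> integrable M (\<lambda>\<omega>. (\<xi> t \<omega>)\<^sup>2)) \<and>
     (\<forall>t. (\<integral>\<omega>. \<xi> t \<omega> \<partial>M) = 0) \<and>
     (\<forall>t. (\<integral>\<omega>. (\<xi> t \<omega>)\<^sup>2 \<partial>M) = 1) \<and>
     (\<forall>s t. s \<noteq> t \<longrightarrow> (\<integral>\<omega>. \<xi> s \<omega> * \<xi> t \<omega> \<partial>M) = 0)"

definition iid :: "'a measure \<Rightarrow> (int \<Rightarrow> 'a \<Rightarrow> real) \<Rightarrow> bool" where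
  "iid M \<xi> \<longleftrightarrow>
     prob_space.indep_vars M (\<lambda>_. borel) \<xi> UNIV \<and>
     (\<forall>t. distr M borel (\<xi> t) = distr M borel (\<xi> 0))"

text \<open>For a square-summable \<open>a\<close> and weak white noise \<open>\<xi>\<close> the series
  \<open>\<Sum>t. a (u - t) * \<xi> t\<close> converges in mean square, and \<open>X u\<close> is any version of its sum.\<close>

definition linear_process ::
    "'a measure \<Rightarrow> (int \<Rightarrow> real) \<Rightarrow> (int \<Rightarrow> 'a \<Rightarrow> real) \<Rightarrow> (int \<Rightarrow> 'a \<Rightarrow> real) \<Rightarrow> bool" where
  "linear_process M a \<xi> X \<longleftrightarrow>
     (\<forall>u. X u \<in> borel_measurable M \<and> integrable M (\<lambda>\<omega>. (X u \<omega>)\<^sup>2) \<and>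
       ((\<lambda>F. \<integral>\<omega>. (X u \<omega> - (\<Sum>t\<in>F. a (u - t) * \<xi> t \<omega>))\<^sup>2 \<partial>M) \<longlongrightarrow> 0)
         (finite_subsets_at_top UNIV))"

text \<open>\<open>g\<close> is a version of the Fourier series
  \<open>(2\<pi>)\<^sup>-\<^sup>1\<^sup>/\<^sup>2 \<Sum>t. a t * exp (-\<i>\<lambda>t)\<close>. As \<open>a\<close> is only
  square-summable, the series is understood in \<open>L\<^sup>2\<close> over a period.\<close>

definition is_fourier_series :: "(int \<Rightarrow> real) \<Rightarrow> (real \<Rightarrow> complex) \<Rightarrow> bool" where
  "is_fourier_series a g \<longleftrightarrow>
     g \<in> borel_measurable borel \<and>
     (\<forall>l. g (l + 2 * pi) = g l) \<and>
     set_integrable lborel {-pi..pi} (\<lambda>l. (cmod (g l))\<^sup>2) \<and>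
     ((\<lambda>F. LBINT l:{-pi..pi}.
         (cmod (g l - (\<Sum>t\<in>F. complex_of_real (a t) * exp (- (\<i> * of_real l * of_int t)))
                        / complex_of_real (sqrt (2 * pi))))\<^sup>2) \<longlongrightarrow> 0)
       (finite_subsets_at_top UNIV)"

definition fourier_transform :: "(real \<Rightarrow> real) \<Rightarrow> real \<Rightarrow> complex" where
  "fourier_transform W x =
     (LBINT t. complex_of_real (W t) * exp (- (\<i> * of_real x * of_real t)))"

text \<open>The sum over \<open>u\<close> has only finitely many nonzero terms when \<open>W\<close> has bounded
  support and \<open>\<gamma> n > 0\<close>.\<close>

definition Z1 ::
    "(real \<Rightarrow> real) \<Rightarrow> (nat \<Rightarrow> nat) \<Rightarrow> (int \<Rightarrow> 'a \<Rightarrow> real) \<Rightarrow> nat \<Rightarrow> nat \<Rightarrow> 'a \<Rightarrow> real" where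
  "Z1 W \<gamma> X n k \<omega> =
     real (\<gamma> n) powr (-1/2) *
       (\<Sum>\<^sub>\<infinity>u\<in>(UNIV :: int set). W (real k - of_int u / real (\<gamma> n)) * X u \<omega>)"

definition num_coeffs :: "(nat \<Rightarrow> nat) \<Rightarrow> nat \<Rightarrow> nat" where
  "num_coeffs \<gamma> n = nat \<lfloor>(real n + 1) / real (\<gamma> n)\<rfloor>"

definition f_hat0 ::
    "(real \<Rightarrow> real) \<Rightarrow> (nat \<Rightarrow> nat) \<Rightarrow> (int \<Rightarrow> 'a \<Rightarrow> real) \<Rightarrow> nat \<Rightarrow> 'a \<Rightarrow> real" where
  "f_hat0 W \<gamma> X n \<omega> =
     (\<Sum>k<num_coeffs \<gamma> n. (Z1 W \<gamma> X n k \<omega>)\<^sup>2) / real (num_coeffs \<gamma> n)"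

text \<open>The law of \<open>m + sqrt v * N\<close> with \<open>N\<close> standard normal, so that \<open>v = 0\<close> gives
  the point mass at \<open>m\<close> (\<open>normal_density m 0\<close> would give the null measure).\<close>

definition normal_law :: "real \<Rightarrow> real \<Rightarrow> real measure" where
  "normal_law m v = distr std_normal_distribution borel (\<lambda>x. m + sqrt v * x)"

text \<open>The constant is \<open>4\<pi> = 2 \<cdot> 2\<pi>\<close>: the factor \<open>2\<pi>\<close> is from Parseval's identity for the
  limiting covariances of \<open>Z1 W \<gamma> X n k\<close> in \<open>k\<close>, and the factor \<open>2\<close> from
  \<open>Cov (Y\<^sup>2, Y'\<^sup>2) = 2 (Cov (Y, Y'))\<^sup>2\<close> for centered jointly Gaussian \<open>Y, Y'\<close>.
  For Gaussian white noise \<open>X\<close> it gives the variance \<open>2 (f 0)\<^sup>2\<close>. The source prints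
  \<open>2\<pi>\<close>, which loses this factor \<open>2\<close>.\<close>

definition asymp_variance :: "(real \<Rightarrow> real) \<Rightarrow> (real \<Rightarrow> real) \<Rightarrow> real" where
  "asymp_variance f W =
     4 * pi * (f 0)\<^sup>2 *
       (LBINT l:{-pi..pi}.
          (\<Sum>\<^sub>\<infinity>p\<in>(UNIV :: int set). (cmod (fourier_transform W (l + 2 * of_int p * pi)))\<^sup>2)\<^sup>2)"

end

theory Submission
  imports Defs "HOL-Real_Asymp.Real_Asymp"
begin

text \<open>Since \<open>W\<close> lives on \<open>[-1, 0]\<close>, the statistics \<open>Z1 W \<gamma> X n k\<close> are spectral averages of the density against
  the kernel \<open>\<bar>P g\<bar>\<^sup>2\<close> of a weighted block of length \<open>g = \<gamma> n\<close>. Poisson summation identifies \<open>P g l\<close> with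
  \<open>sqrt g * fourier_transform W (g * l)\<close> up to aliasing of order \<open>g powr (1/2 - \<beta>)\<close>, which gives the bias. Blocks
  do not overlap, so a constant density contributes nothing to the covariances of distinct \<open>k\<close>: the covariance
  matrix is \<open>f 0\<close> times the identity up to an error whose squared Frobenius norm is \<open>o(N)\<close>, by Bessel's inequality
  near zero and the decay of the kernel elsewhere.

  For the limit law the centred estimator is a quadratic form in the noise with matrix \<open>B\<close>. A leave-one-out
  expansion of its characteristic function \<open>\<phi>\<close> gives \<open>\<phi>' = - 2 \<theta> tr (B\<^sup>2) \<phi>\<close> up to an error governed by
  \<open>tr (B\<^sup>4)\<close> and the diagonal of \<open>B\<close>. The trace tends to zero because \<open>B\<close> has the same nonzero spectrum as the
  scaled covariance matrix, the diagonal because the coefficients of the decimated series vary slowly in mean square.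
  Neither needs any regularity of the phase of \<open>a_star\<close>.\<close>

section \<open>Square-integrable functions and quadratic forms in independent variables\<close>

text \<open>Cumulants of order three and higher of a quadratic form involve noise moments beyond the
  fourth, which need not exist. This rules out the method of moments and leads to a differential
  equation whose error needs only second moments of quadratic forms and fourth moments of linear
  forms. The infinite noise series is never expanded directly: forms are restricted to finite index
  sets, where the estimates are uniform, and the limit along finite sets is taken last, in
  \<open>T_char_approx\<close>. The limit variance collapses. The support of W has length one, so
  Parseval gives the transform the same energy 1 / (2\<pi>) along every translate of the multiples
  of 2\<pi>. The periodized sum is therefore constant and \<open>asymp_variance f W\<close> is 2 (f
  0)^2, matching the limit exp (- \<theta>^2 (f 0)^2) of the characteristic functions. Away from
  zero the density is only known to be integrable, so the covariance error there has the same bound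
  at every lag and adds up over the lags. The growth condition on n and \<open>\<gamma> n\<close> is
  what makes this sum negligible.\<close>

definition square_integrable :: "'a measure \<Rightarrow> ('a \<Rightarrow> real) \<Rightarrow> bool" where
  "square_integrable M X \<longleftrightarrow> X \<in> borel_measurable M \<and> integrable M (\<lambda>\<omega>. (X \<omega>)\<^sup>2)"

lemma square_integrable_measurable: "square_integrable M X \<Longrightarrow> X \<in> borel_measurable M"
  and square_integrable_power2: "square_integrable M X \<Longrightarrow> integrable M (\<lambda>\<omega>. (X \<omega>)\<^sup>2)"
  by (auto simp: square_integrable_def)

lemma square_integrable_mult_integrable:
  assumes "square_integrable M X" "square_integrable M Y"
  shows "integrable M (\<lambda>\<omega>. X \<omega> * Y \<omega>)"
proof (rule Bochner_Integration.integrable_bound)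
  show "integrable M (\<lambda>\<omega>. (X \<omega>)\<^sup>2 + (Y \<omega>)\<^sup>2)" using assms by (auto simp: square_integrable_def)
  show "(\<lambda>\<omega>. X \<omega> * Y \<omega>) \<in> borel_measurable M" using assms by (auto simp: square_integrable_def)
  have "\<bar>x * y\<bar> \<le> x\<^sup>2 + y\<^sup>2" for x y :: real
  proof -
    have "2 * (\<bar>x\<bar> * \<bar>y\<bar>) \<le> x\<^sup>2 + y\<^sup>2" using sum_squares_bound[of "\<bar>x\<bar>" "\<bar>y\<bar>"] by simp
    moreover have "0 \<le> \<bar>x\<bar> * \<bar>y\<bar>" by simp
    ultimately show ?thesis unfolding abs_mult by linarith
  qed
  then show "AE \<omega> in M. norm (X \<omega> * Y \<omega>) \<le> norm ((X \<omega>)\<^sup>2 + (Y \<omega>)\<^sup>2)" by simp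
qed

lemma square_integrable_cmult: "square_integrable M X \<Longrightarrow> square_integrable M (\<lambda>\<omega>. c * X \<omega>)"
  by (auto simp: square_integrable_def power_mult_distrib)

lemma square_integrable_uminus: "square_integrable M X \<Longrightarrow> square_integrable M (\<lambda>\<omega>. - X \<omega>)"
  by (auto simp: square_integrable_def)

lemma square_integrable_add:
  assumes "square_integrable M X" "square_integrable M Y"
  shows "square_integrable M (\<lambda>\<omega>. X \<omega> + Y \<omega>)"
  unfolding square_integrable_def power2_sum
  using assms square_integrable_mult_integrable[OF assms]
  by (auto simp: square_integrable_def mult.assoc)

lemma square_integrable_diff: "square_integrable M X \<Longrightarrow> square_integrable M Y \<Longrightarrow> square_integrable M (\<lambda>\<omega>. X \<omega> - Y \<omega>)"
  using square_integrable_add[of M X "\<lambda>\<omega>. - Y \<omega>"] square_integrable_uminus[of M Y] by simp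

lemma square_integrable_zero: "square_integrable M (\<lambda>\<omega>. 0)" by (simp add: square_integrable_def)

lemma square_integrable_sum: "(\<And>i. i \<in> F \<Longrightarrow> square_integrable M (X i)) \<Longrightarrow> square_integrable M (\<lambda>\<omega>. \<Sum>i\<in>F. X i \<omega>)"
  by (induction F rule: infinite_finite_induct) (auto intro!: square_integrable_add square_integrable_zero)

lemma (in prob_space) square_integrable_const: "square_integrable M (\<lambda>\<omega>. c)" by (simp add: square_integrable_def)

lemma (in prob_space) square_integrable_integrable: "square_integrable M X \<Longrightarrow> integrable M X"
  using square_integrable_mult_integrable[of M X "\<lambda>_. 1"] square_integrable_const[of 1] by simp

text \<open>The quadratic \<open>s\<^sup>2 * a - 2 * s * c + b\<close> is the integral of a square
  and so nonnegative for every s. Taking s = c / a gives the claim; if a = 0, a large s would make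
  it negative unless c = 0. The measure is arbitrary because the bound also serves functions of
  frequency.\<close>

lemma square_integrable_Cauchy_Schwarz:
  assumes X: "square_integrable M X" and Y: "square_integrable M Y"
  shows "(\<integral>\<omega>. \<bar>X \<omega> * Y \<omega>\<bar> \<partial>M) \<le> sqrt (\<integral>\<omega>. (X \<omega>)\<^sup>2 \<partial>M) * sqrt (\<integral>\<omega>. (Y \<omega>)\<^sup>2 \<partial>M)"
proof -
  define a where "a = (\<integral>\<omega>. (X \<omega>)\<^sup>2 \<partial>M)"
  define b where "b = (\<integral>\<omega>. (Y \<omega>)\<^sup>2 \<partial>M)"
  define c where "c = (\<integral>\<omega>. \<bar>X \<omega> * Y \<omega>\<bar> \<partial>M)"
  have ab: "a \<ge> 0" "b \<ge> 0" "c \<ge> 0" by (auto simp: a_def b_def c_def)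
  have i: "integrable M (\<lambda>\<omega>. \<bar>X \<omega> * Y \<omega>\<bar>)" by (intro integrable_abs square_integrable_mult_integrable X Y)
  have q: "2 * s * c \<le> s\<^sup>2 * a + b" for s
  proof -
    have "0 \<le> (\<integral>\<omega>. (s * \<bar>X \<omega>\<bar> - \<bar>Y \<omega>\<bar>)\<^sup>2 \<partial>M)" by simp
    also have "\<dots> = (\<integral>\<omega>. s\<^sup>2 * (X \<omega>)\<^sup>2 - 2 * s * \<bar>X \<omega> * Y \<omega>\<bar> + (Y \<omega>)\<^sup>2 \<partial>M)"
      by (simp add: power2_diff power_mult_distrib abs_mult algebra_simps)
    also have "\<dots> = s\<^sup>2 * a - 2 * s * c + b"
      using i square_integrable_power2[OF X] square_integrable_power2[OF Y] by (simp add: a_def b_def c_def)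
    finally show ?thesis by simp
  qed
  have "c\<^sup>2 \<le> a * b"
  proof (cases "a = 0")
    case True
    have "c = 0"
    proof (rule ccontr)
      assume "c \<noteq> 0"
      with ab have "c > 0" by simp
      then show False using q[of "(b + 1) / (2 * c)"] True by (simp add: field_simps)
    qed
    then show ?thesis using ab by simp
  next
    case False
    with ab have "a > 0" by simp
    then show ?thesis using q[of "c / a"] by (simp add: field_simps power2_eq_square)
  qed
  then have "c \<le> sqrt (a * b)" by (rule real_le_rsqrt)
  then show ?thesis by (simp add: real_sqrt_mult a_def b_def c_def)
qed

lemma (in prob_space) square_integrable_abs_le_sqrt:
  assumes "square_integrable M X"
  shows "(\<integral>\<omega>. \<bar>X \<omega>\<bar> \<partial>M) \<le> sqrt (\<integral>\<omega>. (X \<omega>)\<^sup>2 \<partial>M)"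
  using square_integrable_Cauchy_Schwarz[OF assms square_integrable_const[of 1]] by (simp add: prob_space)

section \<open>Moments of linear and quadratic forms\<close>

definition lin :: "('i \<Rightarrow> real) \<Rightarrow> 'i set \<Rightarrow> ('i \<Rightarrow> real) \<Rightarrow> real" where
  "lin l F x = (\<Sum>s\<in>F. l s * x s)"

definition qf :: "('i \<Rightarrow> 'i \<Rightarrow> real) \<Rightarrow> 'i set \<Rightarrow> ('i \<Rightarrow> real) \<Rightarrow> real" where
  "qf A F x = (\<Sum>s\<in>F. \<Sum>t\<in>F. A s t * x s * x t)"

text \<open>The forms take a coordinate vector rather than a sample point, and see only its
  coordinates in F. Independence needs exactly this: the noise restricted to F can replace the whole
  noise vector.\<close>

lemma lin_restrict [simp]: "lin l F (restrict x F) = lin l F x"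
  by (simp add: lin_def)

lemma qf_restrict [simp]: "qf A F (restrict x F) = qf A F x"
  by (simp add: qf_def)

lemma lin_measurable [measurable]: "lin l F \<in> borel_measurable (PiM F (\<lambda>_. borel))"
  unfolding lin_def[abs_def] by measurable

lemma qf_measurable [measurable]: "qf A F \<in> borel_measurable (PiM F (\<lambda>_. borel))"
  unfolding qf_def[abs_def] by measurable

text \<open>Symmetry merges the row and the column of t into one linear form. The variance induction
  peels off t in this way, and with zero diagonal the same identity is the leave-one-out
  decomposition.\<close>

lemma qf_insert:
  assumes "finite F" "t \<notin> F" and sym: "\<And>s r. A s r = A r s"
  shows "qf A (insert t F) x = qf A F x + 2 * (x t * lin (A t) F x) + A t t * (x t)\<^sup>2"
proof -
  have "(\<Sum>s\<in>F. A s t * x s * x t) = x t * lin (A t) F x"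
    by (simp add: lin_def sum_distrib_left mult_ac sym[of _ t])
  moreover have "(\<Sum>s\<in>F. A t s * x t * x s) = x t * lin (A t) F x"
    by (simp add: lin_def sum_distrib_left mult_ac)
  ultimately show ?thesis
    using assms(1,2) by (simp add: qf_def sum.distrib power2_eq_square mult_ac)
qed

text \<open>Equality of laws enters only through common first, second and fourth moments. Here
  \<kappa> is the fourth moment itself, that is, the excess kurtosis plus 3.\<close>

locale iid_noise = prob_space M for M :: "'a measure" +
  fixes \<xi> :: "'i \<Rightarrow> 'a \<Rightarrow> real" and \<kappa> :: real
  assumes indep: "indep_vars (\<lambda>_. borel) \<xi> UNIV"
    and fourth: "\<And>t. integrable M (\<lambda>\<omega>. (\<xi> t \<omega>) ^ 4)"
    and mean: "\<And>t. expectation (\<xi> t) = 0"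
    and var: "\<And>t. expectation (\<lambda>\<omega>. (\<xi> t \<omega>)\<^sup>2) = 1"
    and kurt: "\<And>t. expectation (\<lambda>\<omega>. (\<xi> t \<omega>) ^ 4) = \<kappa>"
begin

lemma xi_measurable [measurable]: "\<xi> t \<in> borel_measurable M"
  using indep by (auto simp: indep_vars_def)

lemma square_integrable_xi2: "square_integrable M (\<lambda>\<omega>. (\<xi> t \<omega>)\<^sup>2)"
  using fourth[of t] by (simp add: square_integrable_def)

lemma square_integrable_xi: "square_integrable M (\<xi> t)"
  using square_integrable_integrable[OF square_integrable_xi2[of t]] by (simp add: square_integrable_def)

lemma square_integrable_xixi: "square_integrable M (\<lambda>\<omega>. \<xi> s \<omega> * \<xi> t \<omega>)"
  unfolding square_integrable_def using square_integrable_mult_integrable[OF square_integrable_xi2[of s] square_integrable_xi2[of t]]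
  by (simp add: power_mult_distrib)

text \<open>\<open>\<kappa> - 1\<close> is the variance of a squared noise variable. The bound lets
  a factor \<kappa> absorb numerical constants later.\<close>

lemma kappa_ge_1: "\<kappa> \<ge> 1"
proof -
  fix t :: 'i
  have "0 \<le> expectation (\<lambda>\<omega>. ((\<xi> t \<omega>)\<^sup>2 - 1)\<^sup>2)" by simp
  also have "\<dots> = expectation (\<lambda>\<omega>. (\<xi> t \<omega>)^4 - 2 * (\<xi> t \<omega>)\<^sup>2 + 1)"
    by (simp add: power2_diff algebra_simps)
  also have "\<dots> = \<kappa> - 1"
    using fourth[of t] square_integrable_power2[OF square_integrable_xi[of t]] by (simp add: var kurt prob_space)
  finally show ?thesis by simp
qed

lemma square_integrable_lin: "square_integrable M (\<lambda>\<omega>. lin l F (\<lambda>s. \<xi> s \<omega>))"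
  unfolding lin_def by (intro square_integrable_sum square_integrable_cmult square_integrable_xi)

lemma square_integrable_qf: "square_integrable M (\<lambda>\<omega>. qf A F (\<lambda>s. \<xi> s \<omega>))"
  unfolding qf_def mult.assoc by (intro square_integrable_sum square_integrable_cmult square_integrable_xixi)

lemma square_integrable_lin2: "square_integrable M (\<lambda>\<omega>. (lin l F (\<lambda>s. \<xi> s \<omega>))\<^sup>2)"
proof -
  have "(\<lambda>\<omega>. (lin l F (\<lambda>s. \<xi> s \<omega>))\<^sup>2) = (\<lambda>\<omega>. qf (\<lambda>s t. l s * l t) F (\<lambda>s. \<xi> s \<omega>))"
    by (simp add: lin_def qf_def power2_eq_square sum_product mult_ac fun_eq_iff)
  then show ?thesis using square_integrable_qf by simp
qed

text \<open>Stated for a general field since moments are real and characteristic functions complex.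
  The condition \<open>hr\<close> says that h reads only the coordinates in A, so that restricting
  the noise to A does not change the value of h.\<close>

lemma
  fixes h :: "('i \<Rightarrow> real) \<Rightarrow> 'c::{real_normed_field,banach,second_countable_topology}" and g :: "real \<Rightarrow> 'c"
  assumes t: "t \<notin> A" and g: "g \<in> borel_measurable borel" and h: "h \<in> borel_measurable (PiM A (\<lambda>_. borel))"
    and hr: "\<And>x. h (restrict x A) = h x"
    and "integrable M (\<lambda>\<omega>. g (\<xi> t \<omega>))" "integrable M (\<lambda>\<omega>. h (\<lambda>s. \<xi> s \<omega>))"
  shows indep_mult_integrable: "integrable M (\<lambda>\<omega>. g (\<xi> t \<omega>) * h (\<lambda>s. \<xi> s \<omega>))"
    and indep_mult_expectation: "(\<integral>\<omega>. g (\<xi> t \<omega>) * h (\<lambda>s. \<xi> s \<omega>) \<partial>M) = (\<integral>\<omega>. g (\<xi> t \<omega>) \<partial>M) * (\<integral>\<omega>. h (\<lambda>s. \<xi> s \<omega>) \<partial>M)"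
proof -
  have "indep_var (PiM {t} (\<lambda>_. borel)) (\<lambda>\<omega>. restrict (\<lambda>i. \<xi> i \<omega>) {t}) (PiM A (\<lambda>_. borel)) (\<lambda>\<omega>. restrict (\<lambda>i. \<xi> i \<omega>) A)"
    using t by (intro indep_var_restrict[OF indep]) auto
  moreover have "(\<lambda>x. g (x t)) \<in> borel_measurable (PiM {t} (\<lambda>_. borel :: real measure))"
    by (intro measurable_compose[OF _ g] measurable_component_singleton) simp
  ultimately have "indep_var borel ((\<lambda>x. g (x t)) \<circ> (\<lambda>\<omega>. restrict (\<lambda>i. \<xi> i \<omega>) {t})) borel (h \<circ> (\<lambda>\<omega>. restrict (\<lambda>i. \<xi> i \<omega>) A))"
    using h by (rule indep_var_compose)
  then have i: "indep_var borel (\<lambda>\<omega>. g (\<xi> t \<omega>)) borel (\<lambda>\<omega>. h (\<lambda>s. \<xi> s \<omega>))"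
    by (simp add: comp_def hr)
  show "integrable M (\<lambda>\<omega>. g (\<xi> t \<omega>) * h (\<lambda>s. \<xi> s \<omega>))"
    by (rule indep_var_integrable[OF i]) fact+
  show "(\<integral>\<omega>. g (\<xi> t \<omega>) * h (\<lambda>s. \<xi> s \<omega>) \<partial>M) = (\<integral>\<omega>. g (\<xi> t \<omega>) \<partial>M) * (\<integral>\<omega>. h (\<lambda>s. \<xi> s \<omega>) \<partial>M)"
    by (rule indep_var_lebesgue_integral[OF i]) fact+
qed

lemma lin_mean: "expectation (\<lambda>\<omega>. lin l F (\<lambda>s. \<xi> s \<omega>)) = 0"
  unfolding lin_def by (simp add: Bochner_Integration.integral_sum square_integrable_integrable[OF square_integrable_xi] mean)

lemma lin_second_moment:
  assumes "finite F"
  shows "expectation (\<lambda>\<omega>. (lin l F (\<lambda>s. \<xi> s \<omega>))\<^sup>2) = (\<Sum>s\<in>F. (l s)\<^sup>2)"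
  using assms
proof (induction F)
  case empty then show ?case by (simp add: lin_def)
next
  case (insert t F)
  let ?L = "\<lambda>\<omega>. lin l F (\<lambda>s. \<xi> s \<omega>)"
  have i: "integrable M (\<lambda>\<omega>. \<xi> t \<omega> * ?L \<omega>)" and e: "expectation (\<lambda>\<omega>. \<xi> t \<omega> * ?L \<omega>) = 0"
    using indep_mult_integrable[of t F "\<lambda>x. x" "lin l F"] indep_mult_expectation[of t F "\<lambda>x. x" "lin l F"] insert
    by (auto simp: square_integrable_integrable[OF square_integrable_xi] square_integrable_integrable[OF square_integrable_lin] mean)
  have "expectation (\<lambda>\<omega>. (lin l (insert t F) (\<lambda>s. \<xi> s \<omega>))\<^sup>2) =
     expectation (\<lambda>\<omega>. (l t)\<^sup>2 * (\<xi> t \<omega>)\<^sup>2 + 2 * l t * (\<xi> t \<omega> * ?L \<omega>) + (?L \<omega>)\<^sup>2)"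
    using insert by (intro Bochner_Integration.integral_cong) (auto simp: lin_def power2_eq_square algebra_simps)
  also have "\<dots> = (l t)\<^sup>2 + (\<Sum>s\<in>F. (l s)\<^sup>2)"
    using insert i e square_integrable_power2[OF square_integrable_xi] square_integrable_power2[OF square_integrable_lin] by (simp add: var)
  finally show ?case using insert by simp
qed

text \<open>In the expansion at a new index both odd terms vanish by independence and zero means.
  With q the new squared coefficient and S the old sum, the cross term 6 q S must fit into that of 3
  \<kappa> (q + S)^2; this fixes the constant.\<close>

lemma lin_fourth_moment:
  assumes "finite F"
  shows "expectation (\<lambda>\<omega>. (lin l F (\<lambda>s. \<xi> s \<omega>))^4) \<le> 3 * \<kappa> * (\<Sum>s\<in>F. (l s)\<^sup>2)\<^sup>2"
  using assms
proof (induction F)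
  case empty then show ?case by (simp add: lin_def)
next
  case (insert t F)
  let ?L = "\<lambda>\<omega>. lin l F (\<lambda>s. \<xi> s \<omega>)"
  have i4: "integrable M (\<lambda>\<omega>. ?L \<omega>^4)" using square_integrable_power2[OF square_integrable_lin2] by simp
  have i3: "integrable M (\<lambda>\<omega>. ?L \<omega>^3)"
    using square_integrable_mult_integrable[OF square_integrable_lin2 square_integrable_lin] by (simp add: power3_eq_cube power2_eq_square)
  have x3: "integrable M (\<lambda>\<omega>. \<xi> t \<omega>^3)"
    using square_integrable_mult_integrable[OF square_integrable_xi2 square_integrable_xi] by (simp add: power3_eq_cube power2_eq_square)
  note [measurable] = insert
  have a: "integrable M (\<lambda>\<omega>. \<xi> t \<omega> * ?L \<omega>^3)" "expectation (\<lambda>\<omega>. \<xi> t \<omega> * ?L \<omega>^3) = 0"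
    using indep_mult_integrable[of t F "\<lambda>x. x" "\<lambda>x. lin l F x^3"] indep_mult_expectation[of t F "\<lambda>x. x" "\<lambda>x. lin l F x^3"] insert i3
    by (auto simp: square_integrable_integrable[OF square_integrable_xi] mean)
  have b: "integrable M (\<lambda>\<omega>. \<xi> t \<omega>^2 * ?L \<omega>^2)" "expectation (\<lambda>\<omega>. \<xi> t \<omega>^2 * ?L \<omega>^2) = (\<Sum>s\<in>F. (l s)\<^sup>2)"
    using indep_mult_integrable[of t F "\<lambda>x. x^2" "\<lambda>x. lin l F x^2"] indep_mult_expectation[of t F "\<lambda>x. x^2" "\<lambda>x. lin l F x^2"] insert
      square_integrable_power2[OF square_integrable_xi] square_integrable_power2[OF square_integrable_lin]
    by (auto simp: var lin_second_moment)
  have c: "integrable M (\<lambda>\<omega>. \<xi> t \<omega>^3 * ?L \<omega>)" "expectation (\<lambda>\<omega>. \<xi> t \<omega>^3 * ?L \<omega>) = 0"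
    using indep_mult_integrable[of t F "\<lambda>x. x^3" "\<lambda>x. lin l F x"] indep_mult_expectation[of t F "\<lambda>x. x^3" "\<lambda>x. lin l F x"] insert
      x3 square_integrable_integrable[OF square_integrable_lin]
    by (auto simp: lin_mean)
  have p: "(x + y)^4 = x^4 + 4 * (x^3 * y) + 6 * (x^2*y^2) + 4 * (x * y^3) + y^4" for x y :: real
    by (simp add: eval_nat_numeral algebra_simps)
  have "expectation (\<lambda>\<omega>. (lin l (insert t F) (\<lambda>s. \<xi> s \<omega>))^4) =
     expectation (\<lambda>\<omega>. (l t)^4 * \<xi> t \<omega>^4 + 4 * (l t)^3 * (\<xi> t \<omega>^3 * ?L \<omega>) + 6 * (l t)^2 * (\<xi> t \<omega>^2 * ?L \<omega>^2)
       + 4 * l t * (\<xi> t \<omega> * ?L \<omega>^3) + ?L \<omega>^4)"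
  proof (rule Bochner_Integration.integral_cong[OF refl])
    fix \<omega>
    have "lin l (insert t F) (\<lambda>s. \<xi> s \<omega>) = l t * \<xi> t \<omega> + ?L \<omega>" using insert by (simp add: lin_def)
    then show "(lin l (insert t F) (\<lambda>s. \<xi> s \<omega>))^4 = (l t)^4 * \<xi> t \<omega>^4 + 4 * (l t)^3 * (\<xi> t \<omega>^3 * ?L \<omega>) + 6 * (l t)^2 * (\<xi> t \<omega>^2 * ?L \<omega>^2)
       + 4 * l t * (\<xi> t \<omega> * ?L \<omega>^3) + ?L \<omega>^4"
      by (simp add: p power_mult_distrib)
  qed
  also have "\<dots> = (l t)^4 * \<kappa> + 6 * (l t)\<^sup>2 * (\<Sum>s\<in>F. (l s)\<^sup>2) + expectation (\<lambda>\<omega>. ?L \<omega>^4)"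
    using a b c i4 fourth[of t] by (simp add: kurt)
  also have "\<dots> \<le> (l t)^4 * \<kappa> + 6 * (l t)\<^sup>2 * (\<Sum>s\<in>F. (l s)\<^sup>2) + 3 * \<kappa> * (\<Sum>s\<in>F. (l s)\<^sup>2)\<^sup>2"
    using insert by simp
  also have "\<dots> \<le> 3 * \<kappa> * ((l t)\<^sup>2 + (\<Sum>s\<in>F. (l s)\<^sup>2))\<^sup>2"
  proof -
    define S where "S = (\<Sum>s\<in>F. (l s)\<^sup>2)"
    define q where "q = (l t)\<^sup>2"
    have "S \<ge> 0" "q \<ge> 0" by (auto simp: S_def q_def intro: sum_nonneg)
    then have "1 * (q * S) \<le> \<kappa> * (q * S)" using kappa_ge_1 by (intro mult_right_mono) auto
    then have "6 * q * S \<le> 6 * \<kappa> * (q * S)" by simp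
    moreover have "q\<^sup>2 * \<kappa> \<le> 3 * \<kappa> * q\<^sup>2" using kappa_ge_1 by simp
    moreover have "(l t)^4 = q\<^sup>2" by (simp add: q_def)
    ultimately show ?thesis unfolding S_def[symmetric] q_def[symmetric]
      by (simp add: power2_sum algebra_simps)
  qed
  finally show ?case using insert by simp
qed

text \<open>A new index adds an increment whose cross terms, with the old form and within itself,
  all have mean zero. Its off-diagonal part costs 4 times a squared row sum, that is 2 per entry
  since each entry occurs twice, and its diagonal part costs \<kappa> - 1; both rates are at most
  \<kappa> + 1.\<close>

lemma qf_variance:
  assumes "finite F" and sym: "\<And>s r. A s r = A r s"
  shows "expectation (\<lambda>\<omega>. (qf A F (\<lambda>s. \<xi> s \<omega>) - (\<Sum>s\<in>F. A s s))\<^sup>2) \<le> (\<kappa> + 1) * (\<Sum>s\<in>F. \<Sum>t\<in>F. (A s t)\<^sup>2)"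
  using assms(1)
proof (induction F)
  case empty then show ?case by (simp add: qf_def)
next
  case (insert t F)
  let ?L = "\<lambda>\<omega>. lin (A t) F (\<lambda>s. \<xi> s \<omega>)"
  let ?y = "\<lambda>x. qf A F x - (\<Sum>s\<in>F. A s s)"
  let ?Y = "\<lambda>\<omega>. ?y (\<lambda>s. \<xi> s \<omega>)"
  let ?z = "\<lambda>\<omega>. (\<xi> t \<omega>)\<^sup>2 - 1"
  have sY: "square_integrable M ?Y" by (intro square_integrable_diff square_integrable_qf square_integrable_const)
  have sz: "square_integrable M ?z" by (intro square_integrable_diff square_integrable_xi2 square_integrable_const)
  have ez: "expectation ?z = 0" using square_integrable_power2[OF square_integrable_xi] by (simp add: var prob_space)
  have ez2: "expectation (\<lambda>\<omega>. (?z \<omega>)\<^sup>2) = \<kappa> - 1"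
    using fourth[of t] square_integrable_power2[OF square_integrable_xi[of t]] by (simp add: power2_diff kurt var prob_space)
  have a: "integrable M (\<lambda>\<omega>. \<xi> t \<omega>^2 * ?L \<omega>^2)" "expectation (\<lambda>\<omega>. \<xi> t \<omega>^2 * ?L \<omega>^2) = (\<Sum>s\<in>F. (A t s)\<^sup>2)"
    using indep_mult_integrable[of t F "\<lambda>x. x^2" "\<lambda>x. lin (A t) F x^2"] indep_mult_expectation[of t F "\<lambda>x. x^2" "\<lambda>x. lin (A t) F x^2"] insert
      square_integrable_power2[OF square_integrable_xi] square_integrable_power2[OF square_integrable_lin]
    by (auto simp: var lin_second_moment)
  have b: "integrable M (\<lambda>\<omega>. \<xi> t \<omega> * (?Y \<omega> * ?L \<omega>))" "expectation (\<lambda>\<omega>. \<xi> t \<omega> * (?Y \<omega> * ?L \<omega>)) = 0"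
    using indep_mult_integrable[of t F "\<lambda>x. x" "\<lambda>x. ?y x * lin (A t) F x"] indep_mult_expectation[of t F "\<lambda>x. x" "\<lambda>x. ?y x * lin (A t) F x"] insert
      square_integrable_mult_integrable[OF sY square_integrable_lin]
    by (auto simp: square_integrable_integrable[OF square_integrable_xi] mean)
  have c: "integrable M (\<lambda>\<omega>. ?z \<omega> * ?Y \<omega>)" "expectation (\<lambda>\<omega>. ?z \<omega> * ?Y \<omega>) = 0"
    using indep_mult_integrable[of t F "\<lambda>x. x^2 - 1" ?y] indep_mult_expectation[of t F "\<lambda>x. x^2 - 1" ?y] insert
      square_integrable_integrable[OF sY] square_integrable_integrable[OF sz]
    by (auto simp: ez)
  have "integrable M (\<lambda>\<omega>. \<xi> t \<omega> * ?z \<omega>)" using square_integrable_mult_integrable[OF square_integrable_xi sz] .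
  then have d: "integrable M (\<lambda>\<omega>. (\<xi> t \<omega> * ?z \<omega>) * ?L \<omega>)" "expectation (\<lambda>\<omega>. (\<xi> t \<omega> * ?z \<omega>) * ?L \<omega>) = 0"
    using indep_mult_integrable[of t F "\<lambda>x. x * (x^2 - 1)" "lin (A t) F"] indep_mult_expectation[of t F "\<lambda>x. x * (x^2 - 1)" "lin (A t) F"] insert
      square_integrable_integrable[OF square_integrable_lin]
    by (auto simp: lin_mean)
  have "expectation (\<lambda>\<omega>. (qf A (insert t F) (\<lambda>s. \<xi> s \<omega>) - (\<Sum>s\<in>insert t F. A s s))\<^sup>2) =
     expectation (\<lambda>\<omega>. (?Y \<omega>)\<^sup>2 + 4 * (\<xi> t \<omega>^2 * ?L \<omega>^2) + (A t t)\<^sup>2 * (?z \<omega>)\<^sup>2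
        + 4 * (\<xi> t \<omega> * (?Y \<omega> * ?L \<omega>)) + 2 * A t t * (?z \<omega> * ?Y \<omega>) + 4 * A t t * ((\<xi> t \<omega> * ?z \<omega>) * ?L \<omega>))"
  proof (rule Bochner_Integration.integral_cong[OF refl])
    fix \<omega>
    have p: "(y + 2 * (x * l) + r * z)\<^sup>2 = y\<^sup>2 + 4 * (x^2 * l^2) + r\<^sup>2 * z\<^sup>2
        + 4 * (x * (y * l)) + 2 * r * (z * y) + 4 * r * ((x * z) * l)" for y x l r z :: real
      by (simp add: power2_eq_square algebra_simps)
    have "qf A (insert t F) (\<lambda>s. \<xi> s \<omega>) - (\<Sum>s\<in>insert t F. A s s) = ?Y \<omega> + 2 * (\<xi> t \<omega> * ?L \<omega>) + A t t * ?z \<omega>"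
      using insert qf_insert[OF insert(1,2) sym] by (simp add: algebra_simps)
    then show "(qf A (insert t F) (\<lambda>s. \<xi> s \<omega>) - (\<Sum>s\<in>insert t F. A s s))\<^sup>2 = (?Y \<omega>)\<^sup>2 + 4 * (\<xi> t \<omega>^2 * ?L \<omega>^2) + (A t t)\<^sup>2 * (?z \<omega>)\<^sup>2
        + 4 * (\<xi> t \<omega> * (?Y \<omega> * ?L \<omega>)) + 2 * A t t * (?z \<omega> * ?Y \<omega>) + 4 * A t t * ((\<xi> t \<omega> * ?z \<omega>) * ?L \<omega>)"
      by (simp only: p)
  qed
  also have "\<dots> = expectation (\<lambda>\<omega>. (?Y \<omega>)\<^sup>2) + 4 * (\<Sum>s\<in>F. (A t s)\<^sup>2) + (A t t)\<^sup>2 * (\<kappa> - 1)"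
    using a b c d square_integrable_power2[OF sY] square_integrable_power2[OF sz] by (simp add: ez2)
  also have "\<dots> \<le> (\<kappa> + 1) * (\<Sum>s\<in>F. \<Sum>r\<in>F. (A s r)\<^sup>2) + (\<kappa> + 1) * (2 * (\<Sum>s\<in>F. (A t s)\<^sup>2)) + (\<kappa> + 1) * (A t t)\<^sup>2"
  proof (intro add_mono insert.IH)
    have "2 * (2 * (\<Sum>s\<in>F. (A t s)\<^sup>2)) \<le> (\<kappa> + 1) * (2 * (\<Sum>s\<in>F. (A t s)\<^sup>2))"
      using kappa_ge_1 by (intro mult_right_mono) (auto intro: sum_nonneg)
    then show "4 * (\<Sum>s\<in>F. (A t s)\<^sup>2) \<le> (\<kappa> + 1) * (2 * (\<Sum>s\<in>F. (A t s)\<^sup>2))" by simp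
    show "(A t t)\<^sup>2 * (\<kappa> - 1) \<le> (\<kappa> + 1) * (A t t)\<^sup>2" by (simp add: algebra_simps)
  qed
  also have "\<dots> = (\<kappa> + 1) * (\<Sum>s\<in>insert t F. \<Sum>r\<in>insert t F. (A s r)\<^sup>2)"
  proof -
    have "(\<Sum>s\<in>F. (A s t)\<^sup>2) = (\<Sum>s\<in>F. (A t s)\<^sup>2)" using sym by metis
    then show ?thesis using insert by (simp add: sum.distrib distrib_left)
  qed
  finally show ?case .
qed

end

section \<open>Characteristic functions of quadratic forms\<close>

lemma has_vector_derivative_quadratic_bound:
  fixes f :: "real \<Rightarrow> 'b::real_normed_vector"
  assumes "\<And>h. norm (f (x + h) - f x - h *\<^sub>R D) \<le> c * h\<^sup>2"
  shows "(f has_vector_derivative D) (at x)"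
  unfolding has_vector_derivative_def has_derivative_at
proof (intro conjI)
  show "bounded_linear (\<lambda>h. h *\<^sub>R D)" by (rule bounded_linear_scaleR_left)
  show "(\<lambda>h. norm (f (x + h) - f x - h *\<^sub>R D) / norm h) \<midarrow>0\<rightarrow> 0"
  proof (rule tendsto_sandwich[of "\<lambda>_. 0" _ _ "\<lambda>h. c * \<bar>h\<bar>"])
    show "\<forall>\<^sub>F h in at 0. norm (f (x + h) - f x - h *\<^sub>R D) / norm h \<le> c * \<bar>h\<bar>"
    proof (rule always_eventually, rule allI)
      fix h :: real
      show "norm (f (x + h) - f x - h *\<^sub>R D) / norm h \<le> c * \<bar>h\<bar>"
      proof (cases "h = 0")
        case False
        have "norm (f (x + h) - f x - h *\<^sub>R D) \<le> c * \<bar>h\<bar> * \<bar>h\<bar>" using assms[of h] by (simp add: power2_eq_square mult.assoc)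
        then show ?thesis using False by (simp add: divide_le_eq)
      qed simp
    qed
  qed (auto intro!: tendsto_eq_intros)
qed

lemma norm_integral_le:
  fixes f :: "'a \<Rightarrow> 'b::{banach,second_countable_topology}"
  assumes "integrable M f" "integrable M g" "\<And>x. x \<in> space M \<Longrightarrow> norm (f x) \<le> g x"
  shows "norm (\<integral>x. f x \<partial>M) \<le> (\<integral>x. g x \<partial>M)"
  by (rule order_trans[OF integral_norm_bound integral_mono[OF integrable_norm[OF assms(1)] assms(2,3)]])

lemma norm_iexp_diff_le: "cmod (iexp x - iexp y) \<le> \<bar>x - y\<bar>"
proof -
  have "iexp x - iexp y = iexp y * (iexp (x - y) - 1)"
    by (simp add: algebra_simps exp_add[symmetric])
  then show ?thesis using iexp_approx1[of "x - y" 0] by (simp add: norm_mult)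
qed

lemma norm_iexp_diff2_le: "cmod (iexp x - iexp y - \<i> * of_real (x - y) * iexp y) \<le> (x - y)\<^sup>2 / 2"
proof -
  have "iexp x - iexp y - \<i> * of_real (x - y) * iexp y = iexp y * (iexp (x - y) - (1 + \<i> * of_real (x - y)))"
    by (simp add: algebra_simps exp_add[symmetric])
  then show ?thesis using iexp_approx1[of "x - y" 1] by (simp add: norm_mult power2_eq_square)
qed

context prob_space
begin

lemma integrable_of_real_iexp:
  assumes "integrable M X" "Y \<in> borel_measurable M"
  shows "integrable M (\<lambda>\<omega>. complex_of_real (X \<omega>) * iexp (Y \<omega>))"
  by (rule Bochner_Integration.integrable_bound[OF assms(1)]) (use assms in \<open>auto simp: norm_mult\<close>)

lemma integrable_iexp_real:
  assumes "Y \<in> borel_measurable M"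
  shows "integrable M (\<lambda>\<omega>. iexp (Y \<omega>))"
  using integrable_of_real_iexp[of "\<lambda>_. 1", OF _ assms] by simp

text \<open>\<open>iexp\<close> is Lipschitz with constant 1, so closeness in mean transfers to
  characteristic functions. Used to discard the diagonal of a form and to truncate the noise
  series.\<close>

lemma char_diff_le:
  assumes "integrable M X" "integrable M Y"
  shows "cmod ((CLINT \<omega>|M. iexp (\<theta> * X \<omega>)) - (CLINT \<omega>|M. iexp (\<theta> * Y \<omega>))) \<le> \<bar>\<theta>\<bar> * expectation (\<lambda>\<omega>. \<bar>X \<omega> - Y \<omega>\<bar>)"
proof -
  have i: "integrable M (\<lambda>\<omega>. iexp (\<theta> * X \<omega>))" "integrable M (\<lambda>\<omega>. iexp (\<theta> * Y \<omega>))"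
    using assms by (intro integrable_iexp_real; simp)+
  have "(CLINT \<omega>|M. iexp (\<theta> * X \<omega>)) - (CLINT \<omega>|M. iexp (\<theta> * Y \<omega>)) = (CLINT \<omega>|M. iexp (\<theta> * X \<omega>) - iexp (\<theta> * Y \<omega>))"
    by (rule Bochner_Integration.integral_diff[OF i, symmetric])
  also have "cmod \<dots> \<le> expectation (\<lambda>\<omega>. \<bar>\<theta>\<bar> * \<bar>X \<omega> - Y \<omega>\<bar>)"
  proof (rule norm_integral_le)
    show "integrable M (\<lambda>\<omega>. iexp (\<theta> * X \<omega>) - iexp (\<theta> * Y \<omega>))" using i by simp
    show "integrable M (\<lambda>\<omega>. \<bar>\<theta>\<bar> * \<bar>X \<omega> - Y \<omega>\<bar>)" using assms by simp
    show "cmod (iexp (\<theta> * X \<omega>) - iexp (\<theta> * Y \<omega>)) \<le> \<bar>\<theta>\<bar> * \<bar>X \<omega> - Y \<omega>\<bar>" for \<omega>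
      using norm_iexp_diff_le[of "\<theta> * X \<omega>" "\<theta> * Y \<omega>"] by (simp add: abs_mult[symmetric] algebra_simps)
  qed
  finally show ?thesis by simp
qed

text \<open>The second-order Taylor remainder of \<open>iexp\<close> is at most half of
  \<open>h\<^sup>2\<close> times the square of Q, which is integrable. A quadratic estimate for the
  difference quotient thus replaces any interchange of limit and integral.\<close>

lemma char_has_vector_derivative:
  assumes "square_integrable M Q"
  shows "((\<lambda>\<theta>. CLINT \<omega>|M. iexp (\<theta> * Q \<omega>)) has_vector_derivative (\<i> * (CLINT \<omega>|M. Q \<omega> * iexp (\<theta> * Q \<omega>)))) (at \<theta>)"
proof (rule has_vector_derivative_quadratic_bound[where c = "expectation (\<lambda>\<omega>. (Q \<omega>)\<^sup>2) / 2"])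
  fix h :: real
  note [measurable] = square_integrable_measurable[OF assms]
  have i: "integrable M (\<lambda>\<omega>. iexp (x * Q \<omega>))" for x
    by (intro integrable_iexp_real) simp
  have j: "integrable M (\<lambda>\<omega>. complex_of_real (Q \<omega>) * iexp (\<theta> * Q \<omega>))"
    by (intro integrable_of_real_iexp square_integrable_integrable assms) simp
  have "(CLINT \<omega>|M. iexp ((\<theta> + h) * Q \<omega>)) - (CLINT \<omega>|M. iexp (\<theta> * Q \<omega>)) - h *\<^sub>R (\<i> * (CLINT \<omega>|M. Q \<omega> * iexp (\<theta> * Q \<omega>)))
     = (CLINT \<omega>|M. iexp ((\<theta> + h) * Q \<omega>) - iexp (\<theta> * Q \<omega>) - (h * \<i>) * (Q \<omega> * iexp (\<theta> * Q \<omega>)))"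
    using i[of "\<theta> + h"] i[of \<theta>] j by (simp add: scaleR_conv_of_real)
  also have "cmod \<dots> \<le> expectation (\<lambda>\<omega>. h\<^sup>2 / 2 * (Q \<omega>)\<^sup>2)"
  proof (rule norm_integral_le)
    show "integrable M (\<lambda>\<omega>. iexp ((\<theta> + h) * Q \<omega>) - iexp (\<theta> * Q \<omega>) - (h * \<i>) * (Q \<omega> * iexp (\<theta> * Q \<omega>)))"
      using i[of "\<theta> + h"] i[of \<theta>] j by (intro Bochner_Integration.integrable_diff integrable_mult_right)
    show "integrable M (\<lambda>\<omega>. h\<^sup>2 / 2 * (Q \<omega>)\<^sup>2)" using square_integrable_power2[OF assms] by simp
    show "cmod (iexp ((\<theta> + h) * Q \<omega>) - iexp (\<theta> * Q \<omega>) - (h * \<i>) * (Q \<omega> * iexp (\<theta> * Q \<omega>))) \<le> h\<^sup>2 / 2 * (Q \<omega>)\<^sup>2" for \<omega>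
      using norm_iexp_diff2_le[of "(\<theta> + h) * Q \<omega>" "\<theta> * Q \<omega>"]
      by (simp add: algebra_simps power_mult_distrib)
  qed
  finally show "cmod ((CLINT \<omega>|M. iexp ((\<theta> + h) * Q \<omega>)) - (CLINT \<omega>|M. iexp (\<theta> * Q \<omega>)) - h *\<^sub>R (\<i> * (CLINT \<omega>|M. Q \<omega> * iexp (\<theta> * Q \<omega>))))
     \<le> expectation (\<lambda>\<omega>. (Q \<omega>)\<^sup>2) / 2 * h\<^sup>2"
    using square_integrable_power2[OF assms] by (simp add: mult_ac)
qed

end

context iid_noise
begin

lemma xi_abs_mean: "expectation (\<lambda>\<omega>. \<bar>\<xi> t \<omega>\<bar>) \<le> 1"
  using square_integrable_abs_le_sqrt[OF square_integrable_xi] by (simp add: var)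

text \<open>Weighted AM-GM. The weight is free: after summation over the rows of the matrix, the
  second moments stay bounded and the fourth ones are of order \<open>\<eta>\<^sup>2\<close>, so
  that both halves become of order \<eta>.\<close>

lemma abs_cube_le:
  fixes y \<eta> :: real
  assumes "\<eta> > 0"
  shows "\<bar>y\<bar>^3 \<le> (\<eta> * y\<^sup>2 + y^4 / \<eta>) / 2"
proof -
  have "0 \<le> (\<eta> * \<bar>y\<bar> - y\<^sup>2)\<^sup>2 / (2 * \<eta>)" using assms by simp
  also have "\<dots> = (\<eta> * y\<^sup>2 + y^4 / \<eta>) / 2 - \<bar>y\<bar>^3"
    using assms by (simp add: field_simps power2_eq_square eval_nat_numeral abs_mult_self_eq)
  finally show ?thesis by simp
qed

lemma xi_abs_cube: "integrable M (\<lambda>\<omega>. \<bar>\<xi> t \<omega>\<bar>^3)" "expectation (\<lambda>\<omega>. \<bar>\<xi> t \<omega>\<bar>^3) \<le> \<kappa>"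
proof -
  have i: "integrable M (\<lambda>\<omega>. ((\<xi> t \<omega>)\<^sup>2 + (\<xi> t \<omega>)^4) / 2)" using square_integrable_power2[OF square_integrable_xi[of t]] fourth[of t] by simp
  show j: "integrable M (\<lambda>\<omega>. \<bar>\<xi> t \<omega>\<bar>^3)"
    by (rule Bochner_Integration.integrable_bound[OF i]) (use abs_cube_le[of 1] in auto)
  have "expectation (\<lambda>\<omega>. \<bar>\<xi> t \<omega>\<bar>^3) \<le> expectation (\<lambda>\<omega>. ((\<xi> t \<omega>)\<^sup>2 + (\<xi> t \<omega>)^4) / 2)"
    by (rule integral_mono[OF j i]) (use abs_cube_le[of 1] in auto)
  also have "\<dots> = (1 + \<kappa>) / 2" using square_integrable_power2[OF square_integrable_xi[of t]] fourth[of t] by (simp add: var kurt)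
  finally show "expectation (\<lambda>\<omega>. \<bar>\<xi> t \<omega>\<bar>^3) \<le> \<kappa>" using kappa_ge_1 by simp
qed

lemma lin_abs_cube:
  assumes "finite F" "\<eta> > 0"
  shows "integrable M (\<lambda>\<omega>. \<bar>lin l F (\<lambda>s. \<xi> s \<omega>)\<bar>^3)"
    "expectation (\<lambda>\<omega>. \<bar>lin l F (\<lambda>s. \<xi> s \<omega>)\<bar>^3) \<le> (\<eta> * (\<Sum>s\<in>F. (l s)\<^sup>2) + 3 * \<kappa> * (\<Sum>s\<in>F. (l s)\<^sup>2)\<^sup>2 / \<eta>) / 2"
proof -
  let ?L = "\<lambda>\<omega>. lin l F (\<lambda>s. \<xi> s \<omega>)"
  have L4: "integrable M (\<lambda>\<omega>. (?L \<omega>)^4)" using square_integrable_power2[OF square_integrable_lin2] by simp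
  note [measurable] = square_integrable_measurable[OF square_integrable_lin]
  have i: "integrable M (\<lambda>\<omega>. (\<eta> * (?L \<omega>)\<^sup>2 + (?L \<omega>)^4 / \<eta>) / 2)" using square_integrable_power2[OF square_integrable_lin] L4 by simp
  show j: "integrable M (\<lambda>\<omega>. \<bar>?L \<omega>\<bar>^3)"
    by (rule Bochner_Integration.integrable_bound[OF i]) (use abs_cube_le[OF assms(2)] assms in auto)
  have "expectation (\<lambda>\<omega>. \<bar>?L \<omega>\<bar>^3) \<le> expectation (\<lambda>\<omega>. (\<eta> * (?L \<omega>)\<^sup>2 + (?L \<omega>)^4 / \<eta>) / 2)"
    by (rule integral_mono[OF j i]) (use abs_cube_le[OF assms(2)] in auto)
  also have "\<dots> = (\<eta> * (\<Sum>s\<in>F. (l s)\<^sup>2) + expectation (\<lambda>\<omega>. (?L \<omega>)^4) / \<eta>) / 2"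
    using square_integrable_power2[OF square_integrable_lin] L4 assms by (simp add: lin_second_moment)
  also have "\<dots> \<le> (\<eta> * (\<Sum>s\<in>F. (l s)\<^sup>2) + 3 * \<kappa> * (\<Sum>s\<in>F. (l s)\<^sup>2)\<^sup>2 / \<eta>) / 2"
    using lin_fourth_moment[OF assms(1), of l] assms(2) by (simp add: divide_right_mono)
  finally show "expectation (\<lambda>\<omega>. \<bar>?L \<omega>\<bar>^3) \<le> (\<eta> * (\<Sum>s\<in>F. (l s)\<^sup>2) + 3 * \<kappa> * (\<Sum>s\<in>F. (l s)\<^sup>2)\<^sup>2 / \<eta>) / 2" .
qed

text \<open>A substitute for integration by parts under a general noise law. With R the form without
  index t, zero diagonal gives \<open>Q = R + 2 * (\<xi> t * L)\<close>, where R and L are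
  independent of \<open>\<xi> t\<close>. Expanding \<open>iexp\<close> around R, the constant term
  has mean zero, the linear term turns the squared noise into its mean 1, and going back from R to Q
  costs one more order in L.\<close>

lemma Stein_step:
  assumes F: "finite F" "t \<in> F" and sym: "\<And>s r. b s r = b r s" and diag: "b t t = 0"
  defines "L \<equiv> \<lambda>\<omega>. lin (b t) F (\<lambda>s. \<xi> s \<omega>)" and "Q \<equiv> \<lambda>\<omega>. qf b F (\<lambda>s. \<xi> s \<omega>)"
  shows "cmod ((CLINT \<omega>|M. of_real (\<xi> t \<omega> * L \<omega>) * iexp (\<theta> * Q \<omega>)) - 2 * \<i> * \<theta> * (CLINT \<omega>|M. of_real ((L \<omega>)\<^sup>2) * iexp (\<theta> * Q \<omega>)))
     \<le> 6 * \<theta>\<^sup>2 * \<kappa> * expectation (\<lambda>\<omega>. \<bar>L \<omega>\<bar>^3)"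
proof -
  define G where "G = F - {t}"
  have G: "finite G" "t \<notin> G" "F = insert t G" using F by (auto simp: G_def)
  have L: "L = (\<lambda>\<omega>. lin (b t) G (\<lambda>s. \<xi> s \<omega>))"
    using G diag by (simp add: L_def lin_def fun_eq_iff)
  define R where "R = (\<lambda>\<omega>. qf b G (\<lambda>s. \<xi> s \<omega>))"
  have QR: "Q \<omega> = R \<omega> + 2 * (\<xi> t \<omega> * L \<omega>)" for \<omega>
    using qf_insert[OF G(1,2) sym] diag by (simp add: Q_def R_def G(3) L)
  have sL: "square_integrable M L" unfolding L by (rule square_integrable_lin)
  have sL2: "square_integrable M (\<lambda>\<omega>. (L \<omega>)\<^sup>2)" unfolding L by (rule square_integrable_lin2)
  have sR: "square_integrable M R" unfolding R_def by (rule square_integrable_qf)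
  note [measurable] = square_integrable_measurable[OF sL] square_integrable_measurable[OF sR]
  have Qm [measurable]: "Q \<in> borel_measurable M" unfolding QR[abs_def] by measurable
  have xL: "integrable M (\<lambda>\<omega>. \<xi> t \<omega> * L \<omega>)" by (intro square_integrable_mult_integrable square_integrable_xi sL)
  have L2: "integrable M (\<lambda>\<omega>. (L \<omega>)\<^sup>2)" by (rule square_integrable_power2[OF sL])
  have L3: "integrable M (\<lambda>\<omega>. \<bar>L \<omega>\<bar>^3)" unfolding L by (rule lin_abs_cube[OF G(1), of 1]) simp
  \<comment> \<open>The constant term of the expansion and, in \<open>f2\<close>, the part of the
    linear term left after replacing the squared noise by 1. Both have mean zero by
    independence.\<close>
  define f1 where "f1 = (\<lambda>\<omega>. complex_of_real (\<xi> t \<omega>) * (of_real (L \<omega>) * iexp (\<theta> * R \<omega>)))"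
  define f2 where "f2 = (\<lambda>\<omega>. complex_of_real ((\<xi> t \<omega>)\<^sup>2 - 1) * (of_real ((L \<omega>)\<^sup>2) * iexp (\<theta> * R \<omega>)))"
  have iLR: "integrable M (\<lambda>\<omega>. complex_of_real (L \<omega>) * iexp (\<theta> * R \<omega>))"
    by (intro integrable_of_real_iexp square_integrable_integrable sL) simp
  have iL2R: "integrable M (\<lambda>\<omega>. complex_of_real ((L \<omega>)\<^sup>2) * iexp (\<theta> * R \<omega>))"
    by (intro integrable_of_real_iexp L2) simp
  have f1: "integrable M f1" "(CLINT \<omega>|M. f1 \<omega>) = 0"
    using indep_mult_integrable[of t G complex_of_real "\<lambda>x. of_real (lin (b t) G x) * iexp (\<theta> * qf b G x)"]
      indep_mult_expectation[of t G complex_of_real "\<lambda>x. of_real (lin (b t) G x) * iexp (\<theta> * qf b G x)"]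
      G(2) iLR square_integrable_integrable[OF square_integrable_xi]
    by (auto simp: f1_def L R_def mean)
  have sz: "square_integrable M (\<lambda>\<omega>. (\<xi> t \<omega>)\<^sup>2 - 1)" by (intro square_integrable_diff square_integrable_xi2 square_integrable_const)
  have "integrable M (\<lambda>\<omega>. complex_of_real ((\<xi> t \<omega>)\<^sup>2 - 1))"
    by (rule integrable_of_real[OF square_integrable_integrable[OF sz]])
  moreover have "(CLINT \<omega>|M. complex_of_real ((\<xi> t \<omega>)\<^sup>2 - 1)) = 0"
    unfolding integral_complex_of_real using square_integrable_power2[OF square_integrable_xi[of t]] by (simp add: var prob_space)
  ultimately have f2: "integrable M f2" "(CLINT \<omega>|M. f2 \<omega>) = 0"
    using indep_mult_integrable[of t G "\<lambda>x. complex_of_real (x\<^sup>2 - 1)" "\<lambda>x. of_real ((lin (b t) G x)\<^sup>2) * iexp (\<theta> * qf b G x)"]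
      indep_mult_expectation[of t G "\<lambda>x. complex_of_real (x\<^sup>2 - 1)" "\<lambda>x. of_real ((lin (b t) G x)\<^sup>2) * iexp (\<theta> * qf b G x)"]
      G(2) iL2R
    by (simp_all add: f2_def L R_def del: of_real_power of_real_diff)
  define f where "f = (\<lambda>\<omega>. of_real (\<xi> t \<omega> * L \<omega>) * iexp (\<theta> * Q \<omega>) - 2 * \<i> * \<theta> * (of_real ((L \<omega>)\<^sup>2) * iexp (\<theta> * Q \<omega>)))"
  have i1: "integrable M (\<lambda>\<omega>. complex_of_real (\<xi> t \<omega> * L \<omega>) * iexp (\<theta> * Q \<omega>))"
    and i2: "integrable M (\<lambda>\<omega>. complex_of_real ((L \<omega>)\<^sup>2) * iexp (\<theta> * Q \<omega>))"
    by (intro integrable_of_real_iexp xL L2; simp)+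
  have fi: "integrable M f" unfolding f_def by (intro Bochner_Integration.integrable_diff integrable_mult_right i1 i2)
  \<comment> \<open>First summand: the Taylor remainder times \<open>\<xi> t * L\<close>. Second
    summand: the cost of exchanging R for Q in the term with the square of L. The third and first
    absolute noise moments are both at most \<kappa>, which gives 2 + 4 = 6 in the claim.\<close>
  define u where "u = (\<lambda>\<omega>. (2 * \<theta>\<^sup>2 * \<bar>\<xi> t \<omega>\<bar>^3 + 4 * \<theta>\<^sup>2 * \<bar>\<xi> t \<omega>\<bar>) * \<bar>L \<omega>\<bar>^3)"
  have gi: "integrable M (\<lambda>\<omega>. 2 * \<theta>\<^sup>2 * \<bar>\<xi> t \<omega>\<bar>^3 + 4 * \<theta>\<^sup>2 * \<bar>\<xi> t \<omega>\<bar>)"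
    using xi_abs_cube(1)[of t] square_integrable_integrable[OF square_integrable_xi] by simp
  have ui: "integrable M u"
    and ue: "expectation u = expectation (\<lambda>\<omega>. 2 * \<theta>\<^sup>2 * \<bar>\<xi> t \<omega>\<bar>^3 + 4 * \<theta>\<^sup>2 * \<bar>\<xi> t \<omega>\<bar>) * expectation (\<lambda>\<omega>. \<bar>L \<omega>\<bar>^3)"
    using indep_mult_integrable[of t G "\<lambda>x. 2 * \<theta>\<^sup>2 * \<bar>x\<bar>^3 + 4 * \<theta>\<^sup>2 * \<bar>x\<bar>" "\<lambda>x. \<bar>lin (b t) G x\<bar>^3"]
      indep_mult_expectation[of t G "\<lambda>x. 2 * \<theta>\<^sup>2 * \<bar>x\<bar>^3 + 4 * \<theta>\<^sup>2 * \<bar>x\<bar>" "\<lambda>x. \<bar>lin (b t) G x\<bar>^3"]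
      G(2) gi L3
    by (simp_all add: u_def L)
  have bound: "cmod (f \<omega> - f1 \<omega> - 2 * \<i> * \<theta> * f2 \<omega>) \<le> u \<omega>" for \<omega>
  proof -
    define e where "e = iexp (\<theta> * Q \<omega>)"
    define e' where "e' = iexp (\<theta> * R \<omega>)"
    define x where "x = \<xi> t \<omega>"
    define l where "l = L \<omega>"
    have d: "\<theta> * Q \<omega> - \<theta> * R \<omega> = 2 * \<theta> * x * l" by (simp add: QR x_def l_def algebra_simps)
    have n1: "cmod (e - e' - \<i> * of_real (2 * \<theta> * x * l) * e') \<le> (2 * \<theta> * x * l)\<^sup>2 / 2"
      using norm_iexp_diff2_le[of "\<theta> * Q \<omega>" "\<theta> * R \<omega>"] unfolding d e_def e'_def .
    have n2: "cmod (e - e') \<le> \<bar>2 * \<theta> * x * l\<bar>"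
      using norm_iexp_diff_le[of "\<theta> * Q \<omega>" "\<theta> * R \<omega>"] unfolding d e_def e'_def .
    have "f \<omega> - f1 \<omega> - 2 * \<i> * \<theta> * f2 \<omega> = of_real (x * l) * (e - e' - \<i> * of_real (2 * \<theta> * x * l) * e') - 2 * \<i> * \<theta> * of_real (l\<^sup>2) * (e - e')"
      unfolding f_def f1_def f2_def e_def[symmetric] e'_def[symmetric] x_def[symmetric] l_def[symmetric]
      by (simp add: algebra_simps power2_eq_square)
    also have "cmod \<dots> \<le> cmod (of_real (x * l) * (e - e' - \<i> * of_real (2 * \<theta> * x * l) * e')) + cmod (2 * \<i> * \<theta> * of_real (l\<^sup>2) * (e - e'))"
      by (rule norm_triangle_ineq4)
    also have "\<dots> \<le> \<bar>x * l\<bar> * ((2 * \<theta> * x * l)\<^sup>2 / 2) + 2 * \<bar>\<theta>\<bar> * l\<^sup>2 * \<bar>2 * \<theta> * x * l\<bar>"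
      unfolding norm_mult using n1 n2 by (intro add_mono mult_mono) (auto simp: abs_mult norm_mult norm_power)
    also have "\<dots> = u \<omega>"
    proof -
      have "\<bar>x * l\<bar> * ((2 * \<theta> * x * l)\<^sup>2 / 2) = 2 * \<theta>\<^sup>2 * \<bar>x\<bar>^3 * \<bar>l\<bar>^3"
        by (simp add: abs_mult power_mult_distrib power3_eq_cube power2_eq_square)
      moreover have "2 * \<bar>\<theta>\<bar> * l\<^sup>2 * \<bar>2 * \<theta> * x * l\<bar> = 4 * \<theta>\<^sup>2 * \<bar>x\<bar> * \<bar>l\<bar>^3"
        by (simp add: abs_mult power3_eq_cube power2_eq_square)
      moreover have "u \<omega> = 2 * \<theta>\<^sup>2 * \<bar>x\<bar>^3 * \<bar>l\<bar>^3 + 4 * \<theta>\<^sup>2 * \<bar>x\<bar> * \<bar>l\<bar>^3"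
        unfolding u_def x_def l_def by (rule distrib_right)
      ultimately show ?thesis by linarith
    qed
    finally show ?thesis .
  qed
  have "(CLINT \<omega>|M. of_real (\<xi> t \<omega> * L \<omega>) * iexp (\<theta> * Q \<omega>)) - 2 * \<i> * \<theta> * (CLINT \<omega>|M. of_real ((L \<omega>)\<^sup>2) * iexp (\<theta> * Q \<omega>)) = (CLINT \<omega>|M. f \<omega>)"
    unfolding f_def using i1 i2 by simp
  also have "\<dots> = (CLINT \<omega>|M. f \<omega> - f1 \<omega> - 2 * \<i> * \<theta> * f2 \<omega>)"
    using fi f1 f2 by simp
  also have "cmod \<dots> \<le> expectation u"
    by (rule norm_integral_le) (use fi f1 f2 ui bound in auto)
  also have "\<dots> = (2 * \<theta>\<^sup>2 * expectation (\<lambda>\<omega>. \<bar>\<xi> t \<omega>\<bar>^3) + 4 * \<theta>\<^sup>2 * expectation (\<lambda>\<omega>. \<bar>\<xi> t \<omega>\<bar>)) * expectation (\<lambda>\<omega>. \<bar>L \<omega>\<bar>^3)"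
    unfolding ue using xi_abs_cube(1)[of t] square_integrable_integrable[OF square_integrable_xi] by simp
  also have "\<dots> \<le> (2 * \<theta>\<^sup>2 * \<kappa> + 4 * \<theta>\<^sup>2 * \<kappa>) * expectation (\<lambda>\<omega>. \<bar>L \<omega>\<bar>^3)"
    using xi_abs_cube(2)[of t] xi_abs_mean[of t] kappa_ge_1
    by (intro mult_right_mono add_mono mult_left_mono) (auto intro: integral_nonneg_AE)
  also have "2 * \<theta>\<^sup>2 * \<kappa> + 4 * \<theta>\<^sup>2 * \<kappa> = 6 * \<theta>\<^sup>2 * \<kappa>" by simp
  finally show ?thesis .
qed

end

context iid_noise
begin

abbreviation "qchar b F \<theta> \<equiv> (CLINT \<omega>|M. iexp (\<theta> * qf b F (\<lambda>s. \<xi> s \<omega>)))"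

text \<open>Up to a factor of modulus one this bounds the defect in the differential equation of the
  characteristic function. Q is the sum of \<open>\<xi> t * L t\<close>, so the Stein steps replace
  it by 2 \<i> \<theta> S with S the sum of the squared row forms. S is itself a quadratic form,
  with matrix the square of b and mean \<sigma>; its variance is controlled by the trace of the
  fourth power of b, so that S may be replaced by \<sigma>.\<close>

lemma qf_char_ode:
  assumes F: "finite F" and sym: "\<And>s r. b s r = b r s" and diag: "\<And>t. b t t = 0"
    and \<eta>: "\<eta> > 0" and T: "(\<Sum>s\<in>F. \<Sum>t\<in>F. (\<Sum>r\<in>F. b s r * b r t)\<^sup>2) \<le> \<eta>\<^sup>2"
  defines "\<sigma> \<equiv> \<Sum>s\<in>F. \<Sum>t\<in>F. (b s t)\<^sup>2"
  shows "cmod ((CLINT \<omega>|M. of_real (qf b F (\<lambda>s. \<xi> s \<omega>)) * iexp (\<theta> * qf b F (\<lambda>s. \<xi> s \<omega>))) - 2 * \<i> * \<theta> * \<sigma> * qchar b F \<theta>)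
    \<le> \<eta> * (3 * \<theta>\<^sup>2 * \<kappa> * (\<sigma> + 3 * \<kappa>) + 2 * \<bar>\<theta>\<bar> * sqrt (\<kappa> + 1))"
proof -
  define L where "L t \<omega> = lin (b t) F (\<lambda>s. \<xi> s \<omega>)" for t \<omega>
  define Q where "Q \<omega> = qf b F (\<lambda>s. \<xi> s \<omega>)" for \<omega>
  define B where "B s t = (\<Sum>r\<in>F. b s r * b r t)" for s t
  define S where "S \<omega> = (\<Sum>t\<in>F. (L t \<omega>)\<^sup>2)" for \<omega>
  have sL: "square_integrable M (L t)" for t unfolding L_def by (rule square_integrable_lin)
  have sL2: "square_integrable M (\<lambda>\<omega>. (L t \<omega>)\<^sup>2)" for t unfolding L_def by (rule square_integrable_lin2)
  have sQ: "square_integrable M Q" unfolding Q_def by (rule square_integrable_qf)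
  have [measurable]: "Q \<in> borel_measurable M" by (rule square_integrable_measurable[OF sQ])
  have Bs: "B s t = B t s" for s t unfolding B_def by (intro sum.cong) (auto simp: sym mult.commute)
  have Bd: "B t t = (\<Sum>s\<in>F. (b t s)\<^sup>2)" for t unfolding B_def by (intro sum.cong) (auto simp: power2_eq_square sym)
  have trB: "(\<Sum>t\<in>F. B t t) = \<sigma>" unfolding Bd \<sigma>_def ..
  have S_qf: "S \<omega> = qf B F (\<lambda>s. \<xi> s \<omega>)" for \<omega>
  proof -
    have "S \<omega> = (\<Sum>t\<in>F. \<Sum>s\<in>F. \<Sum>r\<in>F. b t s * b t r * \<xi> s \<omega> * \<xi> r \<omega>)"
      unfolding S_def L_def lin_def power2_eq_square sum_product by (simp add: mult_ac)
    also have "\<dots> = (\<Sum>s\<in>F. \<Sum>r\<in>F. \<Sum>t\<in>F. b t s * b t r * \<xi> s \<omega> * \<xi> r \<omega>)"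
      by (subst sum.swap) (intro sum.cong refl sum.swap)
    also have "\<dots> = qf B F (\<lambda>s. \<xi> s \<omega>)"
      unfolding qf_def B_def sum_distrib_right by (intro sum.cong refl) (auto simp: sym)
    finally show ?thesis .
  qed
  have Q_sum: "Q \<omega> = (\<Sum>t\<in>F. \<xi> t \<omega> * L t \<omega>)" for \<omega>
    unfolding Q_def qf_def L_def lin_def sum_distrib_left by (simp add: mult_ac)
  define I where "I t = (\<Sum>s\<in>F. (b t s)\<^sup>2)" for t
  \<comment> \<open>The squared row norms of b are the diagonal entries of its square, hence the
    trace hypothesis bounds the sum of their squares.\<close>
  have I2: "(\<Sum>t\<in>F. (I t)\<^sup>2) \<le> \<eta>\<^sup>2"
  proof -
    have "(\<Sum>t\<in>F. (I t)\<^sup>2) = (\<Sum>t\<in>F. (B t t)\<^sup>2)" by (simp add: I_def Bd)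
    also have "\<dots> \<le> (\<Sum>s\<in>F. \<Sum>t\<in>F. (B s t)\<^sup>2)"
      using F by (intro sum_mono member_le_sum) auto
    also have "\<dots> \<le> \<eta>\<^sup>2" using T by (simp add: B_def)
    finally show ?thesis .
  qed
  define e1 where "e1 t = (CLINT \<omega>|M. of_real (\<xi> t \<omega> * L t \<omega>) * iexp (\<theta> * Q \<omega>))" for t
  define e2 where "e2 t = (CLINT \<omega>|M. of_real ((L t \<omega>)\<^sup>2) * iexp (\<theta> * Q \<omega>))" for t
  have i1: "integrable M (\<lambda>\<omega>. complex_of_real (\<xi> t \<omega> * L t \<omega>) * iexp (\<theta> * Q \<omega>))" for t
    by (intro integrable_of_real_iexp square_integrable_mult_integrable square_integrable_xi sL) simp
  have i2: "integrable M (\<lambda>\<omega>. complex_of_real ((L t \<omega>)\<^sup>2) * iexp (\<theta> * Q \<omega>))" for t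
    by (intro integrable_of_real_iexp square_integrable_power2 sL) simp
  have E1: "(CLINT \<omega>|M. of_real (Q \<omega>) * iexp (\<theta> * Q \<omega>)) = (\<Sum>t\<in>F. e1 t)"
  proof -
    have "(CLINT \<omega>|M. of_real (Q \<omega>) * iexp (\<theta> * Q \<omega>)) = (CLINT \<omega>|M. \<Sum>t\<in>F. of_real (\<xi> t \<omega> * L t \<omega>) * iexp (\<theta> * Q \<omega>))"
      by (intro Bochner_Integration.integral_cong refl) (simp add: Q_sum sum_distrib_right)
    then show ?thesis unfolding e1_def using i1 by (simp add: Bochner_Integration.integral_sum)
  qed
  have E2: "(CLINT \<omega>|M. of_real (S \<omega>) * iexp (\<theta> * Q \<omega>)) = (\<Sum>t\<in>F. e2 t)"
  proof -
    have "(CLINT \<omega>|M. of_real (S \<omega>) * iexp (\<theta> * Q \<omega>)) = (CLINT \<omega>|M. \<Sum>t\<in>F. of_real ((L t \<omega>)\<^sup>2) * iexp (\<theta> * Q \<omega>))"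
      by (intro Bochner_Integration.integral_cong refl) (simp add: S_def sum_distrib_right)
    then show ?thesis unfolding e2_def using i2 by (simp add: Bochner_Integration.integral_sum)
  qed
  have "cmod ((\<Sum>t\<in>F. e1 t) - 2 * \<i> * \<theta> * (\<Sum>t\<in>F. e2 t)) = cmod (\<Sum>t\<in>F. e1 t - 2 * \<i> * \<theta> * e2 t)"
    by (simp add: sum_subtractf sum_distrib_left)
  also have "\<dots> \<le> (\<Sum>t\<in>F. 6 * \<theta>\<^sup>2 * \<kappa> * expectation (\<lambda>\<omega>. \<bar>L t \<omega>\<bar>^3))"
    unfolding e1_def e2_def L_def Q_def
    by (intro sum_norm_le Stein_step F sym diag)
  \<comment> \<open>The weight in the cube bound is the \<eta> of the trace hypothesis: the
    \<open>I t\<close> add up to \<sigma> and their squares to at most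
    \<open>\<eta>\<^sup>2\<close>.\<close>
  also have "\<dots> \<le> (\<Sum>t\<in>F. 6 * \<theta>\<^sup>2 * \<kappa> * ((\<eta> * I t + 3 * \<kappa> * (I t)\<^sup>2 / \<eta>) / 2))"
    using kappa_ge_1 lin_abs_cube(2)[OF F \<eta>] unfolding L_def I_def
    by (intro sum_mono mult_left_mono) auto
  also have "\<dots> = 3 * \<theta>\<^sup>2 * \<kappa> * (\<eta> * \<sigma> + 3 * \<kappa> * (\<Sum>t\<in>F. (I t)\<^sup>2) / \<eta>)"
    unfolding \<sigma>_def I_def[symmetric]
    unfolding sum_distrib_left sum_divide_distrib sum.distrib[symmetric]
    using \<eta> by (intro sum.cong refl) (simp add: field_simps)
  also have "\<dots> \<le> 3 * \<theta>\<^sup>2 * \<kappa> * (\<eta> * \<sigma> + 3 * \<kappa> * \<eta>)"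
  proof -
    have "3 * \<kappa> * (\<Sum>t\<in>F. (I t)\<^sup>2) / \<eta> \<le> 3 * \<kappa> * \<eta>\<^sup>2 / \<eta>"
      using I2 kappa_ge_1 \<eta> by (intro divide_right_mono mult_left_mono) auto
    also have "\<dots> = 3 * \<kappa> * \<eta>" using \<eta> by (simp add: power2_eq_square)
    finally show ?thesis using kappa_ge_1 by (intro mult_left_mono) auto
  qed
  finally have b1: "cmod ((\<Sum>t\<in>F. e1 t) - 2 * \<i> * \<theta> * (\<Sum>t\<in>F. e2 t)) \<le> 3 * \<theta>\<^sup>2 * \<kappa> * (\<eta> * \<sigma> + 3 * \<kappa> * \<eta>)" .
  have sS: "square_integrable M S" unfolding S_def by (intro square_integrable_sum sL2)
  have sd: "square_integrable M (\<lambda>\<omega>. S \<omega> - \<sigma>)" by (intro square_integrable_diff sS square_integrable_const)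
  have iS: "integrable M (\<lambda>\<omega>. complex_of_real (S \<omega>) * iexp (\<theta> * Q \<omega>))"
    by (intro integrable_of_real_iexp square_integrable_integrable sS) simp
  have i0: "integrable M (\<lambda>\<omega>. iexp (\<theta> * Q \<omega>))" by (intro integrable_iexp_real) simp
  have "(CLINT \<omega>|M. of_real (S \<omega>) * iexp (\<theta> * Q \<omega>)) - \<sigma> * (CLINT \<omega>|M. iexp (\<theta> * Q \<omega>))
      = (CLINT \<omega>|M. of_real (S \<omega>) * iexp (\<theta> * Q \<omega>) - \<sigma> * iexp (\<theta> * Q \<omega>))"
    using iS i0 by (subst Bochner_Integration.integral_diff) auto
  also have "cmod \<dots> \<le> expectation (\<lambda>\<omega>. \<bar>S \<omega> - \<sigma>\<bar>)"
  proof (rule norm_integral_le)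
    show "integrable M (\<lambda>\<omega>. complex_of_real (S \<omega>) * iexp (\<theta> * Q \<omega>) - \<sigma> * iexp (\<theta> * Q \<omega>))"
      using iS i0 by auto
    show "integrable M (\<lambda>\<omega>. \<bar>S \<omega> - \<sigma>\<bar>)" using square_integrable_integrable[OF sd] by auto
    show "cmod (complex_of_real (S \<omega>) * iexp (\<theta> * Q \<omega>) - \<sigma> * iexp (\<theta> * Q \<omega>)) \<le> \<bar>S \<omega> - \<sigma>\<bar>" for \<omega>
      unfolding left_diff_distrib[symmetric] norm_mult of_real_diff[symmetric] by simp
  qed
  also have "\<dots> \<le> sqrt (expectation (\<lambda>\<omega>. (S \<omega> - \<sigma>)\<^sup>2))" by (rule square_integrable_abs_le_sqrt[OF sd])
  also have "\<dots> \<le> sqrt ((\<kappa> + 1) * \<eta>\<^sup>2)"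
  proof (rule real_sqrt_le_mono)
    have "expectation (\<lambda>\<omega>. (S \<omega> - \<sigma>)\<^sup>2) \<le> (\<kappa> + 1) * (\<Sum>s\<in>F. \<Sum>t\<in>F. (B s t)\<^sup>2)"
      unfolding S_qf trB[symmetric] by (rule qf_variance[OF F Bs])
    also have "\<dots> \<le> (\<kappa> + 1) * \<eta>\<^sup>2" using T kappa_ge_1 unfolding B_def by (intro mult_left_mono) auto
    finally show "expectation (\<lambda>\<omega>. (S \<omega> - \<sigma>)\<^sup>2) \<le> (\<kappa> + 1) * \<eta>\<^sup>2" .
  qed
  also have "\<dots> = sqrt (\<kappa> + 1) * \<eta>" using \<eta> by (simp add: real_sqrt_mult)
  finally have b2: "cmod ((\<Sum>t\<in>F. e2 t) - \<sigma> * (CLINT \<omega>|M. iexp (\<theta> * Q \<omega>))) \<le> sqrt (\<kappa> + 1) * \<eta>"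
    unfolding E2 .
  have "(\<Sum>t\<in>F. e1 t) - 2 * \<i> * \<theta> * \<sigma> * (CLINT \<omega>|M. iexp (\<theta> * Q \<omega>)) =
     ((\<Sum>t\<in>F. e1 t) - 2 * \<i> * \<theta> * (\<Sum>t\<in>F. e2 t)) + 2 * \<i> * \<theta> * ((\<Sum>t\<in>F. e2 t) - \<sigma> * (CLINT \<omega>|M. iexp (\<theta> * Q \<omega>)))"
    by (simp add: algebra_simps)
  also have "cmod \<dots> \<le> cmod ((\<Sum>t\<in>F. e1 t) - 2 * \<i> * \<theta> * (\<Sum>t\<in>F. e2 t)) + cmod (2 * \<i> * \<theta> * ((\<Sum>t\<in>F. e2 t) - \<sigma> * (CLINT \<omega>|M. iexp (\<theta> * Q \<omega>))))"
    by (rule norm_triangle_ineq)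
  also have "\<dots> \<le> 3 * \<theta>\<^sup>2 * \<kappa> * (\<eta> * \<sigma> + 3 * \<kappa> * \<eta>) + 2 * \<bar>\<theta>\<bar> * (sqrt (\<kappa> + 1) * \<eta>)"
    unfolding norm_mult using b1 b2 by (intro add_mono mult_mono) auto
  finally show ?thesis unfolding E1[symmetric] Q_def by (simp add: algebra_simps)
qed

text \<open>The integrating factor \<open>exp (\<sigma> * x\<^sup>2)\<close> turns the approximate
  equation into a derivative bound for u. That bound increases with |x|, so on the segment from 0 to
  \<theta> it is largest at \<theta>. The approximating function belongs to a centered Gaussian
  variable with variance 2\<sigma>.\<close>

lemma qf_char_approx:
  assumes F: "finite F" and sym: "\<And>s r. b s r = b r s" and diag: "\<And>t. b t t = 0"
    and \<eta>: "\<eta> > 0" and T: "(\<Sum>s\<in>F. \<Sum>t\<in>F. (\<Sum>r\<in>F. b s r * b r t)\<^sup>2) \<le> \<eta>\<^sup>2"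
  defines "\<sigma> \<equiv> \<Sum>s\<in>F. \<Sum>t\<in>F. (b s t)\<^sup>2"
  shows "cmod (qchar b F \<theta> - exp (- (\<theta>\<^sup>2 * \<sigma>)))
    \<le> \<eta> * (3 * \<theta>\<^sup>2 * \<kappa> * (\<sigma> + 3 * \<kappa>) + 2 * \<bar>\<theta>\<bar> * sqrt (\<kappa> + 1)) * \<bar>\<theta>\<bar> * exp (\<theta>\<^sup>2 * \<sigma>)"
proof -
  let ?Q = "\<lambda>\<omega>. qf b F (\<lambda>s. \<xi> s \<omega>)"
  define c where "c x = 3 * x\<^sup>2 * \<kappa> * (\<sigma> + 3 * \<kappa>) + 2 * \<bar>x\<bar> * sqrt (\<kappa> + 1)" for x
  define D where "D x = \<i> * (CLINT \<omega>|M. of_real (?Q \<omega>) * iexp (x * ?Q \<omega>)) + 2 * x * \<sigma> * qchar b F x" for x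
  define u where "u x = qchar b F x * of_real (exp (\<sigma> * x\<^sup>2))" for x :: real
  have \<sigma>0: "\<sigma> \<ge> 0" unfolding \<sigma>_def by (intro sum_nonneg) auto
  have c0: "c x \<ge> 0" for x using \<sigma>0 kappa_ge_1 by (auto simp: c_def)
  have "((\<lambda>x. of_real (exp (\<sigma> * x\<^sup>2)) :: complex) has_vector_derivative of_real (2 * \<sigma> * x * exp (\<sigma> * x\<^sup>2))) (at x)" for x
    by (intro has_vector_derivative_of_real) (auto intro!: derivative_eq_intros simp: has_real_derivative_iff_has_vector_derivative[symmetric])
  then have du: "(u has_vector_derivative (D x * of_real (exp (\<sigma> * x\<^sup>2)))) (at x)" for x
    unfolding u_def
    by (rule has_vector_derivative_eq_rhs[OF has_vector_derivative_mult[OF char_has_vector_derivative[OF square_integrable_qf[of b F], of x]]])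
      (auto simp: D_def algebra_simps)
  have nD: "cmod (D x) \<le> \<eta> * c x" for x
  proof -
    have "D x = \<i> * ((CLINT \<omega>|M. of_real (?Q \<omega>) * iexp (x * ?Q \<omega>)) - 2 * \<i> * x * \<sigma> * qchar b F x)"
      by (simp add: D_def algebra_simps)
    then show ?thesis
      using qf_char_ode[OF F sym diag \<eta> T, of x] by (simp add: norm_mult c_def \<sigma>_def)
  qed
  have "cmod (u \<theta> - u 0) \<le> (\<eta> * c \<theta> * exp (\<theta>\<^sup>2 * \<sigma>)) * norm (\<theta> - 0)"
  proof (rule differentiable_bound[of "closed_segment 0 \<theta>" u "\<lambda>x h. h *\<^sub>R (D x * of_real (exp (\<sigma> * x\<^sup>2)))"])
    show "(u has_derivative (\<lambda>h. h *\<^sub>R (D x * of_real (exp (\<sigma> * x\<^sup>2))))) (at x within closed_segment 0 \<theta>)" for x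
      using du[of x] has_derivative_at_withinI unfolding has_vector_derivative_def by blast
    fix x assume "x \<in> closed_segment 0 \<theta>"
    then have x: "\<bar>x\<bar> \<le> \<bar>\<theta>\<bar>" by (auto simp: closed_segment_eq_real_ivl split: if_splits)
    then have x2: "x\<^sup>2 \<le> \<theta>\<^sup>2" by (simp add: abs_le_square_iff)
    have "c x \<le> c \<theta>" unfolding c_def using x x2 \<sigma>0 kappa_ge_1 by (intro add_mono mult_right_mono mult_left_mono) auto
    moreover have "exp (\<sigma> * x\<^sup>2) \<le> exp (\<theta>\<^sup>2 * \<sigma>)" using x2 \<sigma>0 by (simp add: mult_left_mono mult.commute)
    ultimately have "norm (D x) * exp (\<sigma> * x\<^sup>2) \<le> \<eta> * c \<theta> * exp (\<theta>\<^sup>2 * \<sigma>)"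
      using \<eta> c0 by (intro mult_mono order_trans[OF nD]) auto
    then show "onorm (\<lambda>h. h *\<^sub>R (D x * of_real (exp (\<sigma> * x\<^sup>2)))) \<le> \<eta> * c \<theta> * exp (\<theta>\<^sup>2 * \<sigma>)"
      by (subst onorm_scaleR_left[of "\<lambda>h. h"]) (auto simp: norm_mult onorm_id[unfolded id_def])
  qed auto
  moreover have "u 0 = 1" by (simp add: u_def prob_space)
  moreover have "qchar b F \<theta> - exp (- (\<theta>\<^sup>2 * \<sigma>)) = of_real (exp (- (\<theta>\<^sup>2 * \<sigma>))) * (u \<theta> - 1)"
    by (simp add: u_def algebra_simps exp_of_real[symmetric] mult_exp_exp)
  ultimately have "cmod (qchar b F \<theta> - exp (- (\<theta>\<^sup>2 * \<sigma>))) \<le> exp (- (\<theta>\<^sup>2 * \<sigma>)) * (\<eta> * c \<theta> * exp (\<theta>\<^sup>2 * \<sigma>) * \<bar>\<theta>\<bar>)"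
    by (simp add: norm_mult)
  also have "\<dots> \<le> 1 * (\<eta> * c \<theta> * exp (\<theta>\<^sup>2 * \<sigma>) * \<bar>\<theta>\<bar>)"
    using \<sigma>0 \<eta> c0 by (intro mult_right_mono) auto
  finally show ?thesis by (simp add: c_def mult_ac)
qed

text \<open>The differential equation needs a zero diagonal, so A is split as b + D with D diagonal.
  The centered D-form is small in mean square, b inherits the trace bound up to the factor 3 + 15 K,
  and the Gaussian exponents of A and b differ by the squared diagonal. These are the three summands
  of the bound.\<close>

lemma centered_qf_char_approx:
  assumes F: "finite F" and sym: "\<And>s r. A s r = A r s"
    and \<eta>: "\<eta> > 0" and T: "(\<Sum>s\<in>F. \<Sum>t\<in>F. (\<Sum>r\<in>F. A s r * A r t)\<^sup>2) \<le> \<eta>\<^sup>2"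
    and d: "(\<Sum>s\<in>F. (A s s)\<^sup>2) \<le> \<eta>\<^sup>2"
    and \<sigma>K: "(\<Sum>s\<in>F. \<Sum>t\<in>F. (A s t)\<^sup>2) \<le> K"
  defines "\<sigma> \<equiv> \<Sum>s\<in>F. \<Sum>t\<in>F. (A s t)\<^sup>2"
  shows "cmod ((CLINT \<omega>|M. iexp (\<theta> * (qf A F (\<lambda>s. \<xi> s \<omega>) - (\<Sum>s\<in>F. A s s)))) - exp (- (\<theta>\<^sup>2 * \<sigma>)))
    \<le> \<bar>\<theta>\<bar> * (sqrt (\<kappa> + 1) * \<eta>) + \<eta> * sqrt (3 + 15 * K) * (3 * \<theta>\<^sup>2 * \<kappa> * (K + 3 * \<kappa>) + 2 * \<bar>\<theta>\<bar> * sqrt (\<kappa> + 1)) * \<bar>\<theta>\<bar> * exp (\<theta>\<^sup>2 * K) + \<theta>\<^sup>2 * \<eta>\<^sup>2"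
proof -
  define b where "b s t = (if s = t then 0 else A s t)" for s t
  define D where "D s t = (if s = t then A s s else 0)" for s t
  define \<sigma>b where "\<sigma>b = (\<Sum>s\<in>F. \<Sum>t\<in>F. (b s t)\<^sup>2)"
  have bs: "b s t = b t s" for s t by (simp add: b_def sym)
  have bd: "b t t = 0" for t by (simp add: b_def)
  have Ds: "D s t = D t s" for s t by (simp add: D_def)
  have A_bD: "A s t = b s t + D s t" for s t by (simp add: b_def D_def)
  have A2: "(A s t)\<^sup>2 = (b s t)\<^sup>2 + (D s t)\<^sup>2" for s t by (simp add: b_def D_def)
  have D2: "(\<Sum>s\<in>F. \<Sum>t\<in>F. (D s t)\<^sup>2) = (\<Sum>s\<in>F. (A s s)\<^sup>2)"
    using F by (intro sum.cong refl) (simp add: D_def if_distrib[of "\<lambda>x. x\<^sup>2"] sum.delta cong: if_cong)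
  have \<sigma>: "\<sigma> = \<sigma>b + (\<Sum>s\<in>F. (A s s)\<^sup>2)"
    unfolding \<sigma>_def \<sigma>b_def A2 sum.distrib D2 ..
  have pos: "\<sigma>b \<ge> 0" "(\<Sum>s\<in>F. (A s s)\<^sup>2) \<ge> 0" "\<sigma> \<ge> 0" by (auto simp: \<sigma>b_def \<sigma>_def intro!: sum_nonneg)
  have \<sigma>bK: "\<sigma>b \<le> K" using \<sigma> pos \<sigma>K by (simp add: \<sigma>_def)
  have K0: "K \<ge> 0" using \<sigma>bK pos by simp
  have dmax: "(A s s)\<^sup>2 \<le> \<eta>\<^sup>2" if "s \<in> F" for s
    using member_le_sum[of s F "\<lambda>s. (A s s)\<^sup>2"] F that d by auto
  have Tb: "(\<Sum>s\<in>F. \<Sum>t\<in>F. (\<Sum>r\<in>F. b s r * b r t)\<^sup>2) \<le> (\<eta> * sqrt (3 + 15 * K))\<^sup>2"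
  proof -
    \<comment> \<open>Dropping r = s and r = t removes the same term twice when s = t; the last
      summand restores it.\<close>
    have eq: "(\<Sum>r\<in>F. b s r * b r t) = (\<Sum>r\<in>F. A s r * A r t) - A s t * (A s s + A t t) + D s t * A s s" if "s \<in> F" "t \<in> F" for s t
    proof -
      have "(\<Sum>r\<in>F. b s r * b r t) = (\<Sum>r\<in>F. A s r * A r t - (if r = s then A s s * A s t else 0) - (if r = t then A s t * A t t else 0) + (if r = s \<and> s = t then A s s * A s s else 0))"
        by (intro sum.cong refl) (auto simp: b_def)
      also have "\<dots> = (\<Sum>r\<in>F. A s r * A r t) - A s s * A s t - A s t * A t t + (if s = t then A s s * A s s else 0)"
        using that F by (simp add: sum.distrib sum_subtractf)
      finally show ?thesis by (simp add: D_def algebra_simps)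
    qed
    have "(\<Sum>s\<in>F. \<Sum>t\<in>F. (\<Sum>r\<in>F. b s r * b r t)\<^sup>2) \<le> (\<Sum>s\<in>F. \<Sum>t\<in>F. 3 * (\<Sum>r\<in>F. A s r * A r t)\<^sup>2 + 12 * \<eta>\<^sup>2 * (A s t)\<^sup>2 + 3 * \<eta>\<^sup>2 * (D s t)\<^sup>2)"
    proof (intro sum_mono)
      fix s t assume st: "s \<in> F" "t \<in> F"
      have sq3: "(x - y + z)\<^sup>2 \<le> 3 * x\<^sup>2 + 3 * y\<^sup>2 + 3 * z\<^sup>2" for x y z :: real
        using sum_squares_bound[of x "-y"] sum_squares_bound[of x z] sum_squares_bound[of "-y" z]
        by (simp add: power2_eq_square algebra_simps)
      have "(A s s + A t t)\<^sup>2 \<le> 2 * (A s s)\<^sup>2 + 2 * (A t t)\<^sup>2"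
        using sum_squares_bound[of "A s s" "A t t"] by (simp add: power2_eq_square algebra_simps)
      also have "\<dots> \<le> 4 * \<eta>\<^sup>2" using dmax[OF st(1)] dmax[OF st(2)] by simp
      finally have "(A s t)\<^sup>2 * (A s s + A t t)\<^sup>2 \<le> (A s t)\<^sup>2 * (4 * \<eta>\<^sup>2)"
        by (rule mult_left_mono) simp
      then have "3 * (A s t * (A s s + A t t))\<^sup>2 \<le> 12 * \<eta>\<^sup>2 * (A s t)\<^sup>2"
        by (simp add: power_mult_distrib mult_ac)
      moreover have "(D s t)\<^sup>2 * (A s s)\<^sup>2 \<le> (D s t)\<^sup>2 * \<eta>\<^sup>2"
        by (rule mult_left_mono[OF dmax[OF st(1)]]) simp
      then have "3 * (D s t * A s s)\<^sup>2 \<le> 3 * \<eta>\<^sup>2 * (D s t)\<^sup>2"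
        by (simp add: power_mult_distrib mult_ac)
      ultimately show "(\<Sum>r\<in>F. b s r * b r t)\<^sup>2 \<le> 3 * (\<Sum>r\<in>F. A s r * A r t)\<^sup>2 + 12 * \<eta>\<^sup>2 * (A s t)\<^sup>2 + 3 * \<eta>\<^sup>2 * (D s t)\<^sup>2"
        unfolding eq[OF st] using sq3[of "\<Sum>r\<in>F. A s r * A r t" "A s t * (A s s + A t t)" "D s t * A s s"] by linarith
    qed
    also have "\<dots> = 3 * (\<Sum>s\<in>F. \<Sum>t\<in>F. (\<Sum>r\<in>F. A s r * A r t)\<^sup>2) + 12 * \<eta>\<^sup>2 * \<sigma> + 3 * \<eta>\<^sup>2 * (\<Sum>s\<in>F. (A s s)\<^sup>2)"
      unfolding D2[symmetric] \<sigma>_def by (simp add: sum.distrib sum_distrib_left)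
    also have "\<dots> \<le> 3 * \<eta>\<^sup>2 + 12 * \<eta>\<^sup>2 * K + 3 * \<eta>\<^sup>2 * K"
      using T \<sigma>K \<sigma> pos by (intro add_mono mult_left_mono) (auto simp: \<sigma>_def)
    also have "\<dots> = (\<eta> * sqrt (3 + 15 * K))\<^sup>2" using K0 by (simp add: power_mult_distrib algebra_simps)
    finally show ?thesis .
  qed
  have \<eta>': "\<eta> * sqrt (3 + 15 * K) > 0" using \<eta> K0 by simp
  let ?S = "\<lambda>\<omega>. qf A F (\<lambda>s. \<xi> s \<omega>) - (\<Sum>s\<in>F. A s s)"
  let ?Q = "\<lambda>\<omega>. qf b F (\<lambda>s. \<xi> s \<omega>)"
  let ?R = "\<lambda>\<omega>. qf D F (\<lambda>s. \<xi> s \<omega>) - (\<Sum>s\<in>F. D s s)"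
  have SQ: "?S \<omega> - ?Q \<omega> = ?R \<omega>" for \<omega>
    by (simp add: qf_def A_bD sum.distrib algebra_simps) (simp add: b_def)
  have "cmod ((CLINT \<omega>|M. iexp (\<theta> * ?S \<omega>)) - qchar b F \<theta>) \<le> \<bar>\<theta>\<bar> * expectation (\<lambda>\<omega>. \<bar>?S \<omega> - ?Q \<omega>\<bar>)"
    by (intro char_diff_le square_integrable_integrable square_integrable_diff square_integrable_qf square_integrable_const)
  also have "\<dots> \<le> \<bar>\<theta>\<bar> * sqrt (expectation (\<lambda>\<omega>. (?R \<omega>)\<^sup>2))"
    unfolding SQ by (intro mult_left_mono square_integrable_abs_le_sqrt square_integrable_diff square_integrable_qf square_integrable_const) auto
  also have "\<dots> \<le> \<bar>\<theta>\<bar> * sqrt ((\<kappa> + 1) * \<eta>\<^sup>2)"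
  proof (intro mult_left_mono real_sqrt_le_mono)
    have "expectation (\<lambda>\<omega>. (?R \<omega>)\<^sup>2) \<le> (\<kappa> + 1) * (\<Sum>s\<in>F. \<Sum>t\<in>F. (D s t)\<^sup>2)" by (rule qf_variance[OF F Ds])
    also have "\<dots> \<le> (\<kappa> + 1) * \<eta>\<^sup>2" unfolding D2 using d kappa_ge_1 by (intro mult_left_mono) auto
    finally show "expectation (\<lambda>\<omega>. (?R \<omega>)\<^sup>2) \<le> (\<kappa> + 1) * \<eta>\<^sup>2" .
  qed auto
  also have "\<dots> = \<bar>\<theta>\<bar> * (sqrt (\<kappa> + 1) * \<eta>)" using \<eta> by (simp add: real_sqrt_mult)
  finally have e1: "cmod ((CLINT \<omega>|M. iexp (\<theta> * ?S \<omega>)) - qchar b F \<theta>) \<le> \<bar>\<theta>\<bar> * (sqrt (\<kappa> + 1) * \<eta>)" .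
  have "cmod (qchar b F \<theta> - exp (- (\<theta>\<^sup>2 * \<sigma>b)))
    \<le> \<eta> * sqrt (3 + 15 * K) * (3 * \<theta>\<^sup>2 * \<kappa> * (\<sigma>b + 3 * \<kappa>) + 2 * \<bar>\<theta>\<bar> * sqrt (\<kappa> + 1)) * \<bar>\<theta>\<bar> * exp (\<theta>\<^sup>2 * \<sigma>b)"
    unfolding \<sigma>b_def by (rule qf_char_approx[OF F bs bd \<eta>' Tb])
  also have "\<dots> \<le> \<eta> * sqrt (3 + 15 * K) * (3 * \<theta>\<^sup>2 * \<kappa> * (K + 3 * \<kappa>) + 2 * \<bar>\<theta>\<bar> * sqrt (\<kappa> + 1)) * \<bar>\<theta>\<bar> * exp (\<theta>\<^sup>2 * K)"
    using \<sigma>bK pos kappa_ge_1 \<eta> K0 by (intro mult_mono add_mono mult_left_mono mult_nonneg_nonneg) (auto intro!: mult_left_mono add_nonneg_nonneg)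
  finally have e2: "cmod (qchar b F \<theta> - exp (- (\<theta>\<^sup>2 * \<sigma>b))) \<le> \<dots>" .
  have e3: "cmod (complex_of_real (exp (- (\<theta>\<^sup>2 * \<sigma>b))) - exp (- (\<theta>\<^sup>2 * \<sigma>))) \<le> \<theta>\<^sup>2 * \<eta>\<^sup>2"
  proof -
    define x where "x = \<theta>\<^sup>2 * (\<Sum>s\<in>F. (A s s)\<^sup>2)"
    have x: "0 \<le> x" "x \<le> \<theta>\<^sup>2 * \<eta>\<^sup>2" using d pos by (auto simp: x_def mult_left_mono)
    have "exp (- (\<theta>\<^sup>2 * \<sigma>b)) - exp (- (\<theta>\<^sup>2 * \<sigma>)) = exp (- (\<theta>\<^sup>2 * \<sigma>b)) * (1 - exp (- x))"
      by (simp add: \<sigma> x_def algebra_simps exp_diff exp_minus divide_inverse)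
    also have "\<bar>\<dots>\<bar> \<le> 1 * x"
      unfolding abs_mult using pos x exp_ge_add_one_self[of "-x"] by (intro mult_mono) auto
    finally show ?thesis using x unfolding of_real_diff[symmetric] norm_of_real by simp
  qed
  have "cmod ((CLINT \<omega>|M. iexp (\<theta> * ?S \<omega>)) - exp (- (\<theta>\<^sup>2 * \<sigma>))) \<le> cmod ((CLINT \<omega>|M. iexp (\<theta> * ?S \<omega>)) - qchar b F \<theta>)
      + cmod (qchar b F \<theta> - exp (- (\<theta>\<^sup>2 * \<sigma>b))) + cmod (complex_of_real (exp (- (\<theta>\<^sup>2 * \<sigma>b))) - exp (- (\<theta>\<^sup>2 * \<sigma>)))"
    by (smt (verit) norm_triangle_ineq diff_add_cancel add_diff_eq)
  then show ?thesis using e1 e2 e3 by linarith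
qed

end

section \<open>Fourier series on an interval and Poisson summation\<close>

text \<open>Lebesgue measure on an interval as a finite measure of its own: bounded measurable
  functions are integrable, and general results on Bochner integrals apply to interval integrals as
  they stand.\<close>

definition ival :: "real \<Rightarrow> real \<Rightarrow> real measure" where
  "ival a b = restrict_space lborel {a..b}"

lemma space_ival [simp]: "space (ival a b) = {a..b}"
  by (simp add: ival_def)

lemma finite_measure_ival: "finite_measure (ival a b)"
  by (rule finite_measureI) (simp add: ival_def emeasure_restrict_space emeasure_lborel_Icc_eq)

interpretation ival: finite_measure "ival a b" by (rule finite_measure_ival)

lemma integral_ival: "integral\<^sup>L (ival a b) f = (LBINT x:{a..b}. f x)"
  for f :: "real \<Rightarrow> 'b::{banach, second_countable_topology}"
  by (simp add: ival_def set_lebesgue_integral_def integral_restrict_space)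

lemma integrable_ival: "integrable (ival a b) f \<longleftrightarrow> set_integrable lborel {a..b} f"
  for f :: "real \<Rightarrow> 'b::{banach, second_countable_topology}"
  by (simp add: ival_def set_integrable_def integrable_restrict_space)

lemma measurable_ival: "f \<in> borel_measurable borel \<Longrightarrow> f \<in> borel_measurable (ival a b)"
  unfolding ival_def by (intro measurable_restrict_space1) simp

lemma continuous_integrable_ival:
  fixes f :: "real \<Rightarrow> 'b::{banach, second_countable_topology}"
  assumes "continuous_on {a..b} f"
  shows "integrable (ival a b) f"
  unfolding integrable_ival set_integrable_def
  by (rule borel_integrable_compact) (use assms in auto)

lemma integral_ival_const: "a \<le> b \<Longrightarrow> integral\<^sup>L (ival a b) (\<lambda>x. c) = (b - a) *\<^sub>R c"
  for c :: "'b::{banach, second_countable_topology}"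
  unfolding integral_ival set_lebesgue_integral_def by simp

lemma measure_ival [simp]: "a \<le> b \<Longrightarrow> measure (ival a b) {a..b} = b - a"
  using integral_ival_const[of a b "1::real"] by simp

lemma cis_eq_exp: "cis (- (x * t)) = exp (- (\<i> * of_real x * of_real t))"
  by (simp add: cis_conv_exp mult_ac)

lemma continuous_on_cis_comp [continuous_intros]:
  assumes "continuous_on S f" shows "continuous_on S (\<lambda>x. cis (f x))"
  unfolding cis_conv_exp by (intro continuous_intros assms)

lemma borel_measurable_cis [measurable (raw)]:
  assumes "f \<in> borel_measurable M" shows "(\<lambda>x. cis (f x)) \<in> borel_measurable M"
  unfolding cis_conv_exp using assms by measurable

lemma integral_cis_eq_0:
  assumes "c \<noteq> 0" "a \<le> b" "cis (c * a) = cis (c * b)"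
  shows "integral\<^sup>L (ival a b) (\<lambda>x. cis (c * x)) = 0"
proof -
  have "integral\<^sup>L (ival a b) (\<lambda>x. cis (c * x)) = cis (c * b) / (\<i> * c) - cis (c * a) / (\<i> * c)"
    unfolding integral_ival set_lebesgue_integral_def
  proof (rule integral_FTC_Icc)
    show "((\<lambda>x. cis (c * x) / (\<i> * c)) has_vector_derivative cis (c * x)) (at x within {a..b})" for x
    proof -
      have "((\<lambda>z. exp (\<i> * (c * z)) / (\<i> * c)) has_field_derivative exp (\<i> * (c * of_real x))) (at (of_real x))"
        using assms(1) by (auto intro!: derivative_eq_intros simp: complex_eq_iff)
      then show ?thesis unfolding cis_conv_exp using has_vector_derivative_real_field by force
    qed
    show "continuous_on {a..b} (\<lambda>x. cis (c * x))" by (intro continuous_intros)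
  qed fact
  then show ?thesis using assms by simp
qed

text \<open>The integrals of \<open>r\<close> against the powers of the trigonometric polynomial \<open>T\<close> vanish, but these powers concentrate near \<open>x0\<close>.\<close>

lemma fourier_coeffs_zero_real:
  fixes r :: "real \<Rightarrow> real"
  assumes cont: "continuous_on {-1..0} r"
    and zero: "\<And>m::int. integral\<^sup>L (ival (-1) 0) (\<lambda>x. of_real (r x) * cis (2 * pi * of_int m * x)) = 0"
    and x0: "x0 \<in> {-1<..<0}"
  shows "r x0 \<le> 0"
proof (rule ccontr)
  assume "\<not> r x0 \<le> 0"
  define e where "e = r x0 / 2"
  have e: "e > 0" "e < r x0" using \<open>\<not> r x0 \<le> 0\<close> by (auto simp: e_def)
  have "continuous_on {-1<..<0} r" using cont by (rule continuous_on_subset) auto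
  then have "isCont r x0" using x0 continuous_on_eq_continuous_at[of "{-1<..<0}" r] by auto
  then have "\<forall>\<^sub>F x in at x0. r x > e" using e(2) by (intro order_tendstoD(1)) (auto simp: isCont_def)
  then obtain d0 where d0: "d0 > 0" "\<And>x. x \<noteq> x0 \<Longrightarrow> dist x x0 < d0 \<Longrightarrow> r x > e"
    unfolding eventually_at by auto
  \<comment> \<open>Half of d0 keeps r above e. The distances to the endpoints keep the
    neighbourhood inside the interval and the periodic distance 1 - |x - x0| at least \<delta>. The
    bound 1/4 keeps the angles in the range where the cosine decreases.\<close>
  define \<delta> where "\<delta> = Min {d0 / 2, x0 + 1, -x0, 1/4}"
  have \<delta>: "\<delta> > 0" "\<delta> < d0" "\<delta> \<le> x0 + 1" "\<delta> \<le> -x0" "\<delta> \<le> 1/4" using d0(1) x0 by (auto simp: \<delta>_def min_def)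
  have r_e: "r x \<ge> e" if "\<bar>x - x0\<bar> \<le> \<delta>" for x
    using d0(2)[of x] that \<delta> e by (cases "x = x0") (auto simp: dist_real_def)
  \<comment> \<open>The shift c makes T equal to 1 exactly at distance \<delta>: T is at least 1
    closer to x0, at least q > 1 within half that distance, and between -1 and 1 on the rest of the
    interval.\<close>
  define c where "c = 1 - cos (2 * pi * \<delta>)"
  define T where "T x = c + cos (2 * pi * (x - x0))" for x
  define q where "q = c + cos (pi * \<delta>)"
  have contT: "continuous_on A T" for A unfolding T_def by (intro continuous_intros)
  have T_ge1: "T x \<ge> 1" if "\<bar>x - x0\<bar> \<le> \<delta>" for x
  proof -
    have "cos (2 * pi * \<delta>) \<le> cos \<bar>2 * pi * (x - x0)\<bar>"
      using that \<delta> by (intro cos_monotone_0_pi_le) (auto simp: abs_mult)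
    then show ?thesis by (simp add: T_def c_def)
  qed
  have T_geq: "T x \<ge> q" if "\<bar>x - x0\<bar> \<le> \<delta> / 2" for x
  proof -
    have "cos (pi * \<delta>) \<le> cos \<bar>2 * pi * (x - x0)\<bar>"
      using that \<delta> by (intro cos_monotone_0_pi_le) (auto simp: abs_mult)
    then show ?thesis by (simp add: T_def q_def)
  qed
  have q1: "q > 1"
  proof -
    have "cos (2 * pi * \<delta>) < cos (pi * \<delta>)"
      using \<delta> by (intro cos_monotone_0_pi) auto
    then show ?thesis by (simp add: q_def c_def)
  qed
  have T_out: "\<bar>T x\<bar> \<le> 1" if x: "x \<in> {-1..0}" "\<bar>x - x0\<bar> > \<delta>" for x
  proof -
    have "cos (2 * pi * (x - x0)) \<le> cos (2 * pi * \<delta>)"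
    proof (cases "\<bar>x - x0\<bar> \<le> 1/2")
      case True
      then have "cos \<bar>2 * pi * (x - x0)\<bar> \<le> cos (2 * pi * \<delta>)"
        using that \<delta> by (intro cos_monotone_0_pi_le) (auto simp: abs_mult)
      then show ?thesis by simp
    next
      case False
      have "cos (2 * pi * (x - x0)) = cos (2 * pi * \<bar>x - x0\<bar>)"
        using cos_abs_real[of "2 * pi * (x - x0)"] by (simp add: abs_mult)
      also have "\<dots> = cos (2 * pi * (1 - \<bar>x - x0\<bar>))"
        by (simp add: right_diff_distrib cos_diff)
      also have "\<dots> \<le> cos (2 * pi * \<delta>)"
        using False that \<delta> x0 by (intro cos_monotone_0_pi_le) (auto simp: abs_if)
      finally show ?thesis .
    qed
    then show ?thesis unfolding T_def c_def
      using cos_ge_minus_one[of "2 * pi * (x - x0)"] cos_le_one[of "2 * pi * \<delta>"] by linarith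
  qed
  have int: "integrable (ival (-1) 0) (\<lambda>x. of_real (r x * T x ^ N) * cis (2 * pi * of_int m * x))" for N and m :: int
    by (intro continuous_integrable_ival continuous_intros cont contT)
  \<comment> \<open>Multiplication by T only mixes the frequencies m - 1, m and m + 1, so vanishing
    coefficients survive every power of T.\<close>
  have Tcis: "complex_of_real (T x) * cis (2 * pi * of_int m * x) = c * cis (2 * pi * of_int m * x)
      + cis (- 2 * pi * x0) / 2 * cis (2 * pi * of_int (m + 1) * x) + cis (2 * pi * x0) / 2 * cis (2 * pi * of_int (m - 1) * x)" for x and m :: int
  proof -
    have "complex_of_real (cos (2 * pi * (x - x0))) = (cis (2 * pi * (x - x0)) + cis (- (2 * pi * (x - x0)))) / 2"
      by (simp add: complex_eq_iff)
    then show ?thesis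
      by (simp add: T_def distrib_right cis_mult algebra_simps add_divide_distrib)
  qed
  have zeroN: "integral\<^sup>L (ival (-1) 0) (\<lambda>x. of_real (r x * T x ^ N) * cis (2 * pi * of_int m * x)) = 0" for N and m :: int
  proof (induction N arbitrary: m)
    case 0 then show ?case using zero by simp
  next
    case (Suc N)
    have "integral\<^sup>L (ival (-1) 0) (\<lambda>x. of_real (r x * T x ^ Suc N) * cis (2 * pi * of_int m * x)) =
       integral\<^sup>L (ival (-1) 0) (\<lambda>x. c * (of_real (r x * T x ^ N) * cis (2 * pi * of_int m * x))
        + cis (- 2 * pi * x0) / 2 * (of_real (r x * T x ^ N) * cis (2 * pi * of_int (m + 1) * x))
        + cis (2 * pi * x0) / 2 * (of_real (r x * T x ^ N) * cis (2 * pi * of_int (m - 1) * x)))"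
    proof (intro Bochner_Integration.integral_cong refl)
      fix x
      have "of_real (r x * T x ^ Suc N) * cis (2 * pi * of_int m * x) = complex_of_real (r x * T x ^ N) * (complex_of_real (T x) * cis (2 * pi * of_int m * x))"
        by simp
      then show "of_real (r x * T x ^ Suc N) * cis (2 * pi * of_int m * x) = c * (of_real (r x * T x ^ N) * cis (2 * pi * of_int m * x))
        + cis (- 2 * pi * x0) / 2 * (of_real (r x * T x ^ N) * cis (2 * pi * of_int (m + 1) * x))
        + cis (2 * pi * x0) / 2 * (of_real (r x * T x ^ N) * cis (2 * pi * of_int (m - 1) * x))"
        unfolding Tcis by (simp only: distrib_left mult_ac)
    qed
    also have "\<dots> = 0"
      using int[of N m] int[of N "m + 1"] int[of N "m - 1"] Suc.IH[of m] Suc.IH[of "m + 1"] Suc.IH[of "m - 1"]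
      by (simp del: of_int_add of_int_diff of_real_mult of_real_power)
    finally show ?case .
  qed
  have int0: "integral\<^sup>L (ival (-1) 0) (\<lambda>x. r x * T x ^ N) = 0" for N
  proof -
    have "complex_of_real (integral\<^sup>L (ival (-1) 0) (\<lambda>x. r x * T x ^ N)) = 0"
      using zeroN[of N 0] by (simp only: integral_complex_of_real[symmetric]) simp
    then show ?thesis by simp
  qed
  obtain B where B: "\<And>x. x \<in> {-1..0} \<Longrightarrow> \<bar>r x\<bar> \<le> B"
    using compact_imp_bounded[OF compact_continuous_image[OF cont compact_Icc]] by (force simp: bounded_iff)
  have B0: "B \<ge> 0" using B[of 0] by auto
  define K where "K = {x0 - \<delta> / 2..x0 + \<delta> / 2}"
  \<comment> \<open>Outside the \<delta>-neighbourhood the product may be negative but not below -B,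
    whereas on K it grows like \<open>q ^ N\<close>. A vanishing integral for every N is then
    impossible.\<close>
  have low: "e * q ^ N * indicator K x - B \<le> r x * T x ^ N" if x: "x \<in> {-1..0}" for x N
  proof (cases "\<bar>x - x0\<bar> \<le> \<delta>")
    case True
    have "e * q ^ N * indicator K x \<le> r x * T x ^ N"
    proof (cases "x \<in> K")
      case True
      then have "\<bar>x - x0\<bar> \<le> \<delta> / 2" by (auto simp: K_def abs_if split: if_splits)
      then show ?thesis using T_geq[of x] r_e[of x] q1 e \<delta> True
        by (auto intro!: mult_mono power_mono)
    next
      case False
      then show ?thesis using T_ge1[of x] r_e[of x] \<open>\<bar>x - x0\<bar> \<le> \<delta>\<close> e by auto
    qed
    then show ?thesis using B0 by simp
  next
    case False
    then have "x \<notin> K" using \<delta> by (auto simp: K_def abs_if split: if_splits)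
    have "\<bar>r x * T x ^ N\<bar> \<le> B * 1"
      unfolding abs_mult power_abs using B[OF x] T_out[OF x] False B0 by (intro mult_mono power_le_one) auto
    then show ?thesis using \<open>x \<notin> K\<close> by auto
  qed
  have Kint: "integrable (ival (-1) 0) (indicator K :: real \<Rightarrow> real)"
    by (intro ival.integrable_const_bound[where B=1] AE_I2 measurable_ival) (auto simp: K_def indicator_def)
  have Kval: "integral\<^sup>L (ival (-1) 0) (indicator K) = \<delta>"
  proof -
    have "integral\<^sup>L (ival (-1) 0) (indicator K :: real \<Rightarrow> real) = (LBINT x. indicator K x)"
      unfolding integral_ival set_lebesgue_integral_def using \<delta> x0
      by (intro Bochner_Integration.integral_cong) (auto simp: K_def indicator_def)
    then show ?thesis using \<delta> by (simp add: K_def)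
  qed
  have "e * q ^ N * \<delta> - B \<le> 0" for N
  proof -
    have "e * q ^ N * \<delta> - B = integral\<^sup>L (ival (-1) 0) (\<lambda>x. e * q ^ N * indicator K x - B)"
      using Kint Kval by simp
    also have "\<dots> \<le> integral\<^sup>L (ival (-1) 0) (\<lambda>x. r x * T x ^ N)"
      using low Kint by (intro integral_mono) (auto intro!: continuous_integrable_ival continuous_intros cont contT)
    finally show ?thesis by (simp add: int0)
  qed
  then have "q ^ N \<le> B / (e * \<delta>)" for N using e \<delta> by (simp add: field_simps)
  moreover obtain N where "q ^ N > B / (e * \<delta>)" using real_arch_pow[OF q1] by blast
  ultimately show False by (meson not_le)
qed

text \<open>Conjugation carries frequency m to -m, so the real and imaginary parts also have
  vanishing coefficients. The one-sided real bound, applied to both signs, gives zero in the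
  interior; continuity gives the endpoints.\<close>

lemma fourier_coeffs_zero:
  fixes h :: "real \<Rightarrow> complex"
  assumes cont: "continuous_on {-1..0} h"
    and zero: "\<And>m::int. integral\<^sup>L (ival (-1) 0) (\<lambda>x. h x * cis (2 * pi * of_int m * x)) = 0"
    and x0: "x0 \<in> {-1..0}"
  shows "h x0 = 0"
proof -
  let ?I = "integral\<^sup>L (ival (-1) 0)"
  have i: "integrable (ival (-1) 0) (\<lambda>x. h x * cis (2 * pi * of_int m * x))"
    "integrable (ival (-1) 0) (\<lambda>x. cnj (h x) * cis (2 * pi * of_int m * x))" for m
    by (intro continuous_integrable_ival continuous_intros cont)+
  have cz: "?I (\<lambda>x. cnj (h x) * cis (2 * pi * of_int m * x)) = 0" for m
  proof -
    have "?I (\<lambda>x. cnj (h x) * cis (2 * pi * of_int m * x)) = ?I (\<lambda>x. cnj (h x * cis (2 * pi * of_int (-m) * x)))"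
      by (intro Bochner_Integration.integral_cong) (auto simp: cis_cnj)
    also have "\<dots> = cnj (?I (\<lambda>x. h x * cis (2 * pi * of_int (-m) * x)))" by (rule integral_bounded_linear[OF bounded_linear_cnj]) (rule i)
    finally show ?thesis by (simp only: zero) simp
  qed
  have re: "?I (\<lambda>x. of_real (Re (h x)) * cis (2 * pi * of_int m * x)) = 0" for m
  proof -
    have "?I (\<lambda>x. of_real (Re (h x)) * cis (2 * pi * of_int m * x)) = ?I (\<lambda>x. (h x * cis (2 * pi * of_int m * x) + cnj (h x) * cis (2 * pi * of_int m * x)) / 2)"
      by (intro Bochner_Integration.integral_cong refl) (simp add: distrib_right[symmetric] complex_add_cnj)
    then show ?thesis using i by (simp add: zero cz)
  qed
  have im: "?I (\<lambda>x. of_real (Im (h x)) * cis (2 * pi * of_int m * x)) = 0" for m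
  proof -
    have "?I (\<lambda>x. of_real (Im (h x)) * cis (2 * pi * of_int m * x)) = ?I (\<lambda>x. (h x * cis (2 * pi * of_int m * x) - cnj (h x) * cis (2 * pi * of_int m * x)) / (2 * \<i>))"
      by (intro Bochner_Integration.integral_cong refl) (simp add: left_diff_distrib[symmetric] complex_diff_cnj complex_eq_iff)
    then show ?thesis using i by (simp add: zero cz)
  qed
  have neg: "?I (\<lambda>x. of_real (- Re (h x)) * cis (2 * pi * of_int m * x)) = 0" "?I (\<lambda>x. of_real (- Im (h x)) * cis (2 * pi * of_int m * x)) = 0" for m
    using re[of m] im[of m] by simp_all
  have c: "continuous_on {-1..0} (\<lambda>x. Re (h x))" "continuous_on {-1..0} (\<lambda>x. - Re (h x))"
    "continuous_on {-1..0} (\<lambda>x. Im (h x))" "continuous_on {-1..0} (\<lambda>x. - Im (h x))"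
    by (intro continuous_intros cont)+
  have "h x = 0" if "x \<in> {-1<..<0}" for x
    using fourier_coeffs_zero_real[OF c(1) re that] fourier_coeffs_zero_real[OF c(2) neg(1) that]
      fourier_coeffs_zero_real[OF c(3) im that] fourier_coeffs_zero_real[OF c(4) neg(2) that]
    by (auto simp: complex_eq_iff)
  moreover have "closure {-1<..<0::real} = {-1..0}" by simp
  ultimately show ?thesis
    using continuous_constant_on_closure[of "{-1<..<0::real}" h 0 x0] cont x0 by auto
qed

section \<open>Fourier expansion of the window\<close>

lemma summable_on_inverse_square: "(\<lambda>m::int. 1 / (1 + \<bar>real_of_int m\<bar>)\<^sup>2) summable_on UNIV"
proof -
  have s: "(\<lambda>n::nat. 1 / (1 + real n)\<^sup>2) summable_on UNIV"
    using inverse_squares_sums[THEN sums_summable]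
    by (subst summable_on_UNIV_nonneg_real_iff) (auto simp: add.commute)
  have "UNIV = range int \<union> range (\<lambda>n. - int n)"
    by (auto simp: image_iff) (metis int_cases2)
  moreover have "(\<lambda>m::int. 1 / (1 + \<bar>real_of_int m\<bar>)\<^sup>2) summable_on range int"
    using s by (subst summable_on_reindex) (auto simp: o_def)
  moreover have "(\<lambda>m::int. 1 / (1 + \<bar>real_of_int m\<bar>)\<^sup>2) summable_on range (\<lambda>n. - int n)"
    using s by (subst summable_on_reindex) (auto simp: o_def inj_on_def)
  ultimately show ?thesis by (metis summable_on_union)
qed

text \<open>Continuity matters because W is sampled on a grid, while the transform determines W only
  up to a null set. C bounds the weighted transform, and \<open>unit\<close> fixes the limit of the
  block energies.\<close>

locale window =
  fixes W :: "real \<Rightarrow> real" and \<beta> C :: real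
  assumes contW: "continuous_on UNIV W"
    and supp: "\<And>t. t \<notin> {-1..0} \<Longrightarrow> W t = 0"
    and beta: "\<beta> > 2"
    and decay: "\<And>x. cmod (fourier_transform W x) * (1 + \<bar>x\<bar>) powr \<beta> \<le> C"
    and unit: "(LBINT l. (cmod (fourier_transform W l))\<^sup>2) = 1"
begin

abbreviation "FT \<equiv> fourier_transform W"

lemma C_nonneg: "C \<ge> 0"
  using decay[of 0] by (simp add: order_trans[OF _ decay[of 0]])

lemma isCont_W: "isCont W x" using contW by (simp add: continuous_on_eq_continuous_at)

lemma W_measurable [measurable]: "W \<in> borel_measurable borel"
  using contW by (rule borel_measurable_continuous_onI)

text \<open>Continuity compared with the zero values outside the support. The value at -1 lets a
  block of length g stop at index g - 1.\<close>

lemma W_ends: "W (-1) = 0" "W 0 = 0"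
proof -
  have "(W \<longlongrightarrow> W (-1)) (at_left (-1))" using isCont_W[of "-1"] by (auto simp: isCont_def filterlim_at_split)
  moreover have "((\<lambda>x::real. 0) \<longlongrightarrow> W (-1)) (at_left (-1)) \<longleftrightarrow> (W \<longlongrightarrow> W (-1)) (at_left (-1))"
    by (intro filterlim_cong refl) (auto simp: eventually_at_left_field intro!: exI[of _ "-2"] supp)
  ultimately show "W (-1) = 0" using tendsto_unique[OF _ tendsto_const, of "at_left (-1 :: real)" 0 "W (-1)"] by (auto simp: trivial_limit_at_left_real)
  have "(W \<longlongrightarrow> W 0) (at_right 0)" using isCont_W[of 0] by (auto simp: isCont_def filterlim_at_split)
  moreover have "((\<lambda>x::real. 0) \<longlongrightarrow> W 0) (at_right 0) \<longleftrightarrow> (W \<longlongrightarrow> W 0) (at_right 0)"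
    by (intro filterlim_cong refl) (auto simp: eventually_at_right_field intro!: exI[of _ 2] supp)
  ultimately show "W 0 = 0" using tendsto_unique[OF _ tendsto_const, of "at_right (0 :: real)" 0 "W 0"] by auto
qed

lemma FT_ival: "FT x = integral\<^sup>L (ival (-1) 0) (\<lambda>t. of_real (W t) * cis (- (x * t)))"
  unfolding fourier_transform_def integral_ival set_lebesgue_integral_def cis_eq_exp[symmetric]
  by (intro Bochner_Integration.integral_cong refl) (auto simp: indicator_def supp)

lemma FT_cnj: "integral\<^sup>L (ival (-1) 0) (\<lambda>t. of_real (W t) * cnj (cis (- (x * t)))) = cnj (FT x)"
  unfolding FT_ival by (subst Bochner_Integration.integral_cnj[symmetric]) simp

lemma FT_bound: "cmod (FT x) \<le> C * (1 + \<bar>x\<bar>) powr - \<beta>"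
  using decay[of x] by (simp add: powr_minus field_simps)

lemma powr_minus_beta_le:
  assumes "x \<ge> 1" shows "x powr - \<beta> \<le> 1 / x\<^sup>2"
proof -
  have "x powr - \<beta> \<le> x powr - 2" using assms beta by (intro powr_mono) auto
  also have "\<dots> = 1 / x\<^sup>2" using assms by (simp add: powr_minus powr_numeral field_simps)
  finally show ?thesis .
qed

lemma FT_bound2: "cmod (FT x) \<le> C / (1 + \<bar>x\<bar>)\<^sup>2"
proof -
  have "C * (1 + \<bar>x\<bar>) powr - \<beta> \<le> C * (1 / (1 + \<bar>x\<bar>)\<^sup>2)"
    using powr_minus_beta_le[of "1 + \<bar>x\<bar>"] C_nonneg by (intro mult_left_mono) auto
  then show ?thesis using FT_bound[of x] by simp
qed

text \<open>The shift moves the argument by at least |m|, so 1 + |m| is at most (1 + |\<mu>|)(1 +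
  |y|) at the shifted point y. For fixed \<mu> this gives absolute summability over all
  shifts.\<close>

lemma FT_shift_bound: "cmod (FT (\<mu> + 2 * pi * of_int m)) \<le> C * (1 + \<bar>\<mu>\<bar>)\<^sup>2 * (1 / (1 + \<bar>real_of_int m\<bar>)\<^sup>2)"
proof -
  define y where "y = \<mu> + 2 * pi * of_int m"
  have "1 * \<bar>real_of_int m\<bar> \<le> (2 * pi) * \<bar>real_of_int m\<bar>" using pi_gt3 by (intro mult_right_mono) auto
  also have "\<dots> = \<bar>y - \<mu>\<bar>" by (simp add: y_def abs_mult)
  also have "\<dots> \<le> \<bar>\<mu>\<bar> + \<bar>y\<bar>" by simp
  finally have "1 + \<bar>real_of_int m\<bar> \<le> (1 + \<bar>\<mu>\<bar>) * (1 + \<bar>y\<bar>)"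
    using mult_nonneg_nonneg[of "\<bar>\<mu>\<bar>" "\<bar>y\<bar>"] by (simp add: algebra_simps del: mult_nonneg_nonneg)
  then have "(1 + \<bar>real_of_int m\<bar>)\<^sup>2 \<le> ((1 + \<bar>\<mu>\<bar>) * (1 + \<bar>y\<bar>))\<^sup>2" by (intro power_mono) auto
  then have *: "1 / (1 + \<bar>y\<bar>)\<^sup>2 \<le> (1 + \<bar>\<mu>\<bar>)\<^sup>2 / (1 + \<bar>real_of_int m\<bar>)\<^sup>2"
  proof -
    have *: "1 / c \<le> b / a" if "a > 0" "c > 0" "a \<le> b * c" for a b c :: real
      using that by (simp add: field_simps)
    assume "(1 + \<bar>real_of_int m\<bar>)\<^sup>2 \<le> ((1 + \<bar>\<mu>\<bar>) * (1 + \<bar>y\<bar>))\<^sup>2"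
    then show ?thesis unfolding power_mult_distrib by (intro *) (auto intro!: zero_less_power add_pos_nonneg)
  qed
  have "cmod (FT y) \<le> C * (1 / (1 + \<bar>y\<bar>)\<^sup>2)" using FT_bound2[of y] by simp
  also have "\<dots> \<le> C * ((1 + \<bar>\<mu>\<bar>)\<^sup>2 / (1 + \<bar>real_of_int m\<bar>)\<^sup>2)" using * C_nonneg by (rule mult_left_mono)
  finally show ?thesis by (simp add: y_def)
qed

lemma summable_FT: "(\<lambda>m. cmod (FT (\<mu> + 2 * pi * of_int m))) summable_on UNIV"
  by (rule summable_on_comparison_test[OF summable_on_cmult_right[OF summable_on_inverse_square]])
     (use FT_shift_bound in auto)

lemma FT_series_uniform:
  defines "V \<equiv> \<lambda>\<mu> x. \<Sum>\<^sub>\<infinity>m. FT (\<mu> + 2 * pi * of_int m) * cis (2 * pi * of_int m * x)"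
  shows "uniform_limit UNIV (\<lambda>F x. \<Sum>m\<in>F. FT (\<mu> + 2 * pi * of_int m) * cis (2 * pi * of_int m * x)) (V \<mu>) (finite_subsets_at_top UNIV)"
  unfolding V_def by (rule Weierstrass_m_test_general[OF _ summable_FT[of \<mu>]]) (simp add: norm_mult)

lemma tendsto_integral_uniform_ival:
  fixes h :: "real \<Rightarrow> complex"
  assumes u: "uniform_limit UNIV f h F" and c: "\<forall>\<^sub>F i in F. continuous_on {a..b} (f i)" "continuous_on {a..b} h"
    and g: "continuous_on {a..b} g" and ab: "a \<le> b" and F: "F \<noteq> bot"
  shows "((\<lambda>i. integral\<^sup>L (ival a b) (\<lambda>x. f i x * g x)) \<longlongrightarrow> integral\<^sup>L (ival a b) (\<lambda>x. h x * g x)) F"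
proof (rule tendstoI)
  fix e :: real assume e: "e > 0"
  obtain B where B: "\<And>x. x \<in> {a..b} \<Longrightarrow> cmod (g x) \<le> B"
    using compact_imp_bounded[OF compact_continuous_image[OF g compact_Icc]] by (force simp: bounded_iff)
  have B0: "B \<ge> 0" using B[of a] ab order_trans[OF norm_ge_zero] by auto
  define d where "d = e / ((b - a) * B + 1)"
  have pos: "(b - a) * B + 1 > 0" using B0 ab by (simp add: add_nonneg_pos)
  have d: "d > 0" "(b - a) * (d * B) < e" using e pos by (auto simp: d_def field_simps)
  have "\<forall>\<^sub>F i in F. \<forall>x\<in>UNIV. dist (f i x) (h x) < d" using u d(1) by (rule uniform_limitD)
  with c(1) show "\<forall>\<^sub>F i in F. dist (integral\<^sup>L (ival a b) (\<lambda>x. f i x * g x)) (integral\<^sup>L (ival a b) (\<lambda>x. h x * g x)) < e"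
  proof eventually_elim
    case (elim i)
    have i: "integrable (ival a b) (\<lambda>x. f i x * g x)" "integrable (ival a b) (\<lambda>x. h x * g x)"
      by (intro continuous_integrable_ival continuous_intros elim c g)+
    have "dist (integral\<^sup>L (ival a b) (\<lambda>x. f i x * g x)) (integral\<^sup>L (ival a b) (\<lambda>x. h x * g x))
       = cmod (integral\<^sup>L (ival a b) (\<lambda>x. f i x * g x - h x * g x))" using i by (simp add: dist_norm)
    also have "\<dots> \<le> integral\<^sup>L (ival a b) (\<lambda>x. cmod (f i x * g x - h x * g x))" by (rule integral_norm_bound)
    also have "\<dots> \<le> integral\<^sup>L (ival a b) (\<lambda>x. d * B)"
    proof (rule integral_mono)
      show "integrable (ival a b) (\<lambda>x. cmod (f i x * g x - h x * g x))" using i by (intro integrable_norm Bochner_Integration.integrable_diff)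
      show "integrable (ival a b) (\<lambda>x. d * B)" by (intro continuous_integrable_ival continuous_intros)
      fix x assume "x \<in> space (ival a b)"
      then show "cmod (f i x * g x - h x * g x) \<le> d * B"
        using elim(2) B[of x] B0 d(1) unfolding left_diff_distrib[symmetric] norm_mult
        by (intro mult_mono) (auto simp: dist_norm intro: less_imp_le)
    qed
    also have "\<dots> = (b - a) * (d * B)" using ab by simp
    finally show ?case using d(2) by simp
  qed
qed

lemma integral_cis_ival_int:
  "integral\<^sup>L (ival (-1) 0) (\<lambda>x. cis (2 * pi * of_int m * x)) = (if m = 0 then 1 else 0)"
proof (cases "m = 0")
  case True
  then show ?thesis using integral_ival_const[of "-1" 0 "1::complex"] by simp
next
  case False
  have "cis (2 * pi * of_int m * (-1)) = 1"
    using cis_multiple_2pi[of "- of_int m"] by simp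
  then show ?thesis using False integral_cis_eq_0[of "2 * pi * of_int m" "-1" 0] by simp
qed

text \<open>The values of \<open>FT\<close> here are the Fourier coefficients of
  \<open>W x * cis (- (\<mu> * x))\<close> on an interval of length one. Being absolutely summable,
  they define a continuous sum with the same coefficients, and continuous functions with equal
  coefficients agree at every point, the endpoints included.\<close>

lemma FT_series:
  assumes x: "x \<in> {-1..0}"
  shows "((\<lambda>m. FT (\<mu> + 2 * pi * of_int m) * cis (2 * pi * of_int m * x)) has_sum (of_real (W x) * cis (- (\<mu> * x)))) UNIV"
proof -
  define V where "V x = (\<Sum>\<^sub>\<infinity>m. FT (\<mu> + 2 * pi * of_int m) * cis (2 * pi * of_int m * x))" for x
  have u: "uniform_limit UNIV (\<lambda>F x. \<Sum>m\<in>F. FT (\<mu> + 2 * pi * of_int m) * cis (2 * pi * of_int m * x)) V (finite_subsets_at_top UNIV)"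
    using FT_series_uniform[of \<mu>] unfolding V_def[abs_def] .
  have cV: "continuous_on A V" for A
    by (rule uniform_limit_theorem[OF _ uniform_limit_on_subset[OF u]]) (auto intro!: always_eventually continuous_intros)
  have sV: "((\<lambda>m. FT (\<mu> + 2 * pi * of_int m) * cis (2 * pi * of_int m * x)) has_sum V x) UNIV" for x
    using tendsto_uniform_limitI[OF u] by (auto simp: has_sum_def)
  have cW: "continuous_on A W" for A using contW by (rule continuous_on_subset) auto
  have "integral\<^sup>L (ival (-1) 0) (\<lambda>x. (V x - of_real (W x) * cis (- (\<mu> * x))) * cis (2 * pi * of_int k * x)) = 0" for k
  proof -
    have "((\<lambda>F. integral\<^sup>L (ival (-1) 0) (\<lambda>x. (\<Sum>m\<in>F. FT (\<mu> + 2 * pi * of_int m) * cis (2 * pi * of_int m * x)) * cis (2 * pi * of_int k * x)))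
      \<longlongrightarrow> integral\<^sup>L (ival (-1) 0) (\<lambda>x. V x * cis (2 * pi * of_int k * x))) (finite_subsets_at_top UNIV)"
      by (rule tendsto_integral_uniform_ival[OF u]) (auto intro!: always_eventually continuous_intros cV)
    moreover have "\<forall>\<^sub>F F in finite_subsets_at_top UNIV. integral\<^sup>L (ival (-1) 0) (\<lambda>x. (\<Sum>m\<in>F. FT (\<mu> + 2 * pi * of_int m) * cis (2 * pi * of_int m * x)) * cis (2 * pi * of_int k * x)) = FT (\<mu> - 2 * pi * of_int k)"
    proof -
      \<comment> \<open>Once F contains -k, the integral picks out this single frequency and no
        longer depends on F.\<close>
      have "\<forall>\<^sub>F F in finite_subsets_at_top UNIV. finite F \<and> -k \<in> F"
        unfolding eventually_finite_subsets_at_top by (intro exI[of _ "{-k}"]) auto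
      then show ?thesis
      proof eventually_elim
        case (elim F)
        have "integral\<^sup>L (ival (-1) 0) (\<lambda>x. (\<Sum>m\<in>F. FT (\<mu> + 2 * pi * of_int m) * cis (2 * pi * of_int m * x)) * cis (2 * pi * of_int k * x))
          = integral\<^sup>L (ival (-1) 0) (\<lambda>x. \<Sum>m\<in>F. FT (\<mu> + 2 * pi * of_int m) * cis (2 * pi * of_int (m + k) * x))"
          unfolding sum_distrib_right
          by (intro Bochner_Integration.integral_cong refl sum.cong) (simp add: mult.assoc cis_mult algebra_simps)
        also have "\<dots> = (\<Sum>m\<in>F. FT (\<mu> + 2 * pi * of_int m) * (if m = -k then 1 else 0))"
          by (subst Bochner_Integration.integral_sum)
             (auto intro!: sum.cong continuous_integrable_ival continuous_intros simp: integral_cis_ival_int simp del: of_int_add)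
        also have "\<dots> = FT (\<mu> - 2 * pi * of_int k)" using elim by (simp add: if_distrib[of "(*) _"] cong: if_cong)
        finally show ?case .
      qed
    qed
    ultimately have "((\<lambda>F. FT (\<mu> - 2 * pi * of_int k)) \<longlongrightarrow> integral\<^sup>L (ival (-1) 0) (\<lambda>x. V x * cis (2 * pi * of_int k * x))) (finite_subsets_at_top (UNIV::int set))"
      by (rule Lim_transform_eventually)
    then have V: "integral\<^sup>L (ival (-1) 0) (\<lambda>x. V x * cis (2 * pi * of_int k * x)) = FT (\<mu> - 2 * pi * of_int k)"
      using tendsto_unique[OF _ tendsto_const] by (metis finite_subsets_at_top_neq_bot)
    have Wk: "integral\<^sup>L (ival (-1) 0) (\<lambda>x. of_real (W x) * cis (- (\<mu> * x)) * cis (2 * pi * of_int k * x)) = FT (\<mu> - 2 * pi * of_int k)"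
      unfolding FT_ival by (intro Bochner_Integration.integral_cong refl) (simp add: mult.assoc cis_mult algebra_simps)
    have "integral\<^sup>L (ival (-1) 0) (\<lambda>x. (V x - of_real (W x) * cis (- (\<mu> * x))) * cis (2 * pi * of_int k * x))
      = integral\<^sup>L (ival (-1) 0) (\<lambda>x. V x * cis (2 * pi * of_int k * x)) - integral\<^sup>L (ival (-1) 0) (\<lambda>x. of_real (W x) * cis (- (\<mu> * x)) * cis (2 * pi * of_int k * x))"
      unfolding left_diff_distrib by (intro Bochner_Integration.integral_diff continuous_integrable_ival continuous_intros cV cW)
    then show ?thesis by (simp add: V Wk)
  qed
  then have "V x - of_real (W x) * cis (- (\<mu> * x)) = 0"
    by (intro fourier_coeffs_zero[of "\<lambda>x. V x - of_real (W x) * cis (- (\<mu> * x))"] x continuous_intros cV cW)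
  then show ?thesis using sV[of x] by simp
qed

text \<open>Integrating the uniformly convergent series against \<open>W x * cis (\<mu> * x)\<close>
  produces the conjugate coefficient in every term. The value does not depend on \<mu>, which later
  makes the periodized energy constant.\<close>

lemma FT_Parseval:
  "((\<lambda>m. (cmod (FT (\<mu> + 2 * pi * of_int m)))\<^sup>2) has_sum integral\<^sup>L (ival (-1) 0) (\<lambda>x. (W x)\<^sup>2)) UNIV"
proof -
  define V where "V x = (\<Sum>\<^sub>\<infinity>m. FT (\<mu> + 2 * pi * of_int m) * cis (2 * pi * of_int m * x))" for x
  have u: "uniform_limit UNIV (\<lambda>F x. \<Sum>m\<in>F. FT (\<mu> + 2 * pi * of_int m) * cis (2 * pi * of_int m * x)) V (finite_subsets_at_top UNIV)"
    using FT_series_uniform[of \<mu>] unfolding V_def[abs_def] .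
  have V: "V x = of_real (W x) * cis (- (\<mu> * x))" if "x \<in> {-1..0}" for x
    using FT_series[OF that] unfolding V_def by (rule infsumI)
  have cV: "continuous_on A V" for A
    by (rule uniform_limit_theorem[OF _ uniform_limit_on_subset[OF u]]) (auto intro!: always_eventually continuous_intros)
  have cW: "continuous_on A W" for A using contW by (rule continuous_on_subset) auto
  have "((\<lambda>F. integral\<^sup>L (ival (-1) 0) (\<lambda>x. (\<Sum>m\<in>F. FT (\<mu> + 2 * pi * of_int m) * cis (2 * pi * of_int m * x)) * (of_real (W x) * cis (\<mu> * x))))
      \<longlongrightarrow> integral\<^sup>L (ival (-1) 0) (\<lambda>x. V x * (of_real (W x) * cis (\<mu> * x)))) (finite_subsets_at_top UNIV)"
    by (rule tendsto_integral_uniform_ival[OF u]) (auto intro!: always_eventually continuous_intros cV cW)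
  moreover have "integral\<^sup>L (ival (-1) 0) (\<lambda>x. (\<Sum>m\<in>F. FT (\<mu> + 2 * pi * of_int m) * cis (2 * pi * of_int m * x)) * (of_real (W x) * cis (\<mu> * x)))
      = of_real (\<Sum>m\<in>F. (cmod (FT (\<mu> + 2 * pi * of_int m)))\<^sup>2)" for F
  proof -
    have "integral\<^sup>L (ival (-1) 0) (\<lambda>x. (\<Sum>m\<in>F. FT (\<mu> + 2 * pi * of_int m) * cis (2 * pi * of_int m * x)) * (of_real (W x) * cis (\<mu> * x)))
      = integral\<^sup>L (ival (-1) 0) (\<lambda>x. \<Sum>m\<in>F. FT (\<mu> + 2 * pi * of_int m) * cnj (of_real (W x) * cis (- ((\<mu> + 2 * pi * of_int m) * x))))"
      unfolding sum_distrib_right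
      by (intro Bochner_Integration.integral_cong refl sum.cong)
         (simp add: mult_ac cis_cnj cis_mult distrib_left distrib_right add.commute)
    also have "\<dots> = (\<Sum>m\<in>F. FT (\<mu> + 2 * pi * of_int m) * cnj (FT (\<mu> + 2 * pi * of_int m)))"
      by (subst Bochner_Integration.integral_sum)
         (auto intro!: sum.cong continuous_integrable_ival continuous_intros cW simp: FT_cnj)
    also have "\<dots> = of_real (\<Sum>m\<in>F. (cmod (FT (\<mu> + 2 * pi * of_int m)))\<^sup>2)"
      by (simp only: of_real_sum complex_norm_square)
    finally show ?thesis .
  qed
  moreover have "integral\<^sup>L (ival (-1) 0) (\<lambda>x. V x * (of_real (W x) * cis (\<mu> * x))) = of_real (integral\<^sup>L (ival (-1) 0) (\<lambda>x. (W x)\<^sup>2))"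
    unfolding integral_complex_of_real[symmetric]
    by (intro Bochner_Integration.integral_cong refl) (simp add: V cis_mult power2_eq_square mult_ac)
  ultimately show ?thesis unfolding has_sum_def by (simp only: tendsto_of_real_iff)
qed

end

text \<open>A geometric sum of roots of unity. Sampling at the points -j / g keeps only the
  frequencies divisible by g, which is the source of aliasing.\<close>

lemma sum_cis_roots_of_unity:
  assumes "g > 0"
  shows "(\<Sum>j<g. cis (2 * pi * of_int m * (- real j / real g))) = (if int g dvd m then of_nat g else 0)"
proof -
  define z where "z = cis (2 * pi * of_int m * (- 1 / real g))"
  have pow: "cis (2 * pi * of_int m * (- real j / real g)) = z ^ j" for j
    unfolding z_def by (subst Complex.DeMoivre) (simp add: mult_ac)
  have zg: "z ^ g = 1"
    using assms cis_multiple_2pi[of "of_int (- m)"] unfolding z_def by (subst Complex.DeMoivre) (simp add: mult_ac)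
  have z1: "z = 1 \<longleftrightarrow> int g dvd m"
  proof
    assume "int g dvd m"
    then obtain k where "m = int g * k" by (auto simp: dvd_def)
    then show "z = 1" using assms cis_multiple_2pi[of "of_int (- k)"] by (simp add: z_def mult_ac)
  next
    assume "z = 1"
    then have "cos (2 * pi * of_int m * (- 1 / real g)) = 1" by (metis z_def cis.sel(1) one_complex.sel(1))
    then obtain n :: int where "2 * pi * of_int m * (- 1 / real g) = of_int n * 2 * pi"
      using cos_one_2pi_int[THEN iffD1] by blast
    then have "pi * real_of_int m = pi * of_int (- n * int g)" using assms by (simp add: field_simps)
    then have "real_of_int m = of_int (- n * int g)" using pi_neq_zero mult_left_cancel by blast
    then have "m = - n * int g" by (simp only: of_int_eq_iff)
    then show "int g dvd m" by simp
  qed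
  show ?thesis
  proof (cases "z = 1")
    case True
    then show ?thesis using z1 unfolding pow by simp
  next
    case False
    then show ?thesis using z1 zg unfolding pow by (simp add: geometric_sum)
  qed
qed

lemma integrable_inverse_1_plus_sq: "integrable lborel (\<lambda>x::real. 1 / (1 + x\<^sup>2))"
  and integral_inverse_1_plus_sq: "(LBINT x. 1 / (1 + x\<^sup>2)) = pi"
  using integrable_inverse_1_plus_square LBINT_inverse_1_plus_square
  by (simp_all add: set_integrable_def interval_lebesgue_integral_def set_lebesgue_integral_def inverse_eq_divide einterval_def)

lemma
  fixes g :: real
  assumes "g > 0"
  shows integrable_inverse_1_plus_scaled: "integrable lborel (\<lambda>x::real. 1 / (1 + (g * x)\<^sup>2))"
    and integral_inverse_1_plus_scaled: "(LBINT x. 1 / (1 + (g * x)\<^sup>2)) = pi / g"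
proof -
  show "integrable lborel (\<lambda>x::real. 1 / (1 + (g * x)\<^sup>2))"
    using lborel_integrable_real_affine[OF integrable_inverse_1_plus_sq, of g 0] assms by simp
  show "(LBINT x. 1 / (1 + (g * x)\<^sup>2)) = pi / g"
    using lborel_integral_real_affine[of g "\<lambda>x. 1 / (1 + x\<^sup>2)" 0] assms
    by (simp add: integral_inverse_1_plus_sq field_simps)
qed

lemma integral_ival_le_lborel:
  fixes f :: "real \<Rightarrow> real"
  assumes "integrable lborel f" "\<And>x. f x \<ge> 0"
  shows "integrable (ival a b) f" "integral\<^sup>L (ival a b) f \<le> (LBINT x. f x)"
proof -
  have i: "integrable lborel (\<lambda>x. indicator {a..b} x *\<^sub>R f x)"
    by (rule integrable_mult_indicator) (use assms in auto)
  then show "integrable (ival a b) f" by (simp add: integrable_ival set_integrable_def)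
  show "integral\<^sup>L (ival a b) f \<le> (LBINT x. f x)"
    unfolding integral_ival set_lebesgue_integral_def
    by (rule integral_mono[OF i assms(1)]) (use assms in \<open>auto simp: indicator_def\<close>)
qed

lemma integral_inverse_1_plus_scaled_ival:
  assumes "g > 0"
  shows "integrable (ival a b) (\<lambda>x. 1 / (1 + (g * x)\<^sup>2))"
    "integral\<^sup>L (ival a b) (\<lambda>x. 1 / (1 + (g * x)\<^sup>2)) \<le> pi / g"
  using integral_ival_le_lborel[OF integrable_inverse_1_plus_scaled[OF assms], of a b]
  by (simp_all add: integral_inverse_1_plus_scaled[OF assms])

lemma integral_cis_period:
  fixes m :: int
  shows "integral\<^sup>L (ival (-pi) pi) (\<lambda>x. cis (of_int m * x)) = (if m = 0 then of_real (2 * pi) else 0)"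
proof (cases "m = 0")
  case True
  then show ?thesis using integral_ival_const[of "-pi" pi "1::complex"] by (simp add: scaleR_conv_of_real)
next
  case False
  have "cis (of_int m * pi) = cis (of_int m * (-pi)) * cis (2 * pi * of_int m)"
    by (simp add: cis_mult algebra_simps)
  also have "cis (2 * pi * of_int m) = 1" by (rule cis_multiple_2pi) simp
  finally show ?thesis using False integral_cis_eq_0[of "of_int m" "-pi" pi] by simp
qed

section \<open>The transfer function of a weighted block\<close>

context window
begin

text \<open>Transfer function of the block weights: its squared modulus multiplies the spectral
  density in the covariances of block sums. The division by \<open>sqrt g\<close> gives it nearly
  unit energy over a period.\<close>

definition P :: "nat \<Rightarrow> real \<Rightarrow> complex" where
  "P g l = (\<Sum>j<g. of_real (W (- real j / real g) / sqrt (real g)) * cis (real j * l))"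

lemma isCont_P: "continuous_on A (P g)"
  unfolding P_def[abs_def] by (intro continuous_intros)

lemma P_measurable [measurable]: "P g \<in> borel_measurable borel"
  by (rule borel_measurable_continuous_onI[OF isCont_P])

text \<open>Take \<open>FT_series\<close> with \<mu> = g l at the points -j / g, where the phase is
  exactly j l, and sum over j. Only the frequencies m = g p survive, each with weight g, of which
  the normalization leaves \<open>sqrt g\<close>.\<close>

lemma P_Poisson:
  assumes g: "g > 0"
  shows "((\<lambda>p. of_real (sqrt g) * FT (g * l + 2 * pi * g * of_int p)) has_sum P g l) UNIV"
proof -
  define c where "c m = FT (g * l + 2 * pi * of_int m)" for m
  have "((\<lambda>m. \<Sum>j<g. c m * cis (2 * pi * of_int m * (- real j / real g))) has_sum
      (\<Sum>j<g. of_real (W (- real j / real g)) * cis (real j * l))) UNIV"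
  proof -
    have "((\<lambda>m. c m * cis (2 * pi * of_int m * (- real j / real g))) has_sum (of_real (W (- real j / real g)) * cis (real j * l))) UNIV" if "j < g" for j
    proof -
      have "- real j / real g \<in> {-1..0}" using that by (simp add: field_simps)
      moreover have "- (g * l * (- real j / real g)) = real j * l" using g by simp
      ultimately show ?thesis using FT_series[of "- real j / real g" "g * l"] by (simp add: c_def)
    qed
    then have "((\<lambda>F. \<Sum>j<g. \<Sum>m\<in>F. c m * cis (2 * pi * of_int m * (- real j / real g))) \<longlongrightarrow>
      (\<Sum>j<g. of_real (W (- real j / real g)) * cis (real j * l))) (finite_subsets_at_top UNIV)"
      unfolding has_sum_def by (intro tendsto_sum) auto
    moreover have "(\<lambda>F. \<Sum>j<g. \<Sum>m\<in>F. c m * cis (2 * pi * of_int m * (- real j / real g))) =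
       sum (\<lambda>m. \<Sum>j<g. c m * cis (2 * pi * of_int m * (- real j / real g)))"
      by (rule ext) (rule sum.swap)
    ultimately show ?thesis unfolding has_sum_def by simp
  qed
  then have "((\<lambda>m. c m * (if int g dvd m then of_nat g else 0)) has_sum
      (\<Sum>j<g. of_real (W (- real j / real g)) * cis (real j * l))) UNIV"
    by (simp only: sum_distrib_left[symmetric] sum_cis_roots_of_unity[OF g])
  then have "((\<lambda>m. c m * (if int g dvd m then of_nat g else 0)) has_sum
      (\<Sum>j<g. of_real (W (- real j / real g)) * cis (real j * l))) (range (\<lambda>p. int g * p))"
    by (subst (asm) has_sum_cong_neutral[of "range (\<lambda>p. int g * p)" UNIV]) auto
  then have "((\<lambda>p. c (int g * p) * of_nat g) has_sum
      (\<Sum>j<g. of_real (W (- real j / real g)) * cis (real j * l))) UNIV"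
    using g by (subst (asm) has_sum_reindex) (auto simp: inj_on_def o_def)
  then have "((\<lambda>p. (1 / of_real (sqrt g)) * (c (int g * p) * of_nat g)) has_sum
      ((1 / of_real (sqrt g)) * (\<Sum>j<g. of_real (W (- real j / real g)) * cis (real j * l)))) UNIV"
    by (rule has_sum_cmult_right)
  moreover have "(1 / of_real (sqrt g)) * (\<Sum>j<g. of_real (W (- real j / real g)) * cis (real j * l)) = P g l"
    by (simp add: P_def sum_divide_distrib)
  moreover have "(1 / complex_of_real (sqrt g)) * (c (int g * p) * of_nat g) = of_real (sqrt g) * FT (g * l + 2 * pi * g * of_int p)" for p
  proof -
    have "complex_of_real (sqrt g) * complex_of_real (sqrt g) = of_nat g"
      by (simp flip: of_real_mult)
    then show ?thesis using g by (simp add: c_def field_simps)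
  qed
  ultimately show ?thesis by simp
qed

text \<open>The 4 compares \<open>1 / p\<^sup>2\<close> with
  \<open>1 / (1 + \<bar>p\<bar>)\<^sup>2\<close> for nonzero integers p in the aliasing
  terms.\<close>

definition "K1 = C * 4 * (\<Sum>\<^sub>\<infinity>p::int. 1 / (1 + \<bar>real_of_int p\<bar>)\<^sup>2)"
definition "K2 = C + K1 * (1 + pi) powr \<beta>"

lemma K1_nonneg: "K1 \<ge> 0"
  unfolding K1_def using C_nonneg by (intro mult_nonneg_nonneg infsum_nonneg) auto

lemma K2_nonneg: "K2 \<ge> 0" "C \<le> K2"
  unfolding K2_def using C_nonneg K1_nonneg by auto

text \<open>Apart from p = 0, the condition |l| \<le> \<pi> keeps the arguments in the Poisson sum
  at distance at least \<pi> g |p| from zero, so each term decays like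
  \<open>(g * \<bar>p\<bar>) powr - \<beta>\<close>.\<close>

lemma P_aliasing:
  assumes g: "g > 0" and l: "\<bar>l\<bar> \<le> pi"
  shows "cmod (P g l - of_real (sqrt g) * FT (g * l)) \<le> K1 * (sqrt g * g powr - \<beta>)"
proof -
  define f where "f p = complex_of_real (sqrt g) * FT (g * l + 2 * pi * g * of_int p)" for p
  have s1: "(f has_sum P g l) UNIV" unfolding f_def by (rule P_Poisson[OF g])
  have s0: "((\<lambda>p. if p = 0 then f 0 else 0) has_sum f 0) (UNIV :: int set)"
    by (subst has_sum_cong_neutral[of "{0}" UNIV f]) (auto intro: has_sum_finiteI)
  have "((\<lambda>p. - (if p = 0 then f 0 else 0)) has_sum - f 0) (UNIV :: int set)"
    using has_sum_cmult_right[OF s0, of "-1"] by simp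
  from has_sum_add[OF s1 this] have s: "((\<lambda>p. f p + - (if p = 0 then f 0 else 0)) has_sum (P g l - f 0)) UNIV" by simp
  have b: "cmod (f p + - (if p = 0 then f 0 else 0)) \<le> (C * 4 * (sqrt g * g powr - \<beta>)) * (1 / (1 + \<bar>real_of_int p\<bar>)\<^sup>2)" for p
  proof (cases "p = 0")
    case True
    then show ?thesis using C_nonneg by simp
  next
    case False
    then have p1: "\<bar>real_of_int p\<bar> \<ge> 1" by linarith
    have "g * \<bar>real_of_int p\<bar> \<le> g * (pi * \<bar>real_of_int p\<bar>)" using pi_gt3 by (intro mult_left_mono) (auto intro: mult_right_mono[of 1 pi, simplified])
    also have "pi * \<bar>real_of_int p\<bar> \<le> 2 * pi * \<bar>real_of_int p\<bar> - \<bar>l\<bar>"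
    proof -
      have "\<bar>l\<bar> \<le> pi * 1" using l by simp
      also have "\<dots> \<le> pi * \<bar>real_of_int p\<bar>" using p1 by (intro mult_left_mono) auto
      finally show ?thesis by simp
    qed
    also have "\<dots> \<le> \<bar>2 * pi * real_of_int p + l\<bar>"
      using abs_triangle_ineq[of "2 * pi * real_of_int p + l" "- l"] by (simp add: abs_mult)
    also have "g * \<dots> = \<bar>g * l + 2 * pi * g * of_int p\<bar>"
    proof -
      have "g * l + 2 * pi * g * of_int p = g * (2 * pi * real_of_int p + l)" by (simp add: algebra_simps)
      then show ?thesis by (simp add: abs_mult)
    qed
    finally have y: "g * \<bar>real_of_int p\<bar> \<le> 1 + \<bar>g * l + 2 * pi * g * of_int p\<bar>" using g by (simp add: mult_left_mono)
    have "cmod (FT (g * l + 2 * pi * g * of_int p)) \<le> C * (1 + \<bar>g * l + 2 * pi * g * of_int p\<bar>) powr - \<beta>" by (rule FT_bound)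
    also have "\<dots> \<le> C * (g * \<bar>real_of_int p\<bar>) powr - \<beta>"
      using y g p1 beta C_nonneg by (intro mult_left_mono powr_mono2') auto
    also have "\<dots> = C * (g powr - \<beta> * \<bar>real_of_int p\<bar> powr - \<beta>)" by (simp add: powr_mult)
    also have "\<dots> \<le> C * (g powr - \<beta> * (4 * (1 / (1 + \<bar>real_of_int p\<bar>)\<^sup>2)))"
    proof (intro mult_left_mono C_nonneg)
      have "\<bar>real_of_int p\<bar> powr - \<beta> \<le> 1 / \<bar>real_of_int p\<bar>\<^sup>2" by (rule powr_minus_beta_le[OF p1])
      also have "\<dots> \<le> 4 * (1 / (1 + \<bar>real_of_int p\<bar>)\<^sup>2)"
      proof -
        have "(1 + \<bar>real_of_int p\<bar>)\<^sup>2 \<le> (2 * \<bar>real_of_int p\<bar>)\<^sup>2" using p1 by (intro power_mono) auto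
        moreover have "(1 + \<bar>real_of_int p\<bar>)\<^sup>2 > 0" "\<bar>real_of_int p\<bar>\<^sup>2 > 0" using p1 by (auto intro!: zero_less_power)
        ultimately show ?thesis by (simp only: power_mult_distrib) (simp add: field_simps)
      qed
      finally show "\<bar>real_of_int p\<bar> powr - \<beta> \<le> 4 * (1 / (1 + \<bar>real_of_int p\<bar>)\<^sup>2)" .
    qed simp
    finally have "sqrt g * cmod (FT (g * l + 2 * pi * g * of_int p)) \<le> sqrt g * (C * (g powr - \<beta> * (4 * (1 / (1 + \<bar>real_of_int p\<bar>)\<^sup>2))))"
      by (rule mult_left_mono) simp
    then show ?thesis using False by (simp add: f_def norm_mult mult_ac)
  qed
  have sumb: "(\<lambda>p::int. (C * 4 * (sqrt g * g powr - \<beta>)) * (1 / (1 + \<bar>real_of_int p\<bar>)\<^sup>2)) summable_on UNIV"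
    by (intro summable_on_cmult_right summable_on_inverse_square)
  have sn: "(\<lambda>p. cmod (f p + - (if p = 0 then f 0 else 0))) summable_on UNIV"
    by (rule summable_on_comparison_test[OF sumb b]) auto
  have "cmod (P g l - f 0) \<le> (\<Sum>\<^sub>\<infinity>p. cmod (f p + - (if p = 0 then f 0 else 0)))"
    by (rule norm_has_sum_bound[OF has_sum_infsum[OF sn] s])
  also have "\<dots> \<le> (\<Sum>\<^sub>\<infinity>p. (C * 4 * (sqrt g * g powr - \<beta>)) * (1 / (1 + \<bar>real_of_int p\<bar>)\<^sup>2))"
    by (rule infsum_mono[OF sn sumb b])
  also have "\<dots> = (C * 4 * (sqrt g * g powr - \<beta>)) * (\<Sum>\<^sub>\<infinity>p::int. 1 / (1 + \<bar>real_of_int p\<bar>)\<^sup>2)"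
    by (rule infsum_cmult_right) (use summable_on_inverse_square in auto)
  also have "\<dots> = K1 * (sqrt g * g powr - \<beta>)" by (simp add: K1_def)
  finally show ?thesis by (simp add: f_def)
qed

text \<open>The aliasing error does not decay in l, but on the period
  \<open>1 + g * \<bar>l\<bar>\<close> is at most (1 + \<pi>) g. The error can thus be written with
  the same decaying profile as the main term, at the price of the factor
  \<open>(1 + pi) powr \<beta>\<close> in \<open>K2\<close>.\<close>

lemma P_bound:
  assumes g: "g > 0" and l: "\<bar>l\<bar> \<le> pi"
  shows "cmod (P g l) \<le> K2 * (sqrt g * (1 + g * \<bar>l\<bar>) powr - \<beta>)"
proof -
  have g1: "real g \<ge> 1" using g by simp
  have "cmod (P g l) \<le> cmod (P g l - of_real (sqrt g) * FT (g * l)) + cmod (of_real (sqrt g) * FT (g * l))"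
    using norm_triangle_ineq[of "P g l - of_real (sqrt g) * FT (g * l)" "of_real (sqrt g) * FT (g * l)"] by simp
  also have "\<dots> \<le> K1 * (sqrt g * g powr - \<beta>) + sqrt g * (C * (1 + \<bar>g * l\<bar>) powr - \<beta>)"
    using P_aliasing[OF g l] FT_bound[of "g * l"] by (intro add_mono) (auto simp: norm_mult intro: mult_left_mono)
  also have "\<bar>g * l\<bar> = g * \<bar>l\<bar>" by (simp add: abs_mult)
  finally have *: "cmod (P g l) \<le> K1 * (sqrt g * g powr - \<beta>) + sqrt g * (C * (1 + g * \<bar>l\<bar>) powr - \<beta>)" .
  have "g powr - \<beta> \<le> (1 + pi) powr \<beta> * (1 + g * \<bar>l\<bar>) powr - \<beta>"
  proof -
    have "1 + g * \<bar>l\<bar> \<le> g + g * pi" using g1 l by (intro add_mono mult_left_mono) auto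
    also have "\<dots> = (1 + pi) * g" by (simp add: algebra_simps)
    finally have "((1 + pi) * g) powr - \<beta> \<le> (1 + g * \<bar>l\<bar>) powr - \<beta>"
      using beta by (intro powr_mono2') (auto intro: add_pos_nonneg)
    then have "(1 + pi) powr \<beta> * ((1 + pi) * g) powr - \<beta> \<le> (1 + pi) powr \<beta> * (1 + g * \<bar>l\<bar>) powr - \<beta>"
      by (intro mult_left_mono) auto
    moreover have "1 + pi \<noteq> 0" using pi_gt_zero by linarith
    then have "(1 + pi) powr \<beta> * ((1 + pi) * g) powr - \<beta> = g powr - \<beta>"
      by (simp add: powr_mult powr_minus)
    ultimately show ?thesis by simp
  qed
  then have "K1 * (sqrt g * g powr - \<beta>) \<le> K1 * (sqrt g * ((1 + pi) powr \<beta> * (1 + g * \<bar>l\<bar>) powr - \<beta>))"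
    using K1_nonneg by (intro mult_left_mono) auto
  with * show ?thesis by (simp add: K2_def algebra_simps)
qed

lemma P_bound2:
  assumes g: "g > 0" and l: "\<bar>l\<bar> \<le> pi"
  shows "cmod (P g l) \<le> K2 * (sqrt g / (1 + g * \<bar>l\<bar>)\<^sup>2)"
proof -
  have "(1 + g * \<bar>l\<bar>) powr - \<beta> \<le> 1 / (1 + g * \<bar>l\<bar>)\<^sup>2" by (rule powr_minus_beta_le) simp
  then have "K2 * (sqrt g * (1 + g * \<bar>l\<bar>) powr - \<beta>) \<le> K2 * (sqrt g * (1 / (1 + g * \<bar>l\<bar>)\<^sup>2))"
    using K2_nonneg by (intro mult_left_mono) auto
  then show ?thesis using P_bound[OF assms] by simp
qed

lemma P_sq_expand:
  "complex_of_real ((cmod (P g l))\<^sup>2) = (\<Sum>j<g. \<Sum>k<g.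
    of_real (W (- real j / real g) / sqrt (real g) * (W (- real k / real g) / sqrt (real g))) * cis (of_int (int j - int k) * l))"
proof -
  define w where "w j = W (- real j / real g) / sqrt (real g)" for j
  have "complex_of_real ((cmod (P g l))\<^sup>2) = P g l * cnj (P g l)" by (rule complex_norm_square)
  also have "\<dots> = (\<Sum>j<g. \<Sum>k<g. of_real (w j * w k) * cis (of_int (int j - int k) * l))"
    unfolding P_def w_def[symmetric] cnj_sum sum_product
  proof (intro sum.cong refl)
    fix j k
    have "of_real (w j) * cis (real j * l) * cnj (of_real (w k) * cis (real k * l))
      = of_real (w j * w k) * (cis (real j * l) * cis (- (real k * l)))"
      by (simp add: cis_cnj)
    then show "of_real (w j) * cis (real j * l) * cnj (of_real (w k) * cis (real k * l)) = of_real (w j * w k) * cis (of_int (int j - int k) * l)"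
      by (simp add: cis_mult left_diff_distrib)
  qed
  finally show ?thesis unfolding w_def .
qed

text \<open>The squared modulus of P is a trigonometric polynomial with frequencies j - k for j, k <
  g, all smaller than g in absolute value. A nonzero multiple of g cannot be cancelled by any of
  them.\<close>

lemma P_orthogonal:
  fixes h :: int
  assumes h: "h \<noteq> 0"
  shows "integral\<^sup>L (ival (-pi) pi) (\<lambda>l. of_real ((cmod (P g l))\<^sup>2) * cis (of_int (int g * h) * l)) = 0"
proof (cases "g = 0")
  case True
  then show ?thesis by (simp add: P_def)
next
  case False
  define w where "w j = W (- real j / real g) / sqrt (real g)" for j
  have "of_real ((cmod (P g l))\<^sup>2) * cis (of_int (int g * h) * l)
     = (\<Sum>j<g. \<Sum>k<g. of_real (w j * w k) * cis (of_int (int j - int k + int g * h) * l))" for l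
  proof -
    show ?thesis unfolding P_sq_expand w_def[symmetric]
      by (simp add: sum_distrib_right mult.assoc cis_mult distrib_right)
  qed
  moreover have "integral\<^sup>L (ival (-pi) pi) (\<lambda>l. \<Sum>j<g. \<Sum>k<g. of_real (w j * w k) * cis (of_int (int j - int k + int g * h) * l)) = 0"
  proof -
    have "int j - int k + int g * h \<noteq> 0" if "j < g" "k < g" for j k
    proof
      assume "int j - int k + int g * h = 0"
      then have "int g * h = int k - int j" by simp
      moreover have "int g \<le> \<bar>int g * h\<bar>" using h mult_left_mono[of 1 "\<bar>h\<bar>" "int g"] by (simp add: abs_mult)
      ultimately show False using that by linarith
    qed
    then have z: "integral\<^sup>L (ival (-pi) pi) (\<lambda>l. cis (of_int (int j - int k + int g * h) * l)) = 0" if "j < g" "k < g" for j k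
      using that integral_cis_period by presburger
    have i: "integrable (ival (-pi) pi) (\<lambda>l. of_real (w j * w k) * cis (of_int (int j - int k + int g * h) * l))" for j k
      by (intro continuous_integrable_ival continuous_intros)
    have "integral\<^sup>L (ival (-pi) pi) (\<lambda>l. \<Sum>j<g. \<Sum>k<g. of_real (w j * w k) * cis (of_int (int j - int k + int g * h) * l))
      = (\<Sum>j<g. \<Sum>k<g. of_real (w j * w k) * integral\<^sup>L (ival (-pi) pi) (\<lambda>l. cis (of_int (int j - int k + int g * h) * l)))"
      using i by (simp only: Bochner_Integration.integral_sum Bochner_Integration.integrable_sum integral_mult_right_zero)
    also have "\<dots> = 0" using z by (intro sum.neutral ballI) simp
    finally show ?thesis .
  qed
  ultimately show ?thesis by simp
qed

end

section \<open>Energy of the transfer function and of the window\<close>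

context window
begin

lemma FT_measurable [measurable]: "FT \<in> borel_measurable borel"
proof -
  have s: "snd \<in> borel_measurable (borel \<Otimes>\<^sub>M ival (-1) 0)"
    unfolding ival_def by (rule measurable_compose[OF measurable_snd, of "\<lambda>x. x", simplified]) (intro measurable_restrict_space1, simp)
  have f: "fst \<in> borel_measurable (borel \<Otimes>\<^sub>M ival (-1) 0)" by (rule measurable_fst)
  have "(\<lambda>p. complex_of_real (W (snd p)) * cis (- (fst p * snd p))) \<in> borel_measurable (borel \<Otimes>\<^sub>M ival (-1) 0)"
    using measurable_compose[OF s W_measurable] borel_measurable_cis[OF borel_measurable_uminus[OF borel_measurable_times[OF f s]]]
    by measurable
  then have "(\<lambda>x. integral\<^sup>L (ival (-1) 0) (\<lambda>t. complex_of_real (W t) * cis (- (x * t)))) \<in> borel_measurable borel"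
    by (intro ival.borel_measurable_lebesgue_integral) (simp add: case_prod_beta)
  then show ?thesis unfolding FT_ival[abs_def] .
qed

lemma FT_sq_le: "(cmod (FT x))\<^sup>2 \<le> C\<^sup>2 * (1 / (1 + x\<^sup>2))"
proof -
  have a: "cmod (FT x) \<le> C / (1 + \<bar>x\<bar>)"
  proof -
    have "C / (1 + \<bar>x\<bar>)\<^sup>2 \<le> C / (1 + \<bar>x\<bar>)"
      using C_nonneg mult_right_mono[of 1 "1 + \<bar>x\<bar>" "1 + \<bar>x\<bar>"]
      by (intro divide_left_mono) (auto simp: power2_eq_square intro!: mult_pos_pos add_pos_nonneg)
    then show ?thesis using FT_bound2[of x] by simp
  qed
  have "(cmod (FT x))\<^sup>2 \<le> (C / (1 + \<bar>x\<bar>))\<^sup>2" using a by (intro power_mono) auto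
  also have "\<dots> = C\<^sup>2 / (1 + \<bar>x\<bar>)\<^sup>2" by (simp add: power_divide)
  also have "\<dots> \<le> C\<^sup>2 / (1 + x\<^sup>2)"
    by (intro divide_left_mono) (auto simp: power2_sum intro!: mult_pos_pos add_pos_nonneg zero_less_power)
  finally show ?thesis by simp
qed

lemma FT_sq_integrable: "integrable lborel (\<lambda>x. (cmod (FT x))\<^sup>2)"
  by (rule Bochner_Integration.integrable_bound[OF integrable_mult_right[OF integrable_inverse_1_plus_sq, of "C\<^sup>2"]])
     (use FT_sq_le in auto)

text \<open>Outside [-R, R] the squared transform is at most a multiple of the inverse fourth power
  of 1 + |x|. Two of these powers yield \<open>1 / R\<^sup>2\<close>, the other two the integrable
  \<open>1 / (1 + x\<^sup>2)\<close>.\<close>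

lemma FT_sq_tail:
  assumes R: "R > 0"
  shows "1 - integral\<^sup>L (ival (-R) R) (\<lambda>x. (cmod (FT x))\<^sup>2) \<in> {0..C\<^sup>2 * pi / R\<^sup>2}"
proof -
  let ?f = "\<lambda>x. (cmod (FT x))\<^sup>2"
  have i1: "integrable lborel (\<lambda>x. indicator {-R..R} x *\<^sub>R ?f x)"
    by (rule integrable_mult_indicator[OF _ FT_sq_integrable]) simp
  have "1 - integral\<^sup>L (ival (-R) R) ?f = (LBINT x. ?f x - indicator {-R..R} x *\<^sub>R ?f x)"
    using i1 FT_sq_integrable by (simp add: unit integral_ival set_lebesgue_integral_def)
  moreover have i3: "integrable lborel (\<lambda>x. C\<^sup>2 / R\<^sup>2 * (1 / (1 + x\<^sup>2)))"
    by (intro integrable_mult_right integrable_inverse_1_plus_sq)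
  have "(LBINT x. ?f x - indicator {-R..R} x *\<^sub>R ?f x) \<le> (LBINT x. C\<^sup>2 / R\<^sup>2 * (1 / (1 + x\<^sup>2)))"
  proof (rule integral_mono)
    fix x
    show "?f x - indicator {-R..R} x *\<^sub>R ?f x \<le> C\<^sup>2 / R\<^sup>2 * (1 / (1 + x\<^sup>2))"
    proof (cases "\<bar>x\<bar> \<le> R")
      case True then show ?thesis by (auto simp: indicator_def)
    next
      case False
      have "?f x \<le> (C / (1 + \<bar>x\<bar>)\<^sup>2)\<^sup>2" using FT_bound2 by (intro power_mono) auto
      also have "\<dots> = C\<^sup>2 / ((1 + \<bar>x\<bar>)\<^sup>2 * (1 + \<bar>x\<bar>)\<^sup>2)" by (simp add: power_divide power2_eq_square)
      also have "\<dots> \<le> C\<^sup>2 / (R\<^sup>2 * (1 + x\<^sup>2))"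
      proof (intro divide_left_mono mult_mono)
        show "R\<^sup>2 \<le> (1 + \<bar>x\<bar>)\<^sup>2" using False R by (intro power_mono) auto
        show "1 + x\<^sup>2 \<le> (1 + \<bar>x\<bar>)\<^sup>2" by (simp add: power2_sum)
        show "0 < (1 + \<bar>x\<bar>)\<^sup>2 * (1 + \<bar>x\<bar>)\<^sup>2 * (R\<^sup>2 * (1 + x\<^sup>2))"
          using R by (intro mult_pos_pos zero_less_power add_pos_nonneg) auto
      qed auto
      finally have "?f x \<le> C\<^sup>2 / R\<^sup>2 * (1 / (1 + x\<^sup>2))" by simp
      moreover have "0 \<le> indicator {-R..R} x *\<^sub>R ?f x" by simp
      ultimately show ?thesis by linarith
    qed
  qed (use i1 i3 FT_sq_integrable in auto)
  moreover have "(LBINT x. C\<^sup>2 / R\<^sup>2 * (1 / (1 + x\<^sup>2))) = C\<^sup>2 * pi / R\<^sup>2"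
    by (subst integral_mult_right_zero) (simp add: integral_inverse_1_plus_sq)
  moreover have "0 \<le> (LBINT x. ?f x - indicator {-R..R} x *\<^sub>R ?f x)"
    by (rule Bochner_Integration.integral_nonneg) (auto simp: indicator_def)
  ultimately show ?thesis by simp
qed

lemma FT_scaled_integral:
  assumes "g > 0"
  shows "integral\<^sup>L (ival (-pi) pi) (\<lambda>l. g * (cmod (FT (g * l)))\<^sup>2) = integral\<^sup>L (ival (-(g * pi)) (g * pi)) (\<lambda>x. (cmod (FT x))\<^sup>2)"
proof -
  have "integral\<^sup>L (ival (-(g * pi)) (g * pi)) (\<lambda>x. (cmod (FT x))\<^sup>2) = \<bar>g\<bar> *\<^sub>R (LBINT l. indicator {-(g * pi)..g * pi} (0 + g * l) *\<^sub>R (cmod (FT (0 + g * l)))\<^sup>2)"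
    unfolding integral_ival set_lebesgue_integral_def by (rule lborel_integral_real_affine) (use assms in simp)
  also have "\<dots> = (LBINT l. indicator {-pi..pi} l *\<^sub>R (g * (cmod (FT (g * l)))\<^sup>2))"
  proof -
    have "indicator {-(g * pi)..g * pi} (0 + g * l) = (indicator {-pi..pi} l :: real)" for l
    proof -
      have "g * l \<le> g * pi \<longleftrightarrow> l \<le> pi" using assms by simp
      moreover have "-(g * pi) \<le> g * l \<longleftrightarrow> -pi \<le> l"
        using assms mult_le_cancel_left_pos[of g "-pi" l] by simp
      ultimately show ?thesis by (simp add: indicator_def)
    qed
    then have "\<bar>g\<bar> *\<^sub>R (LBINT l. indicator {-(g * pi)..g * pi} (0 + g * l) *\<^sub>R (cmod (FT (0 + g * l)))\<^sup>2) = (LBINT l. g * (indicator {-pi..pi} l * (cmod (FT (g * l)))\<^sup>2))"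
      using assms by simp
    also have "\<dots> = (LBINT l. indicator {-pi..pi} l *\<^sub>R (g * (cmod (FT (g * l)))\<^sup>2))"
      by (intro Bochner_Integration.integral_cong refl) simp
    finally show ?thesis .
  qed
  finally show ?thesis unfolding integral_ival set_lebesgue_integral_def by (rule sym)
qed

definition "K3 = K1 * (K2 + C) * pi + C\<^sup>2"

lemma P_sq_integrable: "integrable (ival (-pi) pi) (\<lambda>l. (cmod (P g l))\<^sup>2)"
  by (intro continuous_integrable_ival continuous_intros isCont_P)

text \<open>A difference of squares: the aliasing error is uniformly small, while the sum of the two
  moduli has an envelope with integral of order 1 / sqrt g. Together they leave
  \<open>g powr - \<beta>\<close>, which is at most \<open>g powr - 2\<close> because \<beta> > 2.
  The energy of the main term is that of the transform on [-g \<pi>, g \<pi>], and the missing tail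
  has order \<open>g powr - 2\<close> too.\<close>

lemma P_energy:
  assumes g: "g > 0"
  shows "\<bar>integral\<^sup>L (ival (-pi) pi) (\<lambda>l. (cmod (P g l))\<^sup>2) - 1\<bar> \<le> K3 / (real g)\<^sup>2"
proof -
  have g1: "real g \<ge> 1" using g by simp
  define R where "R l = complex_of_real (sqrt g) * FT (g * l)" for l :: real
  have R2: "(cmod (R l))\<^sup>2 = g * (cmod (FT (g * l)))\<^sup>2" for l :: real by (simp add: R_def norm_mult power_mult_distrib)
  let ?I = "integral\<^sup>L (ival (-pi) pi)"
  have iR: "integrable (ival (-pi) pi) (\<lambda>l. (cmod (R l))\<^sup>2)"
  proof -
    have "integrable lborel (\<lambda>l. g * (cmod (FT (g * l)))\<^sup>2)"
      using lborel_integrable_real_affine[OF FT_sq_integrable, of g 0] g by simp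
    then have "integrable (ival (-pi) pi) (\<lambda>l. g * (cmod (FT (g * l)))\<^sup>2)" by (rule integral_ival_le_lborel(1)) auto
    then show ?thesis by (simp only: R2)
  qed
  have bound: "\<bar>(cmod (P g l))\<^sup>2 - (cmod (R l))\<^sup>2\<bar> \<le> K1 * (K2 + C) * (g * g powr - \<beta>) * (1 / (1 + (g * l)\<^sup>2))" if "l \<in> {-pi..pi}" for l :: real
  proof -
    have l: "\<bar>l\<bar> \<le> pi" using that by auto
    have "(cmod (P g l))\<^sup>2 - (cmod (R l))\<^sup>2 = (cmod (P g l) - cmod (R l)) * (cmod (P g l) + cmod (R l))"
      by (simp add: power2_eq_square algebra_simps)
    then have "\<bar>(cmod (P g l))\<^sup>2 - (cmod (R l))\<^sup>2\<bar> = \<bar>cmod (P g l) - cmod (R l)\<bar> * (cmod (P g l) + cmod (R l))"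
      by (simp add: abs_mult)
    also have "\<dots> \<le> (K1 * (sqrt g * g powr - \<beta>)) * (K2 * (sqrt g / (1 + g * \<bar>l\<bar>)\<^sup>2) + C * (sqrt g / (1 + g * \<bar>l\<bar>)\<^sup>2))"
    proof (intro mult_mono add_mono)
      show "\<bar>cmod (P g l) - cmod (R l)\<bar> \<le> K1 * (sqrt g * g powr - \<beta>)"
        using norm_triangle_ineq3[of "P g l" "R l"] P_aliasing[OF g l] unfolding R_def by simp
      show "cmod (P g l) \<le> K2 * (sqrt g / (1 + g * \<bar>l\<bar>)\<^sup>2)" by (rule P_bound2[OF g l])
      have "sqrt g * cmod (FT (g * l)) \<le> sqrt g * (C / (1 + \<bar>g * l\<bar>)\<^sup>2)" by (intro mult_left_mono FT_bound2) auto
      then show "cmod (R l) \<le> C * (sqrt g / (1 + g * \<bar>l\<bar>)\<^sup>2)" by (simp add: R_def norm_mult abs_mult mult_ac)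
    qed (use K1_nonneg in auto)
    also have "\<dots> = K1 * (K2 + C) * (g * g powr - \<beta>) * (1 / (1 + g * \<bar>l\<bar>)\<^sup>2)"
    proof -
      have "(K1 * (s * p)) * (K2 * (s / d) + C * (s / d)) = K1 * (K2 + C) * ((s * s) * p) * (1 / d)" for s p d :: real
        by (simp add: algebra_simps add_divide_distrib)
      from this[of "sqrt g" "g powr - \<beta>"] show ?thesis by simp
    qed
    also have "\<dots> \<le> K1 * (K2 + C) * (g * g powr - \<beta>) * (1 / (1 + (g * l)\<^sup>2))"
    proof (intro mult_left_mono divide_left_mono)
      show "1 + (g * l)\<^sup>2 \<le> (1 + g * \<bar>l\<bar>)\<^sup>2" by (simp add: power2_sum power_mult_distrib)
      show "0 < (1 + g * \<bar>l\<bar>)\<^sup>2 * (1 + (g * l)\<^sup>2)" by (intro mult_pos_pos zero_less_power add_pos_nonneg) auto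
    qed (use K1_nonneg K2_nonneg C_nonneg in auto)
    finally show ?thesis .
  qed
  have "\<bar>?I (\<lambda>l. (cmod (P g l))\<^sup>2) - ?I (\<lambda>l. (cmod (R l))\<^sup>2)\<bar> = \<bar>?I (\<lambda>l. (cmod (P g l))\<^sup>2 - (cmod (R l))\<^sup>2)\<bar>"
    using iR P_sq_integrable by simp
  also have "\<dots> \<le> ?I (\<lambda>l. \<bar>(cmod (P g l))\<^sup>2 - (cmod (R l))\<^sup>2\<bar>)" by (rule integral_abs_bound)
  also have "\<dots> \<le> ?I (\<lambda>l. K1 * (K2 + C) * (g * g powr - \<beta>) * (1 / (1 + (g * l)\<^sup>2)))"
    using iR P_sq_integrable bound integrable_mult_right[OF integral_inverse_1_plus_scaled_ival(1)[of g "-pi" pi], of "K1 * (K2 + C) * (g * g powr - \<beta>)"] g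
    by (intro integral_mono) auto
  also have "\<dots> = K1 * (K2 + C) * (g * g powr - \<beta>) * ?I (\<lambda>l. 1 / (1 + (g * l)\<^sup>2))" by (rule integral_mult_right_zero)
  also have "\<dots> \<le> K1 * (K2 + C) * (g * g powr - \<beta>) * (pi / g)"
    using integral_inverse_1_plus_scaled_ival(2)[of g "-pi" pi] g K1_nonneg K2_nonneg C_nonneg
    by (intro mult_left_mono mult_nonneg_nonneg) auto
  also have "\<dots> = K1 * (K2 + C) * pi * g powr - \<beta>" using g by simp
  also have "\<dots> \<le> K1 * (K2 + C) * pi * (1 / (real g)\<^sup>2)"
    using powr_minus_beta_le[OF g1] K1_nonneg K2_nonneg C_nonneg
    by (intro mult_left_mono mult_nonneg_nonneg) auto
  finally have a: "\<bar>?I (\<lambda>l. (cmod (P g l))\<^sup>2) - ?I (\<lambda>l. (cmod (R l))\<^sup>2)\<bar> \<le> K1 * (K2 + C) * pi * (1 / (real g)\<^sup>2)" .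
  have "?I (\<lambda>l. (cmod (R l))\<^sup>2) = integral\<^sup>L (ival (-(g * pi)) (g * pi)) (\<lambda>x. (cmod (FT x))\<^sup>2)"
    unfolding R2 using g by (intro FT_scaled_integral) simp
  then have "\<bar>?I (\<lambda>l. (cmod (R l))\<^sup>2) - 1\<bar> \<le> C\<^sup>2 * pi / (g * pi)\<^sup>2"
    using FT_sq_tail[of "g * pi"] g by (simp add: abs_if)
  also have "\<dots> \<le> C\<^sup>2 * (1 / (real g)\<^sup>2)"
  proof -
    have "C\<^sup>2 * pi / (g * pi)\<^sup>2 = C\<^sup>2 * (1 / (real g)\<^sup>2) * (1 / pi)" by (simp add: power2_eq_square)
    also have "\<dots> \<le> C\<^sup>2 * (1 / (real g)\<^sup>2) * 1" using pi_gt3 by (intro mult_left_mono) auto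
    finally show ?thesis by simp
  qed
  finally show ?thesis using a unfolding K3_def by (simp add: add_divide_distrib)
qed

text \<open>Plancherel's identity by unfolding. The squared transform summed over shifts by 2\<pi>
  is the constant w, so its integral over a period is 2\<pi> w; the same integral is the total
  energy 1.\<close>

lemma W_energy: "2 * pi * integral\<^sup>L (ival (-1) 0) (\<lambda>x. (W x)\<^sup>2) = 1"
proof -
  define w where "w = integral\<^sup>L (ival (-1) 0) (\<lambda>x. (W x)\<^sup>2)"
  let ?f = "\<lambda>x. (cmod (FT x))\<^sup>2"
  define S where "S K l = (\<Sum>p\<in>{- int K..int K}. ?f (l + 2 * pi * of_int p))" for K l
  have has: "((\<lambda>p. ?f (l + 2 * pi * of_int p)) has_sum w) UNIV" for l
    unfolding w_def by (rule FT_Parseval)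
  have fl: "filterlim (\<lambda>K. {- int K..int K}) (finite_subsets_at_top UNIV) sequentially"
    unfolding filterlim_finite_subsets_at_top
  proof (intro allI impI)
    fix X :: "int set" assume X: "finite X \<and> X \<subseteq> UNIV"
    define N where "N = (\<Sum>x\<in>X. nat \<bar>x\<bar>)"
    have "nat \<bar>x\<bar> \<le> N" if "x \<in> X" for x unfolding N_def using X that by (intro member_le_sum) auto
    then show "\<forall>\<^sub>F K in sequentially. finite {- int K..int K} \<and> X \<subseteq> {- int K..int K} \<and> {- int K..int K} \<subseteq> UNIV"
      by (intro eventually_sequentiallyI[of N]) force
  qed
  have Slim: "(\<lambda>K. S K l) \<longlonglongrightarrow> w" for l
    using filterlim_compose[OF has[of l, unfolded has_sum_def] fl] by (simp add: S_def)
  have Sle: "S K l \<le> w" for K l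
    unfolding S_def using has[of l] by (intro finite_sum_le_has_sum) auto
  have S0: "S K l \<ge> 0" for K l unfolding S_def by (intro sum_nonneg) auto
  have Sm: "S K \<in> borel_measurable borel" for K unfolding S_def by measurable
  have lim1: "(\<lambda>K. integral\<^sup>L (ival (-pi) pi) (S K)) \<longlonglongrightarrow> integral\<^sup>L (ival (-pi) pi) (\<lambda>l. w)"
  proof (rule integral_dominated_convergence[where w = "\<lambda>_. w"])
    show "integrable (ival (-pi) pi) (\<lambda>_. w)" by (intro continuous_integrable_ival continuous_intros)
  qed (use Slim Sle S0 Sm in \<open>auto intro: measurable_ival\<close>)
  \<comment> \<open>The shifted periods tile a symmetric interval that gains one period on each side
    when K increases.\<close>
  have Sint: "integral\<^sup>L (ival (-pi) pi) (S K) = integral\<^sup>L (ival (-((2 * real K + 1) * pi)) ((2 * real K + 1) * pi)) ?f" for K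
  proof -
    have shift: "integral\<^sup>L (ival (-pi) pi) (\<lambda>l. ?f (l + c)) = integral\<^sup>L (ival (c - pi) (c + pi)) ?f" for c
    proof -
      have "integral\<^sup>L (ival (c - pi) (c + pi)) ?f = \<bar>1\<bar> *\<^sub>R (LBINT l. indicator {c - pi..c + pi} (c + 1 * l) *\<^sub>R ?f (c + 1 * l))"
        unfolding integral_ival set_lebesgue_integral_def by (rule lborel_integral_real_affine) simp
      also have "\<dots> = (LBINT l. indicator {-pi..pi} l *\<^sub>R ?f (l + c))"
        by (simp, intro Bochner_Integration.integral_cong) (auto simp: indicator_def add.commute)
      finally show ?thesis by (simp add: integral_ival set_lebesgue_integral_def)
    qed
    have inti: "integrable (ival a b) ?f" for a b
      by (rule integral_ival_le_lborel(1)[OF FT_sq_integrable]) simp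
    have comb: "integral\<^sup>L (ival a b) ?f + integral\<^sup>L (ival b c) ?f = integral\<^sup>L (ival a c) ?f" if "a \<le> b" "b \<le> c" for a b c
    proof -
      have "integral\<^sup>L (ival x y) ?f = (LBINT t=x..y. ?f t)" if "x \<le> y" for x y
        using that by (simp add: integral_ival interval_integral_Icc)
      moreover have "(LBINT t=a..b. ?f t) + (LBINT t=b..c. ?f t) = (LBINT t=a..c. ?f t)"
      proof (rule interval_integral_sum)
        have "set_integrable lborel (einterval (min (ereal a) (min (ereal b) (ereal c))) (max (ereal a) (max (ereal b) (ereal c)))) ?f"
          unfolding set_integrable_def by (rule integrable_mult_indicator[OF _ FT_sq_integrable]) simp
        then show "interval_lebesgue_integrable lborel (min (ereal a) (min (ereal b) (ereal c))) (max (ereal a) (max (ereal b) (ereal c))) ?f"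
          unfolding interval_lebesgue_integrable_def by (auto simp: min_def max_def)
      qed
      ultimately show ?thesis using that by simp
    qed
    have "integral\<^sup>L (ival (-pi) pi) (S K) = (\<Sum>p\<in>{- int K..int K}. integral\<^sup>L (ival (-pi) pi) (\<lambda>l. ?f (l + 2 * pi * of_int p)))"
      unfolding S_def
    proof (rule Bochner_Integration.integral_sum)
      fix p
      have "integrable lborel (\<lambda>l. ?f (2 * pi * of_int p + 1 * l))"
        by (rule lborel_integrable_real_affine[OF FT_sq_integrable]) simp
      then show "integrable (ival (-pi) pi) (\<lambda>l. ?f (l + 2 * pi * of_int p))"
        by (intro integral_ival_le_lborel(1)) (auto simp: add.commute)
    qed
    also have "\<dots> = (\<Sum>p\<in>{- int K..int K}. integral\<^sup>L (ival (2 * pi * of_int p - pi) (2 * pi * of_int p + pi)) ?f)"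
      by (simp only: shift)
    also have "\<dots> = integral\<^sup>L (ival (-((2 * real K + 1) * pi)) ((2 * real K + 1) * pi)) ?f"
    proof (induction K)
      case 0 then show ?case by simp
    next
      case (Suc K)
      have "{- int (Suc K)..int (Suc K)} = insert (- int (Suc K)) (insert (int (Suc K)) {- int K..int K})" by auto
      then have "(\<Sum>p\<in>{- int (Suc K)..int (Suc K)}. integral\<^sup>L (ival (2 * pi * of_int p - pi) (2 * pi * of_int p + pi)) ?f)
        = integral\<^sup>L (ival (2 * pi * of_int (- int (Suc K)) - pi) (2 * pi * of_int (- int (Suc K)) + pi)) ?f
          + (integral\<^sup>L (ival (2 * pi * of_int (int (Suc K)) - pi) (2 * pi * of_int (int (Suc K)) + pi)) ?f
          + integral\<^sup>L (ival (-((2 * real K + 1) * pi)) ((2 * real K + 1) * pi)) ?f)"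
        using Suc by simp
      also have "2 * pi * real_of_int (- int (Suc K)) - pi = -((2 * real (Suc K) + 1) * pi)" by (simp add: algebra_simps)
      also have "2 * pi * real_of_int (- int (Suc K)) + pi = -((2 * real K + 1) * pi)" by (simp add: algebra_simps)
      also have "2 * pi * real_of_int (int (Suc K)) - pi = (2 * real K + 1) * pi" by (simp add: algebra_simps)
      also have "2 * pi * real_of_int (int (Suc K)) + pi = (2 * real (Suc K) + 1) * pi" by (simp add: algebra_simps)
      finally show ?case
        using comb[of "-((2 * real (Suc K) + 1) * pi)" "-((2 * real K + 1) * pi)" "(2 * real K + 1) * pi"]
          comb[of "-((2 * real (Suc K) + 1) * pi)" "(2 * real K + 1) * pi" "(2 * real (Suc K) + 1) * pi"] pi_gt_zero
        by (simp add: algebra_simps)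
    qed
    finally show ?thesis .
  qed
  have lim2: "(\<lambda>K. integral\<^sup>L (ival (-((2 * real K + 1) * pi)) ((2 * real K + 1) * pi)) ?f) \<longlonglongrightarrow> 1"
  proof -
    have "(\<lambda>K. 1 / (2 * real K + 1)\<^sup>2) \<longlonglongrightarrow> 0" by real_asymp
    from tendsto_mult_right[OF this, of "C\<^sup>2 / pi"]
    have u: "(\<lambda>K. C\<^sup>2 * pi / ((2 * real K + 1) * pi)\<^sup>2) \<longlonglongrightarrow> 0"
      by (simp add: power_mult_distrib power2_eq_square mult_ac)
    define A where "A K = integral\<^sup>L (ival (-((2 * real K + 1) * pi)) ((2 * real K + 1) * pi)) ?f" for K :: nat
    have A: "0 \<le> 1 - A K" "1 - A K \<le> C\<^sup>2 * pi / ((2 * real K + 1) * pi)\<^sup>2" for K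
      using FT_sq_tail[of "(2 * real K + 1) * pi"] unfolding A_def by auto
    have "(\<lambda>K. 1 - A K) \<longlonglongrightarrow> 0"
      by (rule tendsto_sandwich[OF always_eventually always_eventually tendsto_const u]) (intro allI A)+
    from tendsto_diff[OF tendsto_const[of 1] this] have "A \<longlonglongrightarrow> 1" by simp
    then show ?thesis unfolding A_def[abs_def] .
  qed
  have "integral\<^sup>L (ival (-pi) pi) (\<lambda>l. w) = 1"
    using lim1 lim2 unfolding Sint by (rule LIMSEQ_unique)
  moreover have "integral\<^sup>L (ival (-pi) pi) (\<lambda>l. w) = 2 * pi * w" by simp
  ultimately show ?thesis by (simp only: w_def)
qed

end

section \<open>Second-order structure of the linear process\<close>

text \<open>Each approximant is its limit minus an error; Cauchy-Schwarz controls every product that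
  contains an error.\<close>

lemma square_integrable_tendsto_mult:
  assumes Y: "square_integrable M Y" "\<And>i. square_integrable M (Yi i)" "((\<lambda>i. \<integral>\<omega>. (Y \<omega> - Yi i \<omega>)\<^sup>2 \<partial>M) \<longlongrightarrow> 0) F"
    and Z: "square_integrable M Z" "\<And>i. square_integrable M (Zi i)" "((\<lambda>i. \<integral>\<omega>. (Z \<omega> - Zi i \<omega>)\<^sup>2 \<partial>M) \<longlongrightarrow> 0) F"
  shows "((\<lambda>i. \<integral>\<omega>. Yi i \<omega> * Zi i \<omega> \<partial>M) \<longlongrightarrow> (\<integral>\<omega>. Y \<omega> * Z \<omega> \<partial>M)) F"
proof (rule Lim_null[THEN iffD2], rule tendsto_rabs_zero_cancel, rule tendsto_sandwich[OF _ _ tendsto_const])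
  let ?E = "\<lambda>X. sqrt (\<integral>\<omega>. (X \<omega>)\<^sup>2 \<partial>M)"
  let ?y = "\<lambda>i \<omega>. Y \<omega> - Yi i \<omega>" and ?z = "\<lambda>i \<omega>. Z \<omega> - Zi i \<omega>"
  have sy: "square_integrable M (?y i)" and sz: "square_integrable M (?z i)" for i using Y Z by (auto intro: square_integrable_diff)
  have y0: "((\<lambda>i. ?E (?y i)) \<longlongrightarrow> 0) F" and z0: "((\<lambda>i. ?E (?z i)) \<longlongrightarrow> 0) F"
    using tendsto_real_sqrt[OF Y(3)] tendsto_real_sqrt[OF Z(3)] by simp_all
  have CS: "\<bar>\<integral>\<omega>. A \<omega> * B \<omega> \<partial>M\<bar> \<le> ?E A * ?E B" if "square_integrable M A" "square_integrable M B" for A B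
    using square_integrable_Cauchy_Schwarz[OF that] integral_abs_bound[of M "\<lambda>\<omega>. A \<omega> * B \<omega>"] by linarith
  show "\<forall>\<^sub>F i in F. \<bar>(\<integral>\<omega>. Yi i \<omega> * Zi i \<omega> \<partial>M) - (\<integral>\<omega>. Y \<omega> * Z \<omega> \<partial>M)\<bar> \<le> ?E (?y i) * ?E Z + ?E Y * ?E (?z i) + ?E (?y i) * ?E (?z i)"
  proof (rule always_eventually, rule allI)
    fix i
    note ints = square_integrable_mult_integrable[OF sy[of i] Z(1)] square_integrable_mult_integrable[OF Y(1) sz[of i]] square_integrable_mult_integrable[OF sy[of i] sz[of i]]
      square_integrable_mult_integrable[OF Y(1) Z(1)]
    have "(\<integral>\<omega>. Yi i \<omega> * Zi i \<omega> \<partial>M) = (\<integral>\<omega>. Y \<omega> * Z \<omega> - ?y i \<omega> * Z \<omega> - Y \<omega> * ?z i \<omega> + ?y i \<omega> * ?z i \<omega> \<partial>M)"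
      by (intro Bochner_Integration.integral_cong refl) (simp add: algebra_simps)
    also have "\<dots> = (\<integral>\<omega>. Y \<omega> * Z \<omega> \<partial>M) - (\<integral>\<omega>. ?y i \<omega> * Z \<omega> \<partial>M) - (\<integral>\<omega>. Y \<omega> * ?z i \<omega> \<partial>M) + (\<integral>\<omega>. ?y i \<omega> * ?z i \<omega> \<partial>M)"
      using ints by (simp only: Bochner_Integration.integral_add Bochner_Integration.integral_diff Bochner_Integration.integrable_diff)
    finally show "\<bar>(\<integral>\<omega>. Yi i \<omega> * Zi i \<omega> \<partial>M) - (\<integral>\<omega>. Y \<omega> * Z \<omega> \<partial>M)\<bar> \<le> ?E (?y i) * ?E Z + ?E Y * ?E (?z i) + ?E (?y i) * ?E (?z i)"
      using CS[OF sy[of i] Z(1)] CS[OF Y(1) sz[of i]] CS[OF sy[of i] sz[of i]] by linarith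
  qed
  have "((\<lambda>i. ?E (?y i) * ?E Z + ?E Y * ?E (?z i) + ?E (?y i) * ?E (?z i)) \<longlongrightarrow> 0 * ?E Z + ?E Y * 0 + 0 * 0) F"
    by (intro tendsto_intros y0 z0)
  then show "((\<lambda>i. ?E (?y i) * ?E Z + ?E Y * ?E (?z i) + ?E (?y i) * ?E (?z i)) \<longlongrightarrow> 0) F" by simp
qed auto

text \<open>Mean-square convergence along finite index sets. The coefficient sequence is an explicit
  argument, so that covariances become inner products of coefficients.\<close>

definition l2_series :: "'a measure \<Rightarrow> (int \<Rightarrow> 'a \<Rightarrow> real) \<Rightarrow> (int \<Rightarrow> real) \<Rightarrow> ('a \<Rightarrow> real) \<Rightarrow> bool" where
  "l2_series M \<xi> v Z \<longleftrightarrow> square_integrable M Z \<and>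
     ((\<lambda>F. \<integral>\<omega>. (Z \<omega> - lin v F (\<lambda>t. \<xi> t \<omega>))\<^sup>2 \<partial>M) \<longlongrightarrow> 0) (finite_subsets_at_top UNIV)"

locale linear_series = prob_space M for M :: "'a measure" +
  fixes \<xi> X :: "int \<Rightarrow> 'a \<Rightarrow> real" and a :: "int \<Rightarrow> real" and a_star :: "real \<Rightarrow> complex"
  assumes wn: "weak_white_noise M \<xi>"
    and lp: "linear_process M a \<xi> X"
    and fs: "is_fourier_series a a_star"
begin

lemma square_integrable_noise: "square_integrable M (\<xi> t)" using wn by (auto simp: weak_white_noise_def square_integrable_def)

lemma noise_cov: "expectation (\<lambda>\<omega>. \<xi> s \<omega> * \<xi> t \<omega>) = (if s = t then 1 else 0)"
  using wn by (auto simp: weak_white_noise_def power2_eq_square)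

lemma square_integrable_lin_noise: "square_integrable M (\<lambda>\<omega>. lin v F (\<lambda>t. \<xi> t \<omega>))"
  unfolding lin_def by (intro square_integrable_sum square_integrable_cmult square_integrable_noise)

lemma lin_noise_cov:
  assumes "finite F"
  shows "expectation (\<lambda>\<omega>. lin v F (\<lambda>t. \<xi> t \<omega>) * lin w F (\<lambda>t. \<xi> t \<omega>)) = (\<Sum>t\<in>F. v t * w t)"
proof -
  have "expectation (\<lambda>\<omega>. lin v F (\<lambda>t. \<xi> t \<omega>) * lin w F (\<lambda>t. \<xi> t \<omega>)) = expectation (\<lambda>\<omega>. \<Sum>s\<in>F. \<Sum>t\<in>F. v s * w t * (\<xi> s \<omega> * \<xi> t \<omega>))"
    unfolding lin_def sum_product by (simp add: mult_ac)
  also have "\<dots> = (\<Sum>s\<in>F. \<Sum>t\<in>F. v s * w t * (if s = t then 1 else 0))"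
    using square_integrable_mult_integrable[OF square_integrable_noise square_integrable_noise] by (simp add: Bochner_Integration.integral_sum noise_cov)
  also have "\<dots> = (\<Sum>t\<in>F. v t * w t)" using assms by (simp add: if_distrib[of "(*) _"] cong: if_cong)
  finally show ?thesis .
qed

lemma l2_series_add:
  assumes "l2_series M \<xi> v Y" "l2_series M \<xi> w Z"
  shows "l2_series M \<xi> (\<lambda>t. v t + w t) (\<lambda>\<omega>. Y \<omega> + Z \<omega>)"
  unfolding l2_series_def
proof (intro conjI)
  show "square_integrable M (\<lambda>\<omega>. Y \<omega> + Z \<omega>)" using assms by (auto simp: l2_series_def intro: square_integrable_add)
  let ?y = "\<lambda>F \<omega>. Y \<omega> - lin v F (\<lambda>t. \<xi> t \<omega>)" and ?z = "\<lambda>F \<omega>. Z \<omega> - lin w F (\<lambda>t. \<xi> t \<omega>)"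
  have s: "square_integrable M (?y F)" "square_integrable M (?z F)" for F using assms by (auto simp: l2_series_def intro!: square_integrable_diff square_integrable_lin_noise)
  show "((\<lambda>F. \<integral>\<omega>. (Y \<omega> + Z \<omega> - lin (\<lambda>t. v t + w t) F (\<lambda>t. \<xi> t \<omega>))\<^sup>2 \<partial>M) \<longlongrightarrow> 0) (finite_subsets_at_top UNIV)"
  proof (rule tendsto_sandwich[OF _ _ tendsto_const])
    show "\<forall>\<^sub>F F in finite_subsets_at_top UNIV. (\<integral>\<omega>. (Y \<omega> + Z \<omega> - lin (\<lambda>t. v t + w t) F (\<lambda>t. \<xi> t \<omega>))\<^sup>2 \<partial>M)
       \<le> 2 * (\<integral>\<omega>. (?y F \<omega>)\<^sup>2 \<partial>M) + 2 * (\<integral>\<omega>. (?z F \<omega>)\<^sup>2 \<partial>M)"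
    proof (rule always_eventually, rule allI)
      fix F
      have e: "Y \<omega> + Z \<omega> - lin (\<lambda>t. v t + w t) F (\<lambda>t. \<xi> t \<omega>) = ?y F \<omega> + ?z F \<omega>" for \<omega>
        by (simp add: lin_def distrib_right sum.distrib)
      have "(\<integral>\<omega>. (?y F \<omega> + ?z F \<omega>)\<^sup>2 \<partial>M) \<le> (\<integral>\<omega>. 2 * (?y F \<omega>)\<^sup>2 + 2 * (?z F \<omega>)\<^sup>2 \<partial>M)"
      proof (rule integral_mono)
        show "integrable M (\<lambda>\<omega>. (?y F \<omega> + ?z F \<omega>)\<^sup>2)" by (rule square_integrable_power2[OF square_integrable_add[OF s]])
        show "integrable M (\<lambda>\<omega>. 2 * (?y F \<omega>)\<^sup>2 + 2 * (?z F \<omega>)\<^sup>2)" using square_integrable_power2[OF s(1)] square_integrable_power2[OF s(2)] by simp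
        have "(x + y)\<^sup>2 \<le> 2 * x\<^sup>2 + 2 * y\<^sup>2" for x y :: real using sum_squares_bound[of x y] by (simp add: power2_sum)
        then show "(?y F \<omega> + ?z F \<omega>)\<^sup>2 \<le> 2 * (?y F \<omega>)\<^sup>2 + 2 * (?z F \<omega>)\<^sup>2" for \<omega> .
      qed
      also have "\<dots> = 2 * (\<integral>\<omega>. (?y F \<omega>)\<^sup>2 \<partial>M) + 2 * (\<integral>\<omega>. (?z F \<omega>)\<^sup>2 \<partial>M)"
        using square_integrable_power2[OF s(1)] square_integrable_power2[OF s(2)] by simp
      finally show "(\<integral>\<omega>. (Y \<omega> + Z \<omega> - lin (\<lambda>t. v t + w t) F (\<lambda>t. \<xi> t \<omega>))\<^sup>2 \<partial>M)
         \<le> 2 * (\<integral>\<omega>. (?y F \<omega>)\<^sup>2 \<partial>M) + 2 * (\<integral>\<omega>. (?z F \<omega>)\<^sup>2 \<partial>M)" unfolding e .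
    qed
    show "((\<lambda>F. 2 * (\<integral>\<omega>. (?y F \<omega>)\<^sup>2 \<partial>M) + 2 * (\<integral>\<omega>. (?z F \<omega>)\<^sup>2 \<partial>M)) \<longlongrightarrow> 0) (finite_subsets_at_top UNIV)"
      using assms unfolding l2_series_def by (auto intro!: tendsto_eq_intros)
  qed auto
qed

lemma l2_series_cmult:
  assumes "l2_series M \<xi> v Z"
  shows "l2_series M \<xi> (\<lambda>t. c * v t) (\<lambda>\<omega>. c * Z \<omega>)"
proof -
  have "(c * Z \<omega> - lin (\<lambda>t. c * v t) F (\<lambda>t. \<xi> t \<omega>))\<^sup>2 = c\<^sup>2 * (Z \<omega> - lin v F (\<lambda>t. \<xi> t \<omega>))\<^sup>2" for F \<omega>
    unfolding power_mult_distrib[symmetric] by (simp add: lin_def sum_distrib_left right_diff_distrib mult_ac)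
  then show ?thesis
    using assms unfolding l2_series_def by (auto intro!: square_integrable_cmult tendsto_eq_intros)
qed

lemma l2_series_sum:
  assumes "finite J" "\<And>j. j \<in> J \<Longrightarrow> l2_series M \<xi> (v j) (Z j)"
  shows "l2_series M \<xi> (\<lambda>t. \<Sum>j\<in>J. v j t) (\<lambda>\<omega>. \<Sum>j\<in>J. Z j \<omega>)"
  using assms
proof (induction J)
  case empty
  then show ?case by (simp add: l2_series_def square_integrable_zero lin_def)
next
  case (insert j J)
  then show ?case by (auto intro!: l2_series_add)
qed

lemma l2_series_X: "l2_series M \<xi> (\<lambda>t. a (u - t)) (X u)"
  using lp by (auto simp: l2_series_def linear_process_def square_integrable_def lin_def)

lemma l2_series_cov:
  assumes "l2_series M \<xi> v Y" "l2_series M \<xi> w Z"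
  shows "((\<lambda>t. v t * w t) has_sum expectation (\<lambda>\<omega>. Y \<omega> * Z \<omega>)) UNIV"
proof -
  have "((\<lambda>F. expectation (\<lambda>\<omega>. lin v F (\<lambda>t. \<xi> t \<omega>) * lin w F (\<lambda>t. \<xi> t \<omega>))) \<longlongrightarrow> expectation (\<lambda>\<omega>. Y \<omega> * Z \<omega>)) (finite_subsets_at_top UNIV)"
    using assms unfolding l2_series_def by (intro square_integrable_tendsto_mult square_integrable_lin_noise) auto
  then have "((\<lambda>F. \<Sum>t\<in>F. v t * w t) \<longlongrightarrow> expectation (\<lambda>\<omega>. Y \<omega> * Z \<omega>)) (finite_subsets_at_top UNIV)"
    by (rule Lim_transform_eventually) (intro eventually_finite_subsets_at_top_weakI lin_noise_cov)
  then show ?thesis by (simp add: has_sum_def)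
qed

definition spec :: "real \<Rightarrow> real" where "spec l = (cmod (a_star l))\<^sup>2"

lemma a_star_measurable [measurable]: "a_star \<in> borel_measurable borel"
  using fs by (simp add: is_fourier_series_def)

lemma spec_measurable [measurable]: "spec \<in> borel_measurable borel"
  unfolding spec_def[abs_def] by measurable

lemma spec_nonneg: "spec l \<ge> 0" by (simp add: spec_def)

lemma spec_integrable: "integrable (ival (-pi) pi) spec"
  using fs by (simp add: is_fourier_series_def integrable_ival spec_def[abs_def])

lemma cmod_integral_mult_le:
  fixes p q :: "real \<Rightarrow> complex"
  assumes [measurable]: "p \<in> borel_measurable N" "q \<in> borel_measurable N"
    and "integrable N (\<lambda>l. (cmod (p l))\<^sup>2)" "integrable N (\<lambda>l. (cmod (q l))\<^sup>2)"
  shows "integrable N (\<lambda>l. p l * q l)"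
    "cmod (CLINT l|N. p l * q l) \<le> sqrt (\<integral>l. (cmod (p l))\<^sup>2 \<partial>N) * sqrt (\<integral>l. (cmod (q l))\<^sup>2 \<partial>N)"
proof -
  have s: "square_integrable N (\<lambda>l. cmod (p l))" "square_integrable N (\<lambda>l. cmod (q l))" using assms by (auto simp: square_integrable_def)
  show "integrable N (\<lambda>l. p l * q l)"
    by (rule Bochner_Integration.integrable_bound[OF square_integrable_mult_integrable[OF s]]) (auto simp: norm_mult)
  have "cmod (CLINT l|N. p l * q l) \<le> (\<integral>l. cmod (p l * q l) \<partial>N)" by (rule integral_norm_bound)
  also have "\<dots> = (\<integral>l. \<bar>cmod (p l) * cmod (q l)\<bar> \<partial>N)" by (simp add: norm_mult)
  also have "\<dots> \<le> sqrt (\<integral>l. (cmod (p l))\<^sup>2 \<partial>N) * sqrt (\<integral>l. (cmod (q l))\<^sup>2 \<partial>N)" by (rule square_integrable_Cauchy_Schwarz[OF s])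
  finally show "cmod (CLINT l|N. p l * q l) \<le> sqrt (\<integral>l. (cmod (p l))\<^sup>2 \<partial>N) * sqrt (\<integral>l. (cmod (q l))\<^sup>2 \<partial>N)" .
qed

abbreviation "CI \<equiv> integral\<^sup>L (ival (-pi) pi)"

definition aF :: "int set \<Rightarrow> real \<Rightarrow> complex" where
  "aF F l = (\<Sum>t\<in>F. of_real (a t / sqrt (2 * pi)) * cis (- (of_int t * l)))"

lemma continuous_aF: "continuous_on A (aF F)"
  unfolding aF_def[abs_def] by (intro continuous_intros)

lemma aF_tendsto: "((\<lambda>F. CI (\<lambda>l. (cmod (a_star l - aF F l))\<^sup>2)) \<longlongrightarrow> 0) (finite_subsets_at_top UNIV)"
proof -
  have "aF F l = (\<Sum>t\<in>F. complex_of_real (a t) * exp (- (\<i> * of_real l * of_int t))) / complex_of_real (sqrt (2 * pi))" for F l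
    by (simp add: aF_def sum_divide_distrib cis_conv_exp mult_ac)
  then show ?thesis using fs by (simp add: is_fourier_series_def integral_ival)
qed

lemma aF_diff_integrable: "integrable (ival (-pi) pi) (\<lambda>l. (cmod (a_star l - aF F l))\<^sup>2)"
proof -
  have [measurable]: "aF F \<in> borel_measurable borel" by (rule borel_measurable_continuous_onI[OF continuous_aF])
  have i: "integrable (ival (-pi) pi) (\<lambda>l. 2 * spec l + 2 * (cmod (aF F l))\<^sup>2)"
    by (intro Bochner_Integration.integrable_add integrable_mult_right spec_integrable continuous_integrable_ival continuous_intros continuous_aF)
  show ?thesis
  proof (rule Bochner_Integration.integrable_bound[OF i])
    show "(\<lambda>l. (cmod (a_star l - aF F l))\<^sup>2) \<in> borel_measurable (ival (-pi) pi)" by (rule measurable_ival) measurable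
    have "(cmod (x - y))\<^sup>2 \<le> 2 * (cmod x)\<^sup>2 + 2 * (cmod y)\<^sup>2" for x y
    proof -
      have "(cmod (x - y))\<^sup>2 \<le> (cmod x + cmod y)\<^sup>2" by (intro power_mono norm_triangle_ineq4) auto
      also have "\<dots> \<le> 2 * (cmod x)\<^sup>2 + 2 * (cmod y)\<^sup>2" using sum_squares_bound[of "cmod x" "cmod y"] by (simp add: power2_sum)
      finally show ?thesis .
    qed
    then show "AE l in ival (-pi) pi. norm ((cmod (a_star l - aF F l))\<^sup>2) \<le> norm (2 * spec l + 2 * (cmod (aF F l))\<^sup>2)"
      by (auto simp: spec_def)
  qed
qed

text \<open>Mean-square convergence of the partial sums gives convergence against every
  square-integrable p. This one limit yields both the Fourier coefficients and the
  autocovariances.\<close>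

lemma tendsto_CI_aF:
  assumes [measurable]: "p \<in> borel_measurable borel" and p: "integrable (ival (-pi) pi) (\<lambda>l. (cmod (p l))\<^sup>2)"
  shows "((\<lambda>F. CI (\<lambda>l. p l * aF F l)) \<longlongrightarrow> CI (\<lambda>l. p l * a_star l)) (finite_subsets_at_top UNIV)"
proof (rule Lim_null[THEN iffD2], rule Lim_null_comparison)
  have [measurable]: "aF F \<in> borel_measurable borel" for F by (rule borel_measurable_continuous_onI[OF continuous_aF])
  let ?N = "ival (-pi) pi"
  have iA: "integrable ?N (\<lambda>l. (cmod (a_star l))\<^sup>2)" using spec_integrable by (simp add: spec_def[abs_def])
  have iF: "integrable ?N (\<lambda>l. (cmod (aF F l))\<^sup>2)" for F by (intro continuous_integrable_ival continuous_intros continuous_aF)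
  have m: "p \<in> borel_measurable ?N" "a_star \<in> borel_measurable ?N" "aF F \<in> borel_measurable ?N" "(\<lambda>l. a_star l - aF F l) \<in> borel_measurable ?N" for F
    by (rule measurable_ival, measurable)+
  show "\<forall>\<^sub>F F in finite_subsets_at_top UNIV. cmod (CI (\<lambda>l. p l * aF F l) - CI (\<lambda>l. p l * a_star l))
     \<le> sqrt (CI (\<lambda>l. (cmod (p l))\<^sup>2)) * sqrt (CI (\<lambda>l. (cmod (a_star l - aF F l))\<^sup>2))"
  proof (rule always_eventually, rule allI)
    fix F
    have "CI (\<lambda>l. p l * a_star l) - CI (\<lambda>l. p l * aF F l) = CI (\<lambda>l. p l * a_star l - p l * aF F l)"
      using cmod_integral_mult_le(1)[OF m(1) m(2) p iA] cmod_integral_mult_le(1)[OF m(1) m(3) p iF] by simp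
    also have "\<dots> = CI (\<lambda>l. p l * (a_star l - aF F l))" by (simp only: right_diff_distrib)
    finally show "cmod (CI (\<lambda>l. p l * aF F l) - CI (\<lambda>l. p l * a_star l))
     \<le> sqrt (CI (\<lambda>l. (cmod (p l))\<^sup>2)) * sqrt (CI (\<lambda>l. (cmod (a_star l - aF F l))\<^sup>2))"
      using cmod_integral_mult_le(2)[OF m(1) m(4) p aF_diff_integrable[of F]] by (simp add: norm_minus_commute)
  qed
  show "((\<lambda>F. sqrt (CI (\<lambda>l. (cmod (p l))\<^sup>2)) * sqrt (CI (\<lambda>l. (cmod (a_star l - aF F l))\<^sup>2))) \<longlongrightarrow> 0) (finite_subsets_at_top UNIV)"
    using tendsto_mult[OF tendsto_const tendsto_real_sqrt[OF aF_tendsto]] by simp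
qed

lemma a_star_coeff: "CI (\<lambda>l. cis (of_int m * l) * a_star l) = of_real (sqrt (2 * pi) * a m)"
proof -
  have "((\<lambda>F. CI (\<lambda>l. cis (of_int m * l) * aF F l)) \<longlongrightarrow> CI (\<lambda>l. cis (of_int m * l) * a_star l)) (finite_subsets_at_top UNIV)"
    by (rule tendsto_CI_aF) (auto intro!: continuous_integrable_ival)
  moreover have "\<forall>\<^sub>F F in finite_subsets_at_top UNIV. CI (\<lambda>l. cis (of_int m * l) * aF F l) = of_real (sqrt (2 * pi) * a m)"
  proof -
    have "\<forall>\<^sub>F F in finite_subsets_at_top UNIV. finite F \<and> m \<in> F"
      unfolding eventually_finite_subsets_at_top by (intro exI[of _ "{m}"]) auto
    then show ?thesis
    proof eventually_elim
      case (elim F)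
      have "CI (\<lambda>l. cis (of_int m * l) * aF F l) = CI (\<lambda>l. \<Sum>t\<in>F. of_real (a t / sqrt (2 * pi)) * cis (of_int (m - t) * l))"
        unfolding aF_def sum_distrib_left
        by (intro Bochner_Integration.integral_cong refl sum.cong) (simp add: mult.left_commute cis_mult left_diff_distrib)
      also have "\<dots> = (\<Sum>t\<in>F. of_real (a t / sqrt (2 * pi)) * CI (\<lambda>l. cis (of_int (m - t) * l)))"
        by (subst Bochner_Integration.integral_sum) (auto intro!: continuous_integrable_ival continuous_intros simp del: of_int_diff)
      also have "\<dots> = (\<Sum>t\<in>F. if t = m then of_real (a t / sqrt (2 * pi)) * of_real (2 * pi) else 0)"
        unfolding integral_cis_period by (intro sum.cong) auto
      also have "\<dots> = of_real (a m / sqrt (2 * pi)) * of_real (2 * pi)" using elim by simp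
      also have "\<dots> = of_real (sqrt (2 * pi) * a m)"
        by (simp only: of_real_mult[symmetric] of_real_eq_iff) (simp add: field_simps)
      finally show ?case .
    qed
  qed
  ultimately have "((\<lambda>F. complex_of_real (sqrt (2 * pi) * a m)) \<longlongrightarrow> CI (\<lambda>l. cis (of_int m * l) * a_star l)) (finite_subsets_at_top (UNIV :: int set))"
    by (rule Lim_transform_eventually)
  then show ?thesis by (metis finite_subsets_at_top_neq_bot tendsto_unique[OF _ tendsto_const])
qed

text \<open>Parseval's identity without double sums: the partial sums are tested against the
  modulated conjugate of \<open>a_star\<close> itself, so that each term is a conjugated Fourier
  coefficient. The terms are real, which permits the conjugation at the end.\<close>

lemma spec_autocov:
  fixes h :: int
  shows "((\<lambda>t. complex_of_real (a t * a (t + h))) has_sum CI (\<lambda>l. of_real (spec l) * cis (of_int h * l))) UNIV"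
proof -
  have [measurable]: "(\<lambda>l. cnj (a_star l)) \<in> borel_measurable borel"
    by (rule measurable_compose[OF a_star_measurable]) (intro borel_measurable_continuous_onI continuous_intros)
  have "((\<lambda>F. CI (\<lambda>l. (cnj (a_star l) * cis (- (of_int h * l))) * aF F l)) \<longlongrightarrow> CI (\<lambda>l. (cnj (a_star l) * cis (- (of_int h * l))) * a_star l)) (finite_subsets_at_top UNIV)"
    by (rule tendsto_CI_aF) (use spec_integrable in \<open>auto simp: norm_mult spec_def[abs_def]\<close>)
  moreover have "CI (\<lambda>l. (cnj (a_star l) * cis (- (of_int h * l))) * a_star l) = cnj (CI (\<lambda>l. of_real (spec l) * cis (of_int h * l)))"
    unfolding Bochner_Integration.integral_cnj[symmetric]
  proof (intro Bochner_Integration.integral_cong refl)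
    fix l
    have "complex_of_real (spec l) = a_star l * cnj (a_star l)" unfolding spec_def by (rule complex_norm_square)
    then show "cnj (a_star l) * cis (- (of_int h * l)) * a_star l = cnj (of_real (spec l) * cis (of_int h * l))"
      by (simp add: cis_cnj mult_ac)
  qed
  moreover have "CI (\<lambda>l. (cnj (a_star l) * cis (- (of_int h * l))) * aF F l) = (\<Sum>t\<in>F. complex_of_real (a t * a (t + h)))" for F
  proof -
    have i: "integrable (ival (-pi) pi) (\<lambda>l. cis (of_int m * l) * a_star l)" for m
      by (rule cmod_integral_mult_le(1)) (use spec_integrable in \<open>auto intro!: measurable_ival continuous_integrable_ival simp: spec_def[abs_def]\<close>)
    have "CI (\<lambda>l. (cnj (a_star l) * cis (- (of_int h * l))) * aF F l) = CI (\<lambda>l. \<Sum>t\<in>F. of_real (a t / sqrt (2 * pi)) * cnj (cis (of_int (t + h) * l) * a_star l))"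
      unfolding aF_def sum_distrib_left
      by (intro Bochner_Integration.integral_cong refl sum.cong) (simp add: cis_cnj mult_ac cis_mult distrib_right distrib_left)
    also have "\<dots> = (\<Sum>t\<in>F. of_real (a t / sqrt (2 * pi)) * cnj (CI (\<lambda>l. cis (of_int (t + h) * l) * a_star l)))"
      using i by (subst Bochner_Integration.integral_sum) (auto simp del: of_int_add complex_cnj_mult intro!: integrable_mult_right integrable_cnj)
    also have "\<dots> = (\<Sum>t\<in>F. complex_of_real (a t * a (t + h)))"
      unfolding a_star_coeff by (intro sum.cong refl) simp
    finally show ?thesis .
  qed
  ultimately have "((\<lambda>F. \<Sum>t\<in>F. complex_of_real (a t * a (t + h))) \<longlongrightarrow> cnj (CI (\<lambda>l. of_real (spec l) * cis (of_int h * l)))) (finite_subsets_at_top UNIV)"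
    by simp
  from tendsto_cnj[OF this] show ?thesis by (simp add: has_sum_def)
qed

lemma X_cov: "complex_of_real (expectation (\<lambda>\<omega>. X u \<omega> * X w \<omega>)) = CI (\<lambda>l. of_real (spec l) * cis (of_int (u - w) * l))"
proof -
  have "((\<lambda>t. a (u - t) * a (w - t)) has_sum expectation (\<lambda>\<omega>. X u \<omega> * X w \<omega>)) UNIV"
    by (rule l2_series_cov[OF l2_series_X l2_series_X])
  then have "((\<lambda>t. complex_of_real (a (u - t) * a (w - t))) has_sum of_real (expectation (\<lambda>\<omega>. X u \<omega> * X w \<omega>))) UNIV"
    by (rule has_sum_of_real)
  moreover have "((\<lambda>t. complex_of_real (a (u - t) * a (w - t))) has_sum CI (\<lambda>l. of_real (spec l) * cis (of_int (u - w) * l))) UNIV"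
  proof -
    \<comment> \<open>The reflection t -> w - t turns \<open>a (u - t) * a (w - t)\<close> into the
      product at lag u - w.\<close>
    have "bij (\<lambda>t. w - t)" by (rule bij_betw_byWitness[of _ "\<lambda>t. w - t"]) auto
    from has_sum_reindex_bij_betw[OF this, THEN iffD2, OF spec_autocov[of "u - w"]]
    show ?thesis by (simp add: mult.commute)
  qed
  ultimately show ?thesis by (rule has_sum_unique)
qed

end

text \<open>Comparing a value at the start of a block with the block average costs the variation inside the block.\<close>

lemma block_start_sum_le:
  fixes u :: "int \<Rightarrow> real"
  assumes g: "g > 0" and E: "\<And>H. finite H \<Longrightarrow> (\<Sum>m\<in>H. (u m)\<^sup>2) \<le> E"
    and D: "\<And>H. finite H \<Longrightarrow> (\<Sum>m\<in>H. (u (m + 1) - u m)\<^sup>2) \<le> D"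
  shows "(\<Sum>k<N. (u (int (k * g) + c))\<^sup>2) \<le> E / g + 2 * sqrt (D * E)"
proof -
  define y where "y i = (u (int i + c))\<^sup>2" for i
  define V where "V k = (\<Sum>i<g. \<bar>y (Suc (k * g + i)) - y (k * g + i)\<bar>)" for k
  have step: "y (k * g) \<le> y (k * g + i) + V k" if "i < g" for i k
  proof -
    have "y (k * g) - y (k * g + i) \<le> (\<Sum>j<i. \<bar>y (Suc (k * g + j)) - y (k * g + j)\<bar>)" for i
      by (induction i) auto
    also have "(\<Sum>j<i. \<bar>y (Suc (k * g + j)) - y (k * g + j)\<bar>) \<le> V k"
      unfolding V_def using that by (intro sum_mono2) auto
    finally show ?thesis by simp
  qed
  have "real g * y (k * g) \<le> (\<Sum>i<g. y (k * g + i)) + real g * V k" for k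
    using sum_mono[of "{..<g}" "\<lambda>_. y (k * g)" "\<lambda>i. y (k * g + i) + V k"] step by (simp add: sum.distrib)
  note blk0 = this
  have blk: "y (k * g) \<le> (\<Sum>i<g. y (k * g + i)) / g + V k" for k
  proof -
    have "r \<le> s / g + v" if "real g * r \<le> s + real g * v" for r s v
      using g that by (simp add: field_simps)
    from this[OF blk0] show ?thesis .
  qed
  have group: "(\<Sum>k<N. \<Sum>i<g. z (k * g + i)) = sum z {..<N * g}" for z :: "nat \<Rightarrow> real"
    using sum.nat_group[of z g N] by (simp add: sum.atLeastLessThan_shift_0 atLeast0LessThan add.commute)
  have inj: "inj_on (\<lambda>i. int i + c) A" for A by (auto simp: inj_on_def)
  have inj2: "inj_on (\<lambda>i. c + int i) A" for A by (auto simp: inj_on_def)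
  have sE: "(\<Sum>i<n. y i) \<le> E" for n
    using E[of "(\<lambda>i. int i + c) ` {..<n}"] by (simp add: sum.reindex inj y_def)
  have sE1: "(\<Sum>i<n. y (Suc i)) \<le> E" for n
    using E[of "(\<lambda>i. int i + c) ` {1..n}"] by (simp add: sum.reindex inj y_def sum.atLeast1_atMost_eq)
  have sD: "(\<Sum>i<n. (u (int (Suc i) + c) - u (int i + c))\<^sup>2) \<le> D" for n
    using D[of "(\<lambda>i. int i + c) ` {..<n}"] by (simp add: sum.reindex inj inj2 add_ac)
  have E0: "E \<ge> 0" and D0: "D \<ge> 0" using E[of "{}"] D[of "{}"] by auto
  have V: "(\<Sum>k<N. V k) \<le> 2 * sqrt (D * E)"
  proof -
    define n where "n = N * g"
    \<comment> \<open>A difference of squares is an increment times a sum. The increments have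
      square sum at most D and the sums at most 4 E, so Cauchy-Schwarz gives the factor 2.\<close>
    define p where "p i = u (int (Suc i) + c) - u (int i + c)" for i
    define q where "q i = u (int (Suc i) + c) + u (int i + c)" for i
    have "(\<Sum>k<N. V k) = (\<Sum>i<n. \<bar>y (Suc i) - y i\<bar>)" unfolding V_def n_def by (rule group)
    also have "\<dots> = (\<Sum>i<n. \<bar>p i\<bar> * \<bar>q i\<bar>)"
      by (intro sum.cong refl) (simp add: y_def p_def q_def abs_mult[symmetric] power2_eq_square algebra_simps)
    also have "\<dots> \<le> L2_set p {..<n} * L2_set q {..<n}" by (rule L2_set_mult_ineq)
    also have "\<dots> \<le> sqrt D * (2 * sqrt E)"
    proof (intro mult_mono)
      show "L2_set p {..<n} \<le> sqrt D" unfolding L2_set_def p_def by (intro real_sqrt_le_mono sD)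
      have "(\<Sum>i<n. (q i)\<^sup>2) \<le> (\<Sum>i<n. 2 * y (Suc i) + 2 * y i)"
      proof (intro sum_mono)
        fix i
        have "(x + z)\<^sup>2 \<le> 2 * x\<^sup>2 + 2 * z\<^sup>2" for x z :: real using sum_squares_bound[of x z] by (simp add: power2_sum)
        then show "(q i)\<^sup>2 \<le> 2 * y (Suc i) + 2 * y i" unfolding q_def y_def .
      qed
      also have "\<dots> \<le> 4 * E" using sE[of n] sE1[of n] by (simp add: sum.distrib sum_distrib_left[symmetric])
      finally have "L2_set q {..<n} \<le> sqrt (4 * E)" unfolding L2_set_def by (rule real_sqrt_le_mono)
      then show "L2_set q {..<n} \<le> 2 * sqrt E" by (simp add: real_sqrt_mult)
    qed (use D0 in auto)
    finally show ?thesis by (simp add: real_sqrt_mult)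
  qed
  have "(\<Sum>k<N. y (k * g)) \<le> (\<Sum>k<N. (\<Sum>i<g. y (k * g + i)) / g + V k)" by (intro sum_mono blk)
  also have "\<dots> = sum y {..<N * g} / g + (\<Sum>k<N. V k)"
    by (simp add: sum.distrib sum_divide_distrib[symmetric] group)
  also have "\<dots> \<le> E / g + 2 * sqrt (D * E)" using sE V by (intro add_mono divide_right_mono) auto
  finally show ?thesis by (simp add: y_def)
qed

text \<open>A is the orthogonal projection of \<phi> onto the exponentials with frequencies in H,
  and the integral of the squared distance is nonnegative. The coefficients carry no factor 1 /
  (2\<pi>), hence the 2\<pi> in the bound.\<close>

lemma Bessel_cis:
  fixes \<phi> :: "real \<Rightarrow> real" and H :: "int set"
  assumes m: "\<phi> \<in> borel_measurable borel" and B: "\<And>l. l \<in> {-pi..pi} \<Longrightarrow> \<bar>\<phi> l\<bar> \<le> B" and H: "finite H"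
  shows "(\<Sum>h\<in>H. (cmod (integral\<^sup>L (ival (-pi) pi) (\<lambda>l. of_real (\<phi> l) * cis (of_int h * l))))\<^sup>2) \<le> (2 * pi * B)\<^sup>2"
proof -
  let ?I = "integral\<^sup>L (ival (-pi) pi)"
  define c where "c h = ?I (\<lambda>l. of_real (\<phi> l) * cis (of_int h * l))" for h :: int
  define A where "A l = (\<Sum>h\<in>H. c h / (2 * pi) * cis (- (of_int h * l)))" for l
  have mi: "\<phi> \<in> borel_measurable (ival (-pi) pi)" by (rule measurable_ival[OF m])
  have B0: "B \<ge> 0" using B[of 0] by auto
  have contA: "continuous_on S A" for S unfolding A_def[abs_def] by (intro continuous_intros) auto
  have i1: "integrable (ival (-pi) pi) (\<lambda>l. of_real (\<phi> l) * cis (of_int h * l))" for h :: int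
  proof (rule ival.integrable_const_bound[where B = B])
    show "(\<lambda>l. complex_of_real (\<phi> l) * cis (of_int h * l)) \<in> borel_measurable (ival (-pi) pi)"
    proof (rule measurable_ival)
      have [measurable]: "(\<lambda>l. cis (of_int h * l)) \<in> borel_measurable borel"
        by (intro borel_measurable_continuous_onI continuous_intros)
      show "(\<lambda>l. complex_of_real (\<phi> l) * cis (of_int h * l)) \<in> borel_measurable borel"
        using m by measurable
    qed
  qed (use B in \<open>auto simp: norm_mult\<close>)
  have iphi2: "integrable (ival (-pi) pi) (\<lambda>l. (\<phi> l)\<^sup>2)"
  proof (rule ival.integrable_const_bound[where B = "B\<^sup>2"])
    have "(\<phi> l)\<^sup>2 \<le> B\<^sup>2" if "l \<in> {-pi..pi}" for l using B[OF that] by (metis abs_ge_zero power2_abs power_mono)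
    then show "AE l in ival (-pi) pi. norm ((\<phi> l)\<^sup>2) \<le> B\<^sup>2" by auto
  qed (use mi in measurable)
  define S where "S = (\<Sum>h\<in>H. (cmod (c h))\<^sup>2)"
  have phiA: "?I (\<lambda>l. of_real (\<phi> l) * cnj (A l)) = of_real (S / (2 * pi))" and iphiA: "integrable (ival (-pi) pi) (\<lambda>l. of_real (\<phi> l) * cnj (A l))"
  proof -
    have e: "of_real (\<phi> l) * cnj (A l) = (\<Sum>h\<in>H. cnj (c h) / (2 * pi) * (of_real (\<phi> l) * cis (of_int h * l)))" for l
      unfolding A_def cnj_sum sum_distrib_left by (intro sum.cong refl) (simp add: cis_cnj)
    show "integrable (ival (-pi) pi) (\<lambda>l. of_real (\<phi> l) * cnj (A l))" unfolding e
      by (intro Bochner_Integration.integrable_sum integrable_mult_right i1)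
    have "?I (\<lambda>l. of_real (\<phi> l) * cnj (A l)) = (\<Sum>h\<in>H. cnj (c h) / (2 * pi) * c h)"
      unfolding e c_def by (subst Bochner_Integration.integral_sum) (auto intro!: integrable_mult_right i1)
    also have "\<dots> = of_real (S / (2 * pi))"
      unfolding S_def of_real_divide of_real_sum complex_norm_square sum_divide_distrib
      by (intro sum.cong refl) simp
    finally show "?I (\<lambda>l. of_real (\<phi> l) * cnj (A l)) = of_real (S / (2 * pi))" .
  qed
  have AA: "?I (\<lambda>l. A l * cnj (A l)) = of_real (S / (2 * pi))"
  proof -
    have e: "A l * cnj (A l) = (\<Sum>h\<in>H. \<Sum>k\<in>H. c h / (2 * pi) * (cnj (c k) / (2 * pi)) * cis (of_int (k - h) * l))" for l
    proof -
      have "A l * cnj (A l) = (\<Sum>h\<in>H. \<Sum>k\<in>H. c h / (2 * pi) * cis (- (of_int h * l)) * cnj (c k / (2 * pi) * cis (- (of_int k * l))))"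
        unfolding A_def cnj_sum sum_product ..
      also have "\<dots> = (\<Sum>h\<in>H. \<Sum>k\<in>H. c h / (2 * pi) * (cnj (c k) / (2 * pi)) * cis (of_int (k - h) * l))"
      proof (intro sum.cong refl)
        fix h k
        have "c h / (2 * pi) * cis (- (of_int h * l)) * cnj (c k / (2 * pi) * cis (- (of_int k * l)))
          = c h / (2 * pi) * (cnj (c k) / (2 * pi)) * (cis (- (of_int h * l)) * cis (of_int k * l))"
          by (simp add: cis_cnj)
        then show "c h / (2 * pi) * cis (- (of_int h * l)) * cnj (c k / (2 * pi) * cis (- (of_int k * l))) = c h / (2 * pi) * (cnj (c k) / (2 * pi)) * cis (of_int (k - h) * l)"
          by (simp add: cis_mult left_diff_distrib)
      qed
      finally show ?thesis .
    qed
    have i: "integrable (ival (-pi) pi) (\<lambda>l. z * cis (of_int (k - h) * l))" for z and h k :: int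
      by (intro continuous_integrable_ival continuous_intros)
    have "?I (\<lambda>l. A l * cnj (A l)) = (\<Sum>h\<in>H. \<Sum>k\<in>H. c h / (2 * pi) * (cnj (c k) / (2 * pi)) * ?I (\<lambda>l. cis (of_int (k - h) * l)))"
      unfolding e using i by (simp only: Bochner_Integration.integral_sum Bochner_Integration.integrable_sum integral_mult_right_zero)
    also have "\<dots> = (\<Sum>h\<in>H. \<Sum>k\<in>H. if k = h then c h * cnj (c h) / (2 * pi) else 0)"
      unfolding integral_cis_period by (intro sum.cong refl) auto
    also have "\<dots> = (\<Sum>h\<in>H. c h * cnj (c h) / (2 * pi))" using H by simp
    also have "\<dots> = of_real (S / (2 * pi))"
      unfolding S_def of_real_divide of_real_sum complex_norm_square sum_divide_distrib by simp
    finally show ?thesis .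
  qed
  have pt: "(cmod (of_real (\<phi> l) - A l))\<^sup>2 = (\<phi> l)\<^sup>2 - 2 * Re (of_real (\<phi> l) * cnj (A l)) + Re (A l * cnj (A l))" for l
    unfolding cmod_power2 by (simp add: power2_eq_square algebra_simps)
  have iAA: "integrable (ival (-pi) pi) (\<lambda>l. A l * cnj (A l))" by (intro continuous_integrable_ival continuous_intros contA)
  have "0 \<le> ?I (\<lambda>l. (cmod (of_real (\<phi> l) - A l))\<^sup>2)" by simp
  also have "\<dots> = ?I (\<lambda>l. (\<phi> l)\<^sup>2) - 2 * ?I (\<lambda>l. Re (of_real (\<phi> l) * cnj (A l))) + ?I (\<lambda>l. Re (A l * cnj (A l)))"
    unfolding pt using iphi2 integrable_Re[OF iphiA] integrable_Re[OF iAA]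
    by (simp only: Bochner_Integration.integral_add Bochner_Integration.integral_diff Bochner_Integration.integrable_diff integrable_mult_right integral_mult_right_zero)
  also have "?I (\<lambda>l. Re (of_real (\<phi> l) * cnj (A l))) = S / (2 * pi)" using integral_Re[OF iphiA] by (simp only: phiA Re_complex_of_real)
  also have "?I (\<lambda>l. Re (A l * cnj (A l))) = S / (2 * pi)" using integral_Re[OF iAA] by (simp only: AA Re_complex_of_real)
  finally have "S / (2 * pi) \<le> ?I (\<lambda>l. (\<phi> l)\<^sup>2)" by simp
  also have "\<dots> \<le> ?I (\<lambda>l. B\<^sup>2)"
  proof (rule integral_mono[OF iphi2])
    show "integrable (ival (-pi) pi) (\<lambda>l. B\<^sup>2)" by (intro continuous_integrable_ival continuous_intros)
    show "(\<phi> l)\<^sup>2 \<le> B\<^sup>2" if "l \<in> space (ival (-pi) pi)" for l using B[of l] that by (metis abs_ge_zero power2_abs power_mono space_ival)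
  qed
  also have "\<dots> = 2 * pi * B\<^sup>2" by simp
  finally have "S \<le> (2 * pi * B)\<^sup>2" by (simp add: field_simps power2_eq_square)
  then show ?thesis by (simp add: S_def c_def)
qed

text \<open>\<open>Kf\<close> and \<delta> make the quadratic behaviour of the density at zero
  explicit; \<delta> stays within half a period because all frequencies are taken from
  [-\<pi>, \<pi>].\<close>

locale decimated = linear_series M \<xi> X a a_star + window W \<beta> C
  for M :: "'a measure" and \<xi> X :: "int \<Rightarrow> 'a \<Rightarrow> real" and a :: "int \<Rightarrow> real" and a_star :: "real \<Rightarrow> complex"
    and W :: "real \<Rightarrow> real" and \<beta> C :: real +
  fixes Kf \<delta> :: real
  assumes Kf: "Kf \<ge> 0" and \<delta>: "\<delta> > 0" "\<delta> \<le> pi"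
    and spec_quad: "\<And>l. \<bar>l\<bar> \<le> \<delta> \<Longrightarrow> \<bar>spec l - spec 0\<bar> \<le> Kf * l\<^sup>2"
begin

section \<open>Covariances of the block sums\<close>

definition w :: "nat \<Rightarrow> nat \<Rightarrow> real" where "w g j = W (- real j / real g) / sqrt (real g)"

text \<open>Blocks may start at any integer m. The estimator uses multiples of g only, but the
  diagonal bound compares neighbouring starting points.\<close>

definition Y :: "nat \<Rightarrow> int \<Rightarrow> 'a \<Rightarrow> real" where
  "Y g m \<omega> = (\<Sum>j<g. w g j * X (m + int j) \<omega>)"

definition v :: "nat \<Rightarrow> int \<Rightarrow> real" where
  "v g m = (\<Sum>j<g. w g j * a (m + int j))"

text \<open>The autocovariance of the stationary sequence of block sums, with the lag h in single
  time steps. Blocks of the estimator have lags that are multiples of g.\<close>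

definition S :: "nat \<Rightarrow> int \<Rightarrow> real" where
  "S g h = CI (\<lambda>l. spec l * (cmod (P g l))\<^sup>2 * cos (of_int h * l))"

lemma l2_series_Y: "l2_series M \<xi> (\<lambda>t. v g (m - t)) (Y g m)"
proof -
  have "l2_series M \<xi> (\<lambda>t. \<Sum>j<g. w g j * a (m + int j - t)) (\<lambda>\<omega>. \<Sum>j<g. w g j * X (m + int j) \<omega>)"
    by (intro l2_series_sum l2_series_cmult l2_series_X) auto
  then show ?thesis by (simp add: v_def Y_def[abs_def] algebra_simps)
qed

lemma square_integrable_Y: "square_integrable M (Y g m)" using l2_series_Y by (simp add: l2_series_def)

lemma spec_mult_integrable:
  assumes "\<phi> \<in> borel_measurable borel" "\<And>l. l \<in> {-pi..pi} \<Longrightarrow> norm (\<phi> l) \<le> B"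
  shows "integrable (ival (-pi) pi) (\<lambda>l. spec l * \<phi> l)"
proof (rule Bochner_Integration.integrable_bound[OF integrable_mult_left[OF spec_integrable, of B]])
  show "(\<lambda>l. spec l * \<phi> l) \<in> borel_measurable (ival (-pi) pi)"
    using assms(1) by (intro measurable_ival) measurable
  show "AE l in ival (-pi) pi. norm (spec l * \<phi> l) \<le> norm (spec l * B)"
  proof (rule AE_I2)
    fix l assume "l \<in> space (ival (-pi) pi)"
    then have "\<bar>\<phi> l\<bar> \<le> B" using assms(2)[of l] by simp
    then show "norm (spec l * \<phi> l) \<le> norm (spec l * B)"
      using spec_nonneg[of l] by (simp add: abs_mult mult_left_mono)
  qed
qed

lemma spec_mult_integrable_complex:
  assumes "continuous_on {-pi..pi} \<phi>" and "\<phi> \<in> borel_measurable borel"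
  shows "integrable (ival (-pi) pi) (\<lambda>l. complex_of_real (spec l) * \<phi> l)"
proof -
  obtain B where B: "\<And>l. l \<in> {-pi..pi} \<Longrightarrow> cmod (\<phi> l) \<le> B"
    using compact_imp_bounded[OF compact_continuous_image[OF assms(1) compact_Icc]] by (force simp: bounded_iff)
  show ?thesis
  proof (rule Bochner_Integration.integrable_bound[OF integrable_mult_left[OF spec_integrable, of B]])
    show "(\<lambda>l. complex_of_real (spec l) * \<phi> l) \<in> borel_measurable (ival (-pi) pi)"
      using assms(2) by (intro measurable_ival) measurable
    show "AE l in ival (-pi) pi. norm (complex_of_real (spec l) * \<phi> l) \<le> norm (spec l * B)"
    proof (rule AE_I2)
      fix l assume "l \<in> space (ival (-pi) pi)"
      then show "norm (complex_of_real (spec l) * \<phi> l) \<le> norm (spec l * B)"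
        using B[of l] spec_nonneg[of l] order_trans[OF norm_ge_zero B[of l]] by (simp add: norm_mult abs_mult mult_left_mono)
    qed
  qed
qed

text \<open>When the spectral form of the covariances of X is inserted, the double sum of block
  weights reassembles into the squared modulus of P. The covariance is real, so only the cosine
  remains.\<close>

lemma Y_cov: "expectation (\<lambda>\<omega>. Y g m \<omega> * Y g m' \<omega>) = S g (m - m')"
proof -
  have sX: "square_integrable M (X u)" for u using l2_series_X by (simp add: l2_series_def)
  have "expectation (\<lambda>\<omega>. Y g m \<omega> * Y g m' \<omega>) = expectation (\<lambda>\<omega>. \<Sum>j<g. \<Sum>k<g. w g j * w g k * (X (m + int j) \<omega> * X (m' + int k) \<omega>))"
    unfolding Y_def sum_product by (simp add: mult_ac)
  also have "\<dots> = (\<Sum>j<g. \<Sum>k<g. w g j * w g k * expectation (\<lambda>\<omega>. X (m + int j) \<omega> * X (m' + int k) \<omega>))"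
    using square_integrable_mult_integrable[OF sX sX] by (simp add: Bochner_Integration.integral_sum)
  finally have "complex_of_real (expectation (\<lambda>\<omega>. Y g m \<omega> * Y g m' \<omega>)) =
     (\<Sum>j<g. \<Sum>k<g. of_real (w g j * w g k) * CI (\<lambda>l. of_real (spec l) * cis (of_int (m + int j - (m' + int k)) * l)))"
    by (simp only: X_cov[symmetric] of_real_sum of_real_mult)
  also have "\<dots> = CI (\<lambda>l. \<Sum>j<g. \<Sum>k<g. of_real (w g j * w g k) * (of_real (spec l) * cis (of_int (m + int j - (m' + int k)) * l)))"
  proof -
    have "(\<lambda>l. cis (of_int h * l)) \<in> borel_measurable borel" for h :: int
      by (intro borel_measurable_continuous_onI continuous_intros)
    then have i: "integrable (ival (-pi) pi) (\<lambda>l. of_real (spec l) * cis (of_int h * l))" for h :: int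
      by (intro spec_mult_integrable_complex continuous_intros)
    show ?thesis
      using i by (simp only: Bochner_Integration.integral_sum Bochner_Integration.integrable_sum integral_mult_right_zero integrable_mult_right)
  qed
  also have "\<dots> = CI (\<lambda>l. of_real (spec l * (cmod (P g l))\<^sup>2) * cis (of_int (m - m') * l))"
  proof (intro Bochner_Integration.integral_cong refl)
    fix l
    have "of_real (spec l * (cmod (P g l))\<^sup>2) * cis (of_int (m - m') * l) = (\<Sum>j<g. \<Sum>k<g. of_real (w g j * w g k) * (of_real (spec l) * (cis (of_int (int j - int k) * l) * cis (of_int (m - m') * l))))"
      unfolding of_real_mult[of "spec l"] P_sq_expand w_def[symmetric] by (simp add: sum_distrib_left sum_distrib_right mult_ac)
    then show "(\<Sum>j<g. \<Sum>k<g. of_real (w g j * w g k) * (of_real (spec l) * cis (of_int (m + int j - (m' + int k)) * l))) = of_real (spec l * (cmod (P g l))\<^sup>2) * cis (of_int (m - m') * l)"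
      by (simp add: cis_mult algebra_simps)
  qed
  finally have *: "complex_of_real (expectation (\<lambda>\<omega>. Y g m \<omega> * Y g m' \<omega>)) = CI (\<lambda>l. of_real (spec l * (cmod (P g l))\<^sup>2) * cis (of_int (m - m') * l))" .
  have i: "integrable (ival (-pi) pi) (\<lambda>l. complex_of_real (spec l) * (of_real ((cmod (P g l))\<^sup>2) * cis (of_int (m - m') * l)))"
    by (intro spec_mult_integrable_complex continuous_intros isCont_P borel_measurable_continuous_onI)
  have "expectation (\<lambda>\<omega>. Y g m \<omega> * Y g m' \<omega>) = Re (CI (\<lambda>l. complex_of_real (spec l) * (of_real ((cmod (P g l))\<^sup>2) * cis (of_int (m - m') * l))))"
    using arg_cong[OF *, of Re] by (simp add: mult.assoc)
  also have "\<dots> = CI (\<lambda>l. Re (complex_of_real (spec l) * (of_real ((cmod (P g l))\<^sup>2) * cis (of_int (m - m') * l))))"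
    by (rule integral_Re[OF i, symmetric])
  also have "\<dots> = S g (m - m')" unfolding S_def
    by (intro Bochner_Integration.integral_cong refl) (simp flip: of_real_mult of_real_power)
  finally show ?thesis .
qed

lemma Psq_bounded: "\<exists>B\<ge>0. \<forall>l\<in>{-pi..pi}. (cmod (P g l))\<^sup>2 \<le> B"
proof -
  have "bounded ((\<lambda>l. (cmod (P g l))\<^sup>2) ` {-pi..pi})"
    by (intro compact_imp_bounded compact_continuous_image continuous_intros isCont_P) auto
  then obtain B where B: "\<And>l. l \<in> {-pi..pi} \<Longrightarrow> norm ((cmod (P g l))\<^sup>2) \<le> B" by (force simp: bounded_iff)
  have "0 \<le> B" using order_trans[OF norm_ge_zero B[of 0]] by simp
  then show ?thesis using B by (intro exI[of _ B]) auto
qed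

lemma spec_Psq_integrable:
  assumes [measurable]: "\<phi> \<in> borel_measurable borel" and \<phi>: "\<And>l. l \<in> {-pi..pi} \<Longrightarrow> \<bar>\<phi> l\<bar> \<le> D"
  shows "integrable (ival (-pi) pi) (\<lambda>l. spec l * (cmod (P g l))\<^sup>2 * \<phi> l)"
    and "integrable (ival (-pi) pi) (\<lambda>l. (cmod (P g l))\<^sup>2 * \<phi> l)"
proof -
  obtain B where B: "B \<ge> 0" "\<And>l. l \<in> {-pi..pi} \<Longrightarrow> (cmod (P g l))\<^sup>2 \<le> B" using Psq_bounded by blast
  have b: "norm ((cmod (P g l))\<^sup>2 * \<phi> l) \<le> B * D" if "l \<in> {-pi..pi}" for l
    using B(2)[OF that] \<phi>[OF that] B(1) by (simp add: abs_mult mult_mono)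
  have "integrable (ival (-pi) pi) (\<lambda>l. spec l * ((cmod (P g l))\<^sup>2 * \<phi> l))"
    by (rule spec_mult_integrable[OF _ b]) auto
  then show "integrable (ival (-pi) pi) (\<lambda>l. spec l * (cmod (P g l))\<^sup>2 * \<phi> l)" by (simp add: mult.assoc)
  show "integrable (ival (-pi) pi) (\<lambda>l. (cmod (P g l))\<^sup>2 * \<phi> l)"
    by (rule ival.integrable_const_bound[where B = "B * D"]) (use b in \<open>auto intro: measurable_ival\<close>)
qed

definition "Ksp = CI spec + 2 * pi * spec 0"
text \<open>A bound for the kernel beyond \<delta>. Its exponent is the origin of the growth
  condition: n / g blocks times the square of \<open>g powr (1 - 2 * \<beta>)\<close> is exactly the
  square of \<open>n powr (1/2) * g powr (1/2 - 2 * \<beta>)\<close>.\<close>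

definition "far g = K2\<^sup>2 * \<delta> powr (- (2 * \<beta>)) * real g powr (1 - 2 * \<beta>)"

lemma Ksp_nonneg: "Ksp \<ge> 0"
  unfolding Ksp_def using spec_nonneg by (intro add_nonneg_nonneg Bochner_Integration.integral_nonneg) auto

lemma far_nonneg: "far g \<ge> 0" by (simp add: far_def)

lemma P_far:
  assumes g: "g > 0" and l: "\<bar>l\<bar> \<le> pi" "\<bar>l\<bar> > \<delta>"
  shows "(cmod (P g l))\<^sup>2 \<le> far g"
proof -
  have "(cmod (P g l))\<^sup>2 \<le> (K2 * (sqrt g * (1 + g * \<bar>l\<bar>) powr - \<beta>))\<^sup>2"
    by (intro power_mono P_bound g l) auto
  also have "\<dots> \<le> (K2 * (sqrt g * (g * \<delta>) powr - \<beta>))\<^sup>2"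
  proof (intro power_mono mult_left_mono powr_mono2')
    have "real g * \<delta> \<le> real g * \<bar>l\<bar>" using l g by (intro mult_left_mono) auto
    then show "real g * \<delta> \<le> 1 + real g * \<bar>l\<bar>" by simp
  qed (use g \<delta> beta K2_nonneg in auto)
  also have "\<dots> = K2\<^sup>2 * (g * ((g * \<delta>) powr - \<beta>)\<^sup>2)" by (simp add: power_mult_distrib)
  also have "((real g * \<delta>) powr - \<beta>)\<^sup>2 = real g powr (- (2 * \<beta>)) * \<delta> powr (- (2 * \<beta>))"
  proof -
    have e: "t powr - \<beta> * t powr - \<beta> = t powr (- (2 * \<beta>))" for t :: real by (simp flip: powr_add)
    have "((real g * \<delta>) powr - \<beta>)\<^sup>2 = (real g powr - \<beta> * real g powr - \<beta>) * (\<delta> powr - \<beta> * \<delta> powr - \<beta>)"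
      using \<delta> by (simp add: power2_eq_square powr_mult)
    then show ?thesis unfolding e .
  qed
  also have "K2\<^sup>2 * (g * (real g powr (- (2 * \<beta>)) * \<delta> powr (- (2 * \<beta>)))) = far g"
  proof -
    have "real g powr (1 - 2 * \<beta>) = g * real g powr (- (2 * \<beta>))"
      using g powr_add[of "real g" 1 "- (2 * \<beta>)"] by simp
    then show ?thesis by (simp add: far_def)
  qed
  finally show ?thesis .
qed

lemma far_le: assumes "g > 0" shows "far g \<le> K2\<^sup>2 * \<delta> powr (- (2 * \<beta>)) / (real g)\<^sup>2"
proof -
  have "real g powr (1 - 2 * \<beta>) \<le> real g powr (-2)" using assms beta by (intro powr_mono) auto
  also have "\<dots> = 1 / (real g)\<^sup>2" using assms by (simp add: powr_minus powr_numeral field_simps)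
  finally have "K2\<^sup>2 * \<delta> powr (- (2 * \<beta>)) * real g powr (1 - 2 * \<beta>) \<le> K2\<^sup>2 * \<delta> powr (- (2 * \<beta>)) * (1 / (real g)\<^sup>2)"
    by (intro mult_left_mono) auto
  then show ?thesis by (simp add: far_def)
qed

text \<open>With z = g |l| the factor \<open>l\<^sup>2\<close> is
  \<open>z\<^sup>2 / g\<^sup>2\<close>. Half of the decay of the kernel absorbs
  \<open>z\<^sup>2\<close>; the other half remains as an integrable profile, whose integral gains a
  further 1 / g.\<close>

lemma P_near:
  assumes g: "g > 0" and l: "\<bar>l\<bar> \<le> pi"
  shows "l\<^sup>2 * (cmod (P g l))\<^sup>2 \<le> K2\<^sup>2 / g * (1 / (1 + (g * l)\<^sup>2))"
proof -
  define z where "z = real g * \<bar>l\<bar>"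
  have z: "z \<ge> 0" by (simp add: z_def)
  have "(cmod (P g l))\<^sup>2 \<le> (K2 * (sqrt g / (1 + g * \<bar>l\<bar>)\<^sup>2))\<^sup>2" by (intro power_mono P_bound2 g l) auto
  also have "\<dots> = K2\<^sup>2 * g / ((1 + z)\<^sup>2 * (1 + z)\<^sup>2)" by (simp add: power_mult_distrib power_divide z_def power2_eq_square mult_ac)
  finally have "l\<^sup>2 * (cmod (P g l))\<^sup>2 \<le> l\<^sup>2 * (K2\<^sup>2 * g / ((1 + z)\<^sup>2 * (1 + z)\<^sup>2))" by (intro mult_left_mono) auto
  also have "l\<^sup>2 = z\<^sup>2 / (real g)\<^sup>2" using g by (simp add: z_def power_mult_distrib)
  also have "z\<^sup>2 / (real g)\<^sup>2 * (K2\<^sup>2 * g / ((1 + z)\<^sup>2 * (1 + z)\<^sup>2)) = K2\<^sup>2 / g * ((z\<^sup>2 / (1 + z)\<^sup>2) * (1 / (1 + z)\<^sup>2))"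
    using g by (simp add: power2_eq_square)
  also have "\<dots> \<le> K2\<^sup>2 / g * (1 * (1 / (1 + z\<^sup>2)))"
  proof (intro mult_left_mono mult_mono)
    show "z\<^sup>2 / (1 + z)\<^sup>2 \<le> 1" using z power_mono[of z "1 + z" 2] zero_less_power[of "1 + z" 2] by (simp add: divide_le_eq_1)
    show "1 / (1 + z)\<^sup>2 \<le> 1 / (1 + z\<^sup>2)"
      using z by (intro divide_left_mono mult_pos_pos zero_less_power add_pos_nonneg) (auto simp: power2_sum)
  qed auto
  finally show ?thesis using g by (simp add: z_def power_mult_distrib)
qed

text \<open>Splitting at \<open>\<bar>l\<bar> = \<delta>\<close>: near zero the density is quadratically close to its value at zero,
  away from zero the kernel \<open>\<bar>P g l\<bar>\<^sup>2\<close> is uniformly small.\<close>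

definition "near g l = (if \<bar>l\<bar> \<le> \<delta> then (spec l - spec 0) * (cmod (P g l))\<^sup>2 else 0)"
definition "rest g l = (if \<bar>l\<bar> \<le> \<delta> then 0 else (spec l - spec 0) * (cmod (P g l))\<^sup>2)"

lemma near_measurable [measurable]: "near g \<in> borel_measurable borel"
  unfolding near_def[abs_def] by measurable

lemma rest_measurable [measurable]: "rest g \<in> borel_measurable borel"
  unfolding rest_def[abs_def] by measurable

lemma near_bound:
  assumes "g > 0"
  shows "\<bar>near g l\<bar> \<le> Kf * K2\<^sup>2 / g * (1 / (1 + (g * l)\<^sup>2))"
proof (cases "\<bar>l\<bar> \<le> \<delta>")
  case True
  have "\<bar>near g l\<bar> \<le> Kf * l\<^sup>2 * (cmod (P g l))\<^sup>2"
    using True spec_quad[OF True] by (simp add: near_def abs_mult mult_right_mono)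
  also have "\<dots> = Kf * (l\<^sup>2 * (cmod (P g l))\<^sup>2)" by simp
  also have "\<dots> \<le> Kf * (K2\<^sup>2 / g * (1 / (1 + (g * l)\<^sup>2)))"
    using True \<delta> by (intro mult_left_mono P_near assms Kf) auto
  finally show ?thesis by simp
next
  case False
  then show ?thesis using Kf by (simp add: near_def)
qed

lemma near_bound_const:
  assumes "g > 0"
  shows "\<bar>near g l\<bar> \<le> Kf * K2\<^sup>2 / g"
proof -
  have "1 / (1 + (real g * l)\<^sup>2) \<le> 1" by (simp add: divide_le_eq add_pos_nonneg)
  then have "Kf * K2\<^sup>2 / g * (1 / (1 + (g * l)\<^sup>2)) \<le> Kf * K2\<^sup>2 / g * 1" using Kf by (intro mult_left_mono) auto
  then show ?thesis using near_bound[OF assms, of l] by simp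
qed

lemma rest_bound:
  assumes "g > 0" "\<bar>l\<bar> \<le> pi"
  shows "\<bar>rest g l\<bar> \<le> (spec l + spec 0) * far g"
proof (cases "\<bar>l\<bar> \<le> \<delta>")
  case True
  then show ?thesis using far_nonneg spec_nonneg by (simp add: rest_def)
next
  case False
  have "\<bar>spec l - spec 0\<bar> \<le> spec l + spec 0" using spec_nonneg[of l] spec_nonneg[of 0] by simp
  then show ?thesis using False P_far[of g l] assms spec_nonneg
    by (auto simp: rest_def abs_mult intro!: mult_mono)
qed

lemma integrable_near: "g > 0 \<Longrightarrow> integrable (ival (-pi) pi) (near g)"
  using near_bound_const by (intro ival.integrable_const_bound[where B = "Kf * K2\<^sup>2 / g"] AE_I2) (auto intro: measurable_ival)

lemma rest_bound_integrable: "integrable (ival (-pi) pi) (\<lambda>l. (spec l + spec 0) * far g)"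
  and rest_bound_integral: "CI (\<lambda>l. (spec l + spec 0) * far g) = Ksp * far g"
proof -
  have i: "integrable (ival (-pi) pi) (\<lambda>l. spec 0)" by (intro continuous_integrable_ival continuous_intros)
  show "integrable (ival (-pi) pi) (\<lambda>l. (spec l + spec 0) * far g)"
    by (intro integrable_mult_left Bochner_Integration.integrable_add i spec_integrable)
  have "CI (\<lambda>l. (spec l + spec 0) * far g) = CI (\<lambda>l. spec l + spec 0) * far g" by (rule integral_mult_left_zero)
  also have "CI (\<lambda>l. spec l + spec 0) = Ksp" using i spec_integrable by (simp add: Ksp_def)
  finally show "CI (\<lambda>l. (spec l + spec 0) * far g) = Ksp * far g" .
qed

lemma integrable_rest: "g > 0 \<Longrightarrow> integrable (ival (-pi) pi) (rest g)"
  by (rule Bochner_Integration.integrable_bound[OF rest_bound_integrable[of g]])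
     (use rest_bound far_nonneg spec_nonneg in \<open>auto intro!: measurable_ival AE_I2 simp: abs_mult\<close>)

lemma cos_bounded_integrable:
  fixes \<phi> :: "real \<Rightarrow> real"
  assumes "integrable (ival (-pi) pi) \<phi>"
  shows "integrable (ival (-pi) pi) (\<lambda>l. \<phi> l * cos (c * l))"
proof (rule Bochner_Integration.integrable_bound[OF assms])
  show "(\<lambda>l. \<phi> l * cos (c * l)) \<in> borel_measurable (ival (-pi) pi)"
  proof -
    have "(\<lambda>l. cos (c * l)) \<in> borel_measurable borel" by measurable
    then show ?thesis by (intro borel_measurable_times borel_measurable_integrable[OF assms] measurable_ival)
  qed
  have "\<bar>\<phi> l\<bar> * \<bar>cos (c * l)\<bar> \<le> \<bar>\<phi> l\<bar> * 1" for l by (intro mult_left_mono) auto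
  then show "AE l in ival (-pi) pi. norm (\<phi> l * cos (c * l)) \<le> norm (\<phi> l)" by (simp add: abs_mult)
qed

lemma rest_cos_bound:
  assumes g: "g > 0"
  shows "\<bar>CI (\<lambda>l. rest g l * cos (c * l))\<bar> \<le> Ksp * far g"
proof -
  have "\<bar>CI (\<lambda>l. rest g l * cos (c * l))\<bar> \<le> CI (\<lambda>l. \<bar>rest g l * cos (c * l)\<bar>)" by (rule integral_abs_bound)
  also have "\<dots> \<le> CI (\<lambda>l. (spec l + spec 0) * far g)"
  proof (rule integral_mono[OF _ rest_bound_integrable])
    show "integrable (ival (-pi) pi) (\<lambda>l. \<bar>rest g l * cos (c * l)\<bar>)"
      by (intro integrable_abs cos_bounded_integrable integrable_rest g)
    fix l assume "l \<in> space (ival (-pi) pi)"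
    then have "\<bar>rest g l\<bar> \<le> (spec l + spec 0) * far g" by (intro rest_bound g) auto
    moreover have "\<bar>rest g l\<bar> * \<bar>cos (c * l)\<bar> \<le> \<bar>rest g l\<bar> * 1" by (intro mult_left_mono) auto
    ultimately show "\<bar>rest g l * cos (c * l)\<bar> \<le> (spec l + spec 0) * far g" by (simp add: abs_mult)
  qed
  finally show ?thesis unfolding rest_bound_integral .
qed

lemma S_split:
  assumes g: "g > 0"
  shows "S g h = CI (\<lambda>l. near g l * cos (of_int h * l)) + CI (\<lambda>l. rest g l * cos (of_int h * l)) + spec 0 * CI (\<lambda>l. (cmod (P g l))\<^sup>2 * cos (of_int h * l))"
proof -
  have i: "integrable (ival (-pi) pi) (\<lambda>l. spec 0 * ((cmod (P g l))\<^sup>2 * cos (of_int h * l)))"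
    by (intro integrable_mult_right spec_Psq_integrable[where D = 1]) auto
  have "S g h = CI (\<lambda>l. near g l * cos (of_int h * l) + rest g l * cos (of_int h * l) + spec 0 * ((cmod (P g l))\<^sup>2 * cos (of_int h * l)))"
    unfolding S_def by (intro Bochner_Integration.integral_cong refl) (auto simp: near_def rest_def algebra_simps)
  also have "\<dots> = CI (\<lambda>l. near g l * cos (of_int h * l)) + CI (\<lambda>l. rest g l * cos (of_int h * l)) + CI (\<lambda>l. spec 0 * ((cmod (P g l))\<^sup>2 * cos (of_int h * l)))"
    using cos_bounded_integrable[OF integrable_near[OF g]] cos_bounded_integrable[OF integrable_rest[OF g]] i
    by (simp only: Bochner_Integration.integral_add Bochner_Integration.integrable_add)
  finally show ?thesis by simp
qed

definition "KS0 = Kf * K2\<^sup>2 * pi + Ksp * (K2\<^sup>2 * \<delta> powr (- (2 * \<beta>))) + spec 0 * K3"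

text \<open>All three pieces have order \<open>g powr - 2\<close>: the near part through its
  integrable profile, the rest because 1 - 2 \<beta> < -2, the constant part through the energy of
  P.\<close>

lemma S_zero_approx:
  assumes g: "g > 0"
  shows "\<bar>S g 0 - spec 0\<bar> \<le> KS0 / (real g)\<^sup>2"
proof -
  have a: "\<bar>CI (near g)\<bar> \<le> Kf * K2\<^sup>2 * pi / (real g)\<^sup>2"
  proof -
    have "\<bar>CI (near g)\<bar> \<le> CI (\<lambda>l. \<bar>near g l\<bar>)" by (rule integral_abs_bound)
    also have "\<dots> \<le> CI (\<lambda>l. Kf * K2\<^sup>2 / g * (1 / (1 + (g * l)\<^sup>2)))"
      using integral_inverse_1_plus_scaled_ival(1)[of g "-pi" pi] g
      by (intro integral_mono integrable_abs integrable_near near_bound integrable_mult_right) auto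
    also have "\<dots> = Kf * K2\<^sup>2 / g * CI (\<lambda>l. 1 / (1 + (g * l)\<^sup>2))" by (rule integral_mult_right_zero)
    also have "\<dots> \<le> Kf * K2\<^sup>2 / g * (pi / g)"
      using integral_inverse_1_plus_scaled_ival(2)[of g "-pi" pi] g Kf by (intro mult_left_mono) auto
    finally show ?thesis by (simp add: power2_eq_square)
  qed
  have b: "\<bar>CI (\<lambda>l. rest g l * cos (0 * l))\<bar> \<le> Ksp * (K2\<^sup>2 * \<delta> powr (- (2 * \<beta>)) / (real g)\<^sup>2)"
    by (rule order_trans[OF rest_cos_bound[OF g]]) (intro mult_left_mono far_le g Ksp_nonneg)
  have c: "\<bar>spec 0 * CI (\<lambda>l. (cmod (P g l))\<^sup>2) - spec 0\<bar> \<le> spec 0 * (K3 / (real g)\<^sup>2)"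
  proof -
    have "spec 0 * CI (\<lambda>l. (cmod (P g l))\<^sup>2) - spec 0 = spec 0 * (CI (\<lambda>l. (cmod (P g l))\<^sup>2) - 1)" by (simp add: algebra_simps)
    then show ?thesis using mult_left_mono[OF P_energy[OF g] spec_nonneg[of 0]] spec_nonneg[of 0] by (simp add: abs_mult)
  qed
  show ?thesis using S_split[OF g, of 0] a b c by (simp add: KS0_def add_divide_distrib)
qed

text \<open>At nonzero multiples of g the constant density drops out by orthogonality. The near part
  is uniformly of order 1 / g, so Bessel controls all lags together, whatever their number; only the
  rest pays the factor \<open>card H\<close>.\<close>

lemma S_offdiag:
  fixes H :: "int set"
  assumes g: "g > 0" and H: "finite H" "0 \<notin> H"
  shows "(\<Sum>h\<in>H. (S g (int g * h))\<^sup>2) \<le> 2 * (2 * pi * (Kf * K2\<^sup>2 / g))\<^sup>2 + 2 * real (card H) * (Ksp * far g)\<^sup>2"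
proof -
  define p where "p h = CI (\<lambda>l. near g l * cos (of_int h * l))" for h :: int
  define q where "q h = CI (\<lambda>l. rest g l * cos (of_int h * l))" for h :: int
  have Sh: "S g (int g * h) = p (int g * h) + q (int g * h)" if "h \<noteq> 0" for h
  proof -
    have i: "integrable (ival (-pi) pi) (\<lambda>l. of_real ((cmod (P g l))\<^sup>2) * cis (of_int (int g * h) * l))"
      by (intro continuous_integrable_ival continuous_intros isCont_P)
    have "CI (\<lambda>l. (cmod (P g l))\<^sup>2 * cos (of_int (int g * h) * l)) = CI (\<lambda>l. Re (of_real ((cmod (P g l))\<^sup>2) * cis (of_int (int g * h) * l)))"
      by (intro Bochner_Integration.integral_cong refl) (simp flip: of_real_power)
    also have "\<dots> = 0" using integral_Re[OF i] P_orthogonal[OF that, of g] by simp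
    finally show ?thesis using S_split[OF g, of "int g * h"] by (simp add: p_def q_def)
  qed
  have pc: "(p h)\<^sup>2 \<le> (cmod (CI (\<lambda>l. of_real (near g l) * cis (of_int h * l))))\<^sup>2" for h
  proof -
    have [measurable]: "(\<lambda>l. cis (of_int h * l)) \<in> borel_measurable borel"
      by (intro borel_measurable_continuous_onI continuous_intros)
    have i: "integrable (ival (-pi) pi) (\<lambda>l. complex_of_real (near g l) * cis (of_int h * l))"
      using near_bound_const[OF g] by (intro ival.integrable_const_bound[where B = "Kf * K2\<^sup>2 / g"] AE_I2 measurable_ival) (auto simp: norm_mult)
    have "p h = Re (CI (\<lambda>l. of_real (near g l) * cis (of_int h * l)))"
      unfolding p_def using integral_Re[OF i] by simp
    then show ?thesis using abs_Re_le_cmod by (metis abs_ge_zero power2_abs power_mono)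
  qed
  have inj: "inj_on (\<lambda>h. int g * h) H" using g by (auto simp: inj_on_def)
  have "(\<Sum>h\<in>H. (S g (int g * h))\<^sup>2) \<le> (\<Sum>h\<in>H. 2 * (p (int g * h))\<^sup>2 + 2 * (Ksp * far g)\<^sup>2)"
  proof (intro sum_mono)
    fix h assume "h \<in> H"
    then have h: "h \<noteq> 0" using H by auto
    have "(x + y)\<^sup>2 \<le> 2 * x\<^sup>2 + 2 * y\<^sup>2" for x y :: real using sum_squares_bound[of x y] by (simp add: power2_sum)
    then have "(S g (int g * h))\<^sup>2 \<le> 2 * (p (int g * h))\<^sup>2 + 2 * (q (int g * h))\<^sup>2" unfolding Sh[OF h] .
    moreover have "(q (int g * h))\<^sup>2 \<le> (Ksp * far g)\<^sup>2"
      unfolding q_def using rest_cos_bound[OF g] by (metis abs_ge_zero power2_abs power_mono)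
    ultimately show "(S g (int g * h))\<^sup>2 \<le> 2 * (p (int g * h))\<^sup>2 + 2 * (Ksp * far g)\<^sup>2" by simp
  qed
  also have "\<dots> = 2 * (\<Sum>h\<in>(\<lambda>h. int g * h) ` H. (p h)\<^sup>2) + 2 * real (card H) * (Ksp * far g)\<^sup>2"
    by (simp add: sum.distrib sum_distrib_left sum.reindex[OF inj])
  also have "(\<Sum>h\<in>(\<lambda>h. int g * h) ` H. (p h)\<^sup>2) \<le> (\<Sum>h\<in>(\<lambda>h. int g * h) ` H. (cmod (CI (\<lambda>l. of_real (near g l) * cis (of_int h * l))))\<^sup>2)"
    by (intro sum_mono pc)
  also have "\<dots> \<le> (2 * pi * (Kf * K2\<^sup>2 / g))\<^sup>2"
    using H near_bound_const[OF g] by (intro Bessel_cis near_measurable) auto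
  finally show ?thesis by simp
qed

definition "KS1 = 2 * pi * ((spec 0 + Kf * pi\<^sup>2) * K2\<^sup>2) + 4 * (Ksp * (K2\<^sup>2 * \<delta> powr (- (2 * \<beta>))))"

text \<open>The left side is the mean-square change of a block sum under a shift by one, with
  spectral factor 2 - 2 cos l. Near zero this is at most \<open>l\<^sup>2\<close> and compensates
  the growth of the kernel; elsewhere it is at most 4 and the kernel is small.\<close>

lemma S_increment:
  assumes g: "g > 0"
  shows "2 * (S g 0 - S g 1) \<le> KS1 / g"
proof -
  have g1: "real g \<ge> 1" using g by simp
  have i1: "integrable (ival (-pi) pi) (\<lambda>l. spec l * (cmod (P g l))\<^sup>2 * cos (of_int h * l))" for h :: int
    by (rule spec_Psq_integrable(1)[where D = 1]) auto
  have i: "integrable (ival (-pi) pi) (\<lambda>l. spec l * (cmod (P g l))\<^sup>2 * (2 - 2 * cos l))"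
  proof (rule spec_Psq_integrable(1)[where D = 4])
    show "\<bar>2 - 2 * cos l\<bar> \<le> 4" for l :: real using cos_ge_minus_one[of l] cos_le_one[of l] by linarith
  qed simp
  have "2 * (S g 0 - S g 1) = CI (\<lambda>l. spec l * (cmod (P g l))\<^sup>2 * (2 - 2 * cos l))"
  proof -
    have "2 * (S g 0 - S g 1) = 2 * CI (\<lambda>l. spec l * (cmod (P g l))\<^sup>2 * cos (of_int 0 * l) - spec l * (cmod (P g l))\<^sup>2 * cos (of_int 1 * l))"
      unfolding S_def using i1[of 0] i1[of 1] by (subst Bochner_Integration.integral_diff) simp_all
    also have "\<dots> = CI (\<lambda>l. 2 * (spec l * (cmod (P g l))\<^sup>2 * cos (of_int 0 * l) - spec l * (cmod (P g l))\<^sup>2 * cos (of_int 1 * l)))"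
      by (rule integral_mult_right_zero[symmetric])
    finally show ?thesis by (simp add: algebra_simps)
  qed
  also have "\<dots> \<le> CI (\<lambda>l. (spec 0 + Kf * pi\<^sup>2) * K2\<^sup>2 / g + 4 * ((spec l + spec 0) * far g))"
  proof (rule integral_mono[OF i])
    show "integrable (ival (-pi) pi) (\<lambda>l. (spec 0 + Kf * pi\<^sup>2) * K2\<^sup>2 / g + 4 * ((spec l + spec 0) * far g))"
      by (intro Bochner_Integration.integrable_add integrable_mult_right rest_bound_integrable continuous_integrable_ival continuous_intros)
    fix l assume "l \<in> space (ival (-pi) pi)"
    then have l: "\<bar>l\<bar> \<le> pi" by auto
    have c0: "2 - 2 * cos l \<ge> 0" "2 - 2 * cos l \<le> 4" using cos_ge_minus_one[of l] cos_le_one[of l] by linarith+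
    have c2: "2 - 2 * cos l \<le> l\<^sup>2"
    proof -
      have "cos l = 1 - 2 * (sin (l / 2))\<^sup>2" using cos_double_sin[of "l / 2"] by simp
      moreover have "(sin (l / 2))\<^sup>2 \<le> (l / 2)\<^sup>2" by (rule abs_le_square_iff[THEN iffD1, OF abs_sin_x_le_abs_x])
      ultimately show ?thesis by (simp add: power_divide)
    qed
    show "spec l * (cmod (P g l))\<^sup>2 * (2 - 2 * cos l) \<le> (spec 0 + Kf * pi\<^sup>2) * K2\<^sup>2 / g + 4 * ((spec l + spec 0) * far g)"
    proof (cases "\<bar>l\<bar> \<le> \<delta>")
      case True
      have "l\<^sup>2 \<le> pi\<^sup>2" using l by (metis abs_ge_zero power2_abs power_mono)
      then have "Kf * l\<^sup>2 \<le> Kf * pi\<^sup>2" using Kf by (rule mult_left_mono)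
      then have sl: "spec l \<le> spec 0 + Kf * pi\<^sup>2" using spec_quad[OF True] by linarith
      have "spec l * (cmod (P g l))\<^sup>2 * (2 - 2 * cos l) \<le> spec l * (cmod (P g l))\<^sup>2 * l\<^sup>2"
        using c2 spec_nonneg by (intro mult_left_mono) auto
      also have "\<dots> = spec l * (l\<^sup>2 * (cmod (P g l))\<^sup>2)" by simp
      also have "\<dots> \<le> (spec 0 + Kf * pi\<^sup>2) * (K2\<^sup>2 / g)"
      proof (intro mult_mono sl)
        have "1 / (1 + (real g * l)\<^sup>2) \<le> 1" by (simp add: divide_le_eq add_pos_nonneg)
        then have "K2\<^sup>2 / g * (1 / (1 + (g * l)\<^sup>2)) \<le> K2\<^sup>2 / g * 1" by (intro mult_left_mono) auto
        then show "l\<^sup>2 * (cmod (P g l))\<^sup>2 \<le> K2\<^sup>2 / g" using P_near[OF g l] by simp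
      qed (use spec_nonneg Kf in auto)
      finally show ?thesis using spec_nonneg[of l] spec_nonneg[of 0] far_nonneg[of g]
        by (simp add: add_increasing2)
    next
      case False
      have "spec l * (cmod (P g l))\<^sup>2 * (2 - 2 * cos l) \<le> (spec l + spec 0) * far g * 4"
        using P_far[OF g l] False c0 spec_nonneg[of l] spec_nonneg[of 0] far_nonneg[of g]
        by (intro mult_mono) auto
      moreover have "0 \<le> (spec 0 + Kf * pi\<^sup>2) * K2\<^sup>2 / g" using spec_nonneg Kf by simp
      ultimately show ?thesis by simp
    qed
  qed
  also have "\<dots> = 2 * pi * ((spec 0 + Kf * pi\<^sup>2) * K2\<^sup>2 / g) + 4 * (Ksp * far g)"
  proof -
    have "integrable (ival (-pi) pi) (\<lambda>l. (spec 0 + Kf * pi\<^sup>2) * K2\<^sup>2 / g)" by (intro continuous_integrable_ival continuous_intros)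
    then have "CI (\<lambda>l. (spec 0 + Kf * pi\<^sup>2) * K2\<^sup>2 / g + 4 * ((spec l + spec 0) * far g))
      = CI (\<lambda>l. (spec 0 + Kf * pi\<^sup>2) * K2\<^sup>2 / g) + 4 * CI (\<lambda>l. (spec l + spec 0) * far g)"
      by (simp only: Bochner_Integration.integral_add integrable_mult_right[OF rest_bound_integrable] integral_mult_right_zero)
    then show ?thesis unfolding rest_bound_integral by simp
  qed
  also have "\<dots> \<le> 2 * pi * ((spec 0 + Kf * pi\<^sup>2) * K2\<^sup>2 / g) + 4 * (Ksp * (K2\<^sup>2 * \<delta> powr (- (2 * \<beta>)) / g))"
  proof (intro add_left_mono mult_left_mono Ksp_nonneg)
    have "K2\<^sup>2 * \<delta> powr (- (2 * \<beta>)) / (real g)\<^sup>2 \<le> K2\<^sup>2 * \<delta> powr (- (2 * \<beta>)) / g"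
      using g1 by (intro divide_left_mono) (auto simp: power2_eq_square)
    then show "far g \<le> K2\<^sup>2 * \<delta> powr (- (2 * \<beta>)) / g" using far_le[OF g] by linarith
  qed auto
  also have "\<dots> = KS1 / g" by (simp add: KS1_def add_divide_distrib)
  finally show ?thesis .
qed

end

section \<open>The central limit theorem\<close>

lemma sum_square_expand:
  fixes c :: "'p \<Rightarrow> real"
  shows "(\<Sum>e\<in>E. (\<Sum>p\<in>P. c p * x p e)\<^sup>2) = (\<Sum>p\<in>P. \<Sum>q\<in>P. c p * c q * (\<Sum>e\<in>E. x p e * x q e))"
proof -
  have "(\<Sum>e\<in>E. (\<Sum>p\<in>P. c p * x p e)\<^sup>2) = (\<Sum>e\<in>E. \<Sum>p\<in>P. \<Sum>q\<in>P. c p * c q * (x p e * x q e))"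
    unfolding power2_eq_square sum_product by (intro sum.cong refl) (simp add: mult_ac)
  also have "\<dots> = (\<Sum>p\<in>P. \<Sum>e\<in>E. \<Sum>q\<in>P. c p * c q * (x p e * x q e))" by (rule sum.swap)
  also have "\<dots> = (\<Sum>p\<in>P. \<Sum>q\<in>P. \<Sum>e\<in>E. c p * c q * (x p e * x q e))" by (intro sum.cong refl sum.swap)
  finally show ?thesis by (simp only: sum_distrib_left)
qed

text \<open>In matrix terms, the squared Frobenius norm of \<open>U\<^sup>T A U\<close> through the
  Gram matrix G of the rows of U. The pairs (k, l) index tensor products of rows, and inner products
  of tensors factor.\<close>

lemma congruence_Frobenius:
  fixes u :: "'k \<Rightarrow> 't \<Rightarrow> real" and A :: "'k \<Rightarrow> 'k \<Rightarrow> real"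
  defines "G \<equiv> \<lambda>F k l. \<Sum>t\<in>F. u k t * u l t"
  shows "(\<Sum>s\<in>F. \<Sum>t\<in>F. (\<Sum>k\<in>K. \<Sum>l\<in>K. A k l * (u k s * u l t))\<^sup>2)
    = (\<Sum>k\<in>K. \<Sum>l\<in>K. \<Sum>k'\<in>K. \<Sum>l'\<in>K. A k l * A k' l' * (G F k k' * G F l l'))"
proof -
  let ?x = "\<lambda>(k, l) (s, t). u k s * u l t"
  have "(\<Sum>s\<in>F. \<Sum>t\<in>F. (\<Sum>k\<in>K. \<Sum>l\<in>K. A k l * (u k s * u l t))\<^sup>2) = (\<Sum>e\<in>F \<times> F. (\<Sum>p\<in>K \<times> K. (case p of (k, l) \<Rightarrow> A k l) * ?x p e)\<^sup>2)"
    by (simp add: sum.cartesian_product case_prod_beta)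
  also have "\<dots> = (\<Sum>p\<in>K \<times> K. \<Sum>q\<in>K \<times> K. (case p of (k, l) \<Rightarrow> A k l) * (case q of (k, l) \<Rightarrow> A k l) * (\<Sum>e\<in>F \<times> F. ?x p e * ?x q e))"
    by (rule sum_square_expand)
  also have "\<dots> = (\<Sum>p\<in>K \<times> K. \<Sum>q\<in>K \<times> K. (case p of (k, l) \<Rightarrow> A k l) * (case q of (k, l) \<Rightarrow> A k l) * (G F (fst p) (fst q) * G F (snd p) (snd q)))"
  proof (intro sum.cong refl arg_cong[of _ _ "\<lambda>z. _ * z"])
    fix p q :: "'k \<times> 'k"
    have "(\<Sum>e\<in>F \<times> F. ?x p e * ?x q e) = (\<Sum>s\<in>F. \<Sum>t\<in>F. (u (fst p) s * u (fst q) s) * (u (snd p) t * u (snd q) t))"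
      by (simp add: sum.cartesian_product case_prod_beta mult_ac)
    also have "\<dots> = G F (fst p) (fst q) * G F (snd p) (snd q)" unfolding G_def by (rule sum_product[symmetric])
    finally show "(\<Sum>e\<in>F \<times> F. ?x p e * ?x q e) = G F (fst p) (fst q) * G F (snd p) (snd q)" .
  qed
  also have "\<dots> = (\<Sum>k\<in>K. \<Sum>l\<in>K. \<Sum>k'\<in>K. \<Sum>l'\<in>K. A k l * A k' l' * (G F k k' * G F l l'))"
    unfolding sum.cartesian_product' by simp
  finally show ?thesis .
qed

text \<open>With U the matrix of the rows u k, b is \<open>U\<^sup>T U\<close> and G is
  \<open>U U\<^sup>T\<close>. They have the same nonzero eigenvalues, so the traces of their squares
  and fourth powers agree. This moves the estimates from noise indices to block indices.\<close>

lemma Gram_Frobenius: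
  fixes u :: "'k \<Rightarrow> 't \<Rightarrow> real"
  assumes K: "finite K"
  defines "G \<equiv> \<lambda>F k l. \<Sum>t\<in>F. u k t * u l t"
  defines "b \<equiv> \<lambda>s t. \<Sum>k\<in>K. u k s * u k t"
  shows "(\<Sum>s\<in>F. \<Sum>t\<in>F. (b s t)\<^sup>2) = (\<Sum>k\<in>K. \<Sum>l\<in>K. (G F k l)\<^sup>2)"
    and "(\<Sum>s\<in>F. \<Sum>t\<in>F. (\<Sum>r\<in>F. b s r * b r t)\<^sup>2) = (\<Sum>k\<in>K. \<Sum>l\<in>K. (\<Sum>m\<in>K. G F k m * G F m l)\<^sup>2)"
proof -
  have Gs: "G F k l = G F l k" for k l unfolding G_def by (simp add: mult.commute)
  \<comment> \<open>The congruence formula with A the identity matrix.\<close>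
  have "b s t = (\<Sum>k\<in>K. \<Sum>l\<in>K. (if l = k then 1 else 0) * (u k s * u l t))" for s t
    unfolding b_def using K by (intro sum.cong refl) (simp add: if_distrib[of "\<lambda>x. x * _"] cong: if_cong)
  then have "(\<Sum>s\<in>F. \<Sum>t\<in>F. (b s t)\<^sup>2) = (\<Sum>k\<in>K. \<Sum>l\<in>K. \<Sum>k'\<in>K. \<Sum>l'\<in>K. (if l = k then 1 else 0) * (if l' = k' then 1 else 0) * (G F k k' * G F l l'))"
    unfolding G_def by (simp only: congruence_Frobenius)
  also have "\<dots> = (\<Sum>k\<in>K. \<Sum>k'\<in>K. (G F k k')\<^sup>2)"
  proof (rule sum.cong[OF refl])
    fix k assume k: "k \<in> K"
    have "(\<Sum>l\<in>K. \<Sum>k'\<in>K. \<Sum>l'\<in>K. (if l = k then 1 else 0) * (if l' = k' then 1 else 0) * (G F k k' * G F l l'))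
      = (\<Sum>l\<in>K. if l = k then \<Sum>k'\<in>K. \<Sum>l'\<in>K. (if l' = k' then 1 else 0) * (G F k k' * G F k l') else 0)"
      by (intro sum.cong refl) auto
    also have "\<dots> = (\<Sum>k'\<in>K. \<Sum>l'\<in>K. (if l' = k' then 1 else 0) * (G F k k' * G F k l'))"
      using K k by (simp only: sum.delta) simp
    also have "\<dots> = (\<Sum>k'\<in>K. \<Sum>l'\<in>K. if l' = k' then G F k k' * G F k k' else 0)"
      by (intro sum.cong refl) auto
    also have "\<dots> = (\<Sum>k'\<in>K. (G F k k')\<^sup>2)" using K by (intro sum.cong refl) (simp add: power2_eq_square)
    finally show "(\<Sum>l\<in>K. \<Sum>k'\<in>K. \<Sum>l'\<in>K. (if l = k then 1 else 0) * (if l' = k' then 1 else 0) * (G F k k' * G F l l')) = (\<Sum>k'\<in>K. (G F k k')\<^sup>2)" .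
  qed
  finally show "(\<Sum>s\<in>F. \<Sum>t\<in>F. (b s t)\<^sup>2) = (\<Sum>k\<in>K. \<Sum>l\<in>K. (G F k l)\<^sup>2)" .
  \<comment> \<open>The square of b is \<open>U\<^sup>T G U\<close>, so the same formula now applies
    with A = G.\<close>
  have b2: "(\<Sum>r\<in>F. b s r * b r t) = (\<Sum>k\<in>K. \<Sum>l\<in>K. G F k l * (u k s * u l t))" for s t
  proof -
    have "(\<Sum>r\<in>F. b s r * b r t) = (\<Sum>r\<in>F. \<Sum>k\<in>K. \<Sum>l\<in>K. (u k r * u l r) * (u k s * u l t))"
      unfolding b_def sum_product by (intro sum.cong refl) (simp add: mult_ac)
    also have "\<dots> = (\<Sum>k\<in>K. \<Sum>r\<in>F. \<Sum>l\<in>K. (u k r * u l r) * (u k s * u l t))" by (rule sum.swap)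
    also have "\<dots> = (\<Sum>k\<in>K. \<Sum>l\<in>K. \<Sum>r\<in>F. (u k r * u l r) * (u k s * u l t))" by (intro sum.cong refl sum.swap)
    finally show ?thesis unfolding G_def sum_distrib_right .
  qed
  have "(\<Sum>s\<in>F. \<Sum>t\<in>F. (\<Sum>r\<in>F. b s r * b r t)\<^sup>2) = (\<Sum>k\<in>K. \<Sum>l\<in>K. \<Sum>k'\<in>K. \<Sum>l'\<in>K. G F k l * G F k' l' * (G F k k' * G F l l'))"
    unfolding b2 unfolding G_def by (rule congruence_Frobenius)
  also have "\<dots> = (\<Sum>k\<in>K. \<Sum>k'\<in>K. \<Sum>l\<in>K. \<Sum>l'\<in>K. G F k l * G F k' l' * (G F k k' * G F l l'))"
    by (intro sum.cong refl sum.swap)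
  also have "\<dots> = (\<Sum>k'\<in>K. \<Sum>k\<in>K. \<Sum>l\<in>K. \<Sum>l'\<in>K. G F k l * G F k' l' * (G F k k' * G F l l'))" by (rule sum.swap)
  also have "\<dots> = (\<Sum>k'\<in>K. \<Sum>l\<in>K. \<Sum>k\<in>K. \<Sum>l'\<in>K. G F k l * G F k' l' * (G F k k' * G F l l'))"
    by (intro sum.cong refl sum.swap)
  also have "\<dots> = (\<Sum>k'\<in>K. \<Sum>l\<in>K. (\<Sum>m\<in>K. G F k' m * G F m l)\<^sup>2)"
  proof (intro sum.cong refl)
    fix k' l
    have "(\<Sum>m\<in>K. G F k' m * G F m l)\<^sup>2 = (\<Sum>k\<in>K. \<Sum>l'\<in>K. (G F k' k * G F k l) * (G F k' l' * G F l' l))"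
      unfolding power2_eq_square sum_product ..
    also have "\<dots> = (\<Sum>k\<in>K. \<Sum>l'\<in>K. G F k l * G F k' l' * (G F k k' * G F l l'))"
      by (intro sum.cong refl) (simp add: Gs[of k'] Gs[of l] mult_ac)
    finally show "(\<Sum>k\<in>K. \<Sum>l'\<in>K. G F k l * G F k' l' * (G F k k' * G F l l')) = (\<Sum>m\<in>K. G F k' m * G F m l)\<^sup>2" ..
  qed
  finally show "(\<Sum>s\<in>F. \<Sum>t\<in>F. (\<Sum>r\<in>F. b s r * b r t)\<^sup>2) = (\<Sum>k\<in>K. \<Sum>l\<in>K. (\<Sum>m\<in>K. G F k m * G F m l)\<^sup>2)" .
qed

text \<open>The square of G is that of f0 times the identity, plus 2 f0 E, plus the square of E,
  whose Frobenius norm is at most e by Cauchy-Schwarz; the 3 comes from squaring a sum of three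
  terms. Divided by the square of \<open>card K\<close>, the first bound vanishes when
  \<open>card K\<close> grows and e / \<open>card K\<close> tends to zero.\<close>

lemma near_scalar_Frobenius:
  fixes G E :: "'k \<Rightarrow> 'k \<Rightarrow> real"
  assumes K: "finite K" and G: "\<And>k l. G k l = (if k = l then f0 else 0) + E k l"
  defines "e \<equiv> \<Sum>k\<in>K. \<Sum>l\<in>K. (E k l)\<^sup>2"
  shows "(\<Sum>k\<in>K. \<Sum>l\<in>K. (\<Sum>m\<in>K. G k m * G m l)\<^sup>2) \<le> 3 * (f0^4 * card K + 4 * f0\<^sup>2 * e + e\<^sup>2)"
    and "(\<Sum>k\<in>K. \<Sum>l\<in>K. (G k l)\<^sup>2) = f0\<^sup>2 * card K + 2 * f0 * (\<Sum>k\<in>K. E k k) + e"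
proof -
  have GG: "(\<Sum>m\<in>K. G k m * G m l) = (if k = l then f0\<^sup>2 else 0) + 2 * f0 * E k l + (\<Sum>m\<in>K. E k m * E m l)" if "k \<in> K" "l \<in> K" for k l
  proof -
    have "(\<Sum>m\<in>K. G k m * G m l) = (\<Sum>m\<in>K. (if k = m then f0 * (if k = l then f0 else 0) + f0 * E k l else 0) + (if m = l then f0 * E k l else 0) + E k m * E m l)"
      unfolding G by (intro sum.cong refl) (auto simp: algebra_simps)
    also have "\<dots> = (if k = l then f0\<^sup>2 else 0) + 2 * f0 * E k l + (\<Sum>m\<in>K. E k m * E m l)"
      using K that by (simp add: sum.distrib power2_eq_square)
    finally show ?thesis .
  qed
  have sq3: "(x + y + z)\<^sup>2 \<le> 3 * (x\<^sup>2 + y\<^sup>2 + z\<^sup>2)" for x y z :: real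
    using sum_squares_bound[of x y] sum_squares_bound[of x z] sum_squares_bound[of y z]
    by (simp add: power2_eq_square algebra_simps)
  have "(\<Sum>k\<in>K. \<Sum>l\<in>K. (\<Sum>m\<in>K. G k m * G m l)\<^sup>2)
    \<le> (\<Sum>k\<in>K. \<Sum>l\<in>K. 3 * ((if k = l then f0^4 else 0) + 4 * f0\<^sup>2 * (E k l)\<^sup>2 + (\<Sum>m\<in>K. (E k m)\<^sup>2) * (\<Sum>m\<in>K. (E m l)\<^sup>2)))"
  proof (intro sum_mono)
    fix k l assume kl: "k \<in> K" "l \<in> K"
    have "(\<Sum>m\<in>K. G k m * G m l)\<^sup>2 \<le> 3 * ((if k = l then f0\<^sup>2 else 0)\<^sup>2 + (2 * f0 * E k l)\<^sup>2 + (\<Sum>m\<in>K. E k m * E m l)\<^sup>2)"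
      unfolding GG[OF kl] by (rule sq3)
    also have "\<dots> \<le> 3 * ((if k = l then f0^4 else 0) + 4 * f0\<^sup>2 * (E k l)\<^sup>2 + (\<Sum>m\<in>K. (E k m)\<^sup>2) * (\<Sum>m\<in>K. (E m l)\<^sup>2))"
      using Cauchy_Schwarz_ineq_sum[of "E k" "\<lambda>m. E m l" K] by (auto simp: power_mult_distrib)
    finally show "(\<Sum>m\<in>K. G k m * G m l)\<^sup>2 \<le> 3 * ((if k = l then f0^4 else 0) + 4 * f0\<^sup>2 * (E k l)\<^sup>2 + (\<Sum>m\<in>K. (E k m)\<^sup>2) * (\<Sum>m\<in>K. (E m l)\<^sup>2))" .
  qed
  also have "\<dots> = 3 * (f0^4 * card K + 4 * f0\<^sup>2 * e + e\<^sup>2)"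
  proof -
    have "(\<Sum>k\<in>K. \<Sum>l\<in>K. (\<Sum>m\<in>K. (E k m)\<^sup>2) * (\<Sum>m\<in>K. (E m l)\<^sup>2)) = e * (\<Sum>l\<in>K. \<Sum>m\<in>K. (E m l)\<^sup>2)"
      unfolding e_def by (rule sum_product[symmetric])
    also have "(\<Sum>l\<in>K. \<Sum>m\<in>K. (E m l)\<^sup>2) = e" unfolding e_def by (rule sum.swap)
    finally have "(\<Sum>k\<in>K. \<Sum>l\<in>K. (\<Sum>m\<in>K. (E k m)\<^sup>2) * (\<Sum>m\<in>K. (E m l)\<^sup>2)) = e\<^sup>2" by (simp add: power2_eq_square)
    moreover have "(\<Sum>k\<in>K. \<Sum>l\<in>K. if k = l then f0^4 else 0) = f0^4 * card K" using K by simp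
    ultimately show ?thesis by (simp add: sum.distrib sum_distrib_left[symmetric] e_def)
  qed
  finally show "(\<Sum>k\<in>K. \<Sum>l\<in>K. (\<Sum>m\<in>K. G k m * G m l)\<^sup>2) \<le> 3 * (f0^4 * card K + 4 * f0\<^sup>2 * e + e\<^sup>2)" .
  have "(\<Sum>k\<in>K. \<Sum>l\<in>K. (G k l)\<^sup>2) = (\<Sum>k\<in>K. \<Sum>l\<in>K. (if k = l then f0\<^sup>2 + 2 * f0 * E k k else 0) + (E k l)\<^sup>2)"
    unfolding G by (intro sum.cong refl) (auto simp: power2_sum)
  also have "\<dots> = f0\<^sup>2 * card K + 2 * f0 * (\<Sum>k\<in>K. E k k) + e"
    using K by (simp add: sum.distrib e_def sum_distrib_left)
  finally show "(\<Sum>k\<in>K. \<Sum>l\<in>K. (G k l)\<^sup>2) = f0\<^sup>2 * card K + 2 * f0 * (\<Sum>k\<in>K. E k k) + e" .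
qed

section \<open>The estimator as a limit of finite quadratic forms\<close>

locale decimated_iid = decimated M \<xi> X a a_star W \<beta> C Kf \<delta> + iid_noise M \<xi> \<kappa>
  for M :: "'a measure" and \<xi> X :: "int \<Rightarrow> 'a \<Rightarrow> real" and a :: "int \<Rightarrow> real" and a_star :: "real \<Rightarrow> complex"
    and W :: "real \<Rightarrow> real" and \<beta> C Kf \<delta> \<kappa> :: real
begin

lemma v_cov: "((\<lambda>t. v g (m - t) * v g (m' - t)) has_sum S g (m - m')) UNIV"
  using l2_series_cov[OF l2_series_Y[of g m] l2_series_Y[of g m']] by (simp add: Y_cov)

lemma v_sq_sum_le:
  assumes "finite H" shows "(\<Sum>m\<in>H. (v g m)\<^sup>2) \<le> S g 0"
proof -
  have "(\<Sum>m\<in>H. (v g m)\<^sup>2) = (\<Sum>t\<in>uminus ` H. v g (0 - t) * v g (0 - t))"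
    by (subst sum.reindex) (auto simp: power2_eq_square)
  also have "\<dots> \<le> S g (0 - 0)" by (rule finite_sum_le_has_sum[OF v_cov]) (use assms in auto)
  finally show ?thesis by simp
qed

lemma v_diff_sum_le:
  assumes "finite H" shows "(\<Sum>m\<in>H. (v g (m + 1) - v g m)\<^sup>2) \<le> 2 * (S g 0 - S g 1)"
proof -
  have s1: "S g (-1) = S g 1" by (simp add: S_def)
  have "((\<lambda>t. v g (1 - t) * v g (1 - t) + (v g (0 - t) * v g (0 - t) + (- 1) * (v g (1 - t) * v g (0 - t) + v g (0 - t) * v g (1 - t)))) has_sum
     (S g (1 - 1) + (S g (0 - 0) + (- 1) * (S g (1 - 0) + S g (0 - 1))))) UNIV"
    by (intro has_sum_add has_sum_cmult_right v_cov)
  then have h: "((\<lambda>t. (v g (1 - t) - v g (- t))\<^sup>2) has_sum 2 * (S g 0 - S g 1)) UNIV"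
    by (simp add: power2_eq_square algebra_simps s1)
  have "(\<Sum>m\<in>H. (v g (m + 1) - v g m)\<^sup>2) = (\<Sum>t\<in>uminus ` H. (v g (1 - t) - v g (- t))\<^sup>2)"
    by (subst sum.reindex) (auto simp: add.commute)
  also have "\<dots> \<le> 2 * (S g 0 - S g 1)" by (rule finite_sum_le_has_sum[OF h]) (use assms in auto)
  finally show ?thesis .
qed

text \<open>The block-start bound with E = \<open>S g 0\<close>, the energy of the coefficients, and
  D = \<open>2 * (S g 0 - S g 1)\<close>, that of their increments. It is uniform in the number of
  blocks and in the noise index.\<close>

definition "diag_bound g = S g 0 / g + 2 * sqrt (2 * (S g 0 - S g 1) * S g 0)"

lemma v_decimated_sum_le:
  assumes "g > 0"
  shows "(\<Sum>k<N. (v g (int (k * g) - t))\<^sup>2) \<le> diag_bound g"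
  using block_start_sum_le[OF assms, of "v g" "S g 0" "2 * (S g 0 - S g 1)" "- t" N] v_sq_sum_le v_diff_sum_le
  unfolding diag_bound_def by auto

lemma S0_nonneg: "S g 0 \<ge> 0" using v_sq_sum_le[of "{}" g] by simp

definition "V g k t = v g (int (k * g) - t)"

text \<open>The rows \<open>V g k\<close> are the coefficients of the decimated series, and \<open>bmat\<close> is the matrix of the
  quadratic form \<open>\<rho> * (\<Sum>k<N. (Y g (k * g))\<^sup>2)\<close> in the noise variables.\<close>

definition "bmat \<rho> g N s t = \<rho> * (\<Sum>k<N. V g k s * V g k t)"
definition "Gam g k l = S g (int g * (int k - int l))"

lemma V_cov: "((\<lambda>t. V g k t * V g l t) has_sum Gam g k l) UNIV"
  using v_cov[of g "int (k * g)" "int (l * g)"] by (simp add: V_def Gam_def algebra_simps)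

lemma qf_bmat:
  "qf (bmat \<rho> g N) F x = \<rho> * (\<Sum>k<N. (lin (V g k) F x)\<^sup>2)"
proof -
  have "qf (bmat \<rho> g N) F x = (\<Sum>s\<in>F. \<Sum>t\<in>F. \<Sum>k<N. \<rho> * ((V g k s * x s) * (V g k t * x t)))"
    unfolding qf_def bmat_def sum_distrib_left sum_distrib_right by (simp add: mult_ac)
  also have "\<dots> = (\<Sum>k<N. \<Sum>s\<in>F. \<Sum>t\<in>F. \<rho> * ((V g k s * x s) * (V g k t * x t)))"
  proof -
    have "(\<Sum>s\<in>F. \<Sum>t\<in>F. \<Sum>k<N. \<rho> * ((V g k s * x s) * (V g k t * x t))) = (\<Sum>s\<in>F. \<Sum>k<N. \<Sum>t\<in>F. \<rho> * ((V g k s * x s) * (V g k t * x t)))"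
      by (intro sum.cong refl sum.swap)
    also have "\<dots> = (\<Sum>k<N. \<Sum>s\<in>F. \<Sum>t\<in>F. \<rho> * ((V g k s * x s) * (V g k t * x t)))" by (rule sum.swap)
    finally show ?thesis .
  qed
  also have "\<dots> = \<rho> * (\<Sum>k<N. (lin (V g k) F x)\<^sup>2)"
    by (simp only: lin_def power2_eq_square sum_product) (simp only: sum_distrib_left)
  finally show ?thesis .
qed

lemma sum_bmat_diag: "(\<Sum>s\<in>F. bmat \<rho> g N s s) = \<rho> * (\<Sum>k<N. \<Sum>s\<in>F. V g k s * V g k s)"
  unfolding bmat_def sum_distrib_left by (rule sum.swap)

text \<open>The squares differ by a multiple of the truncation error, so Cauchy-Schwarz turns
  mean-square convergence of the series into convergence of the squares in mean.\<close>

lemma truncation_tendsto: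
  "((\<lambda>F. expectation (\<lambda>\<omega>. \<bar>(Y g m \<omega>)\<^sup>2 - (lin (\<lambda>t. v g (m - t)) F (\<lambda>s. \<xi> s \<omega>))\<^sup>2\<bar>)) \<longlongrightarrow> 0) (finite_subsets_at_top UNIV)"
proof (rule tendsto_sandwich[OF _ _ tendsto_const])
  let ?L = "\<lambda>F \<omega>. lin (\<lambda>t. v g (m - t)) F (\<lambda>s. \<xi> s \<omega>)"
  let ?d = "\<lambda>F \<omega>. Y g m \<omega> - ?L F \<omega>"
  have sd: "square_integrable M (?d F)" for F by (intro square_integrable_diff square_integrable_Y square_integrable_lin)
  have lim: "((\<lambda>F. expectation (\<lambda>\<omega>. (?d F \<omega>)\<^sup>2)) \<longlongrightarrow> 0) (finite_subsets_at_top UNIV)"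
    using l2_series_Y[of g m] by (simp add: l2_series_def)
  show "\<forall>\<^sub>F F in finite_subsets_at_top UNIV. expectation (\<lambda>\<omega>. \<bar>(Y g m \<omega>)\<^sup>2 - (?L F \<omega>)\<^sup>2\<bar>)
     \<le> expectation (\<lambda>\<omega>. (?d F \<omega>)\<^sup>2) + 2 * (sqrt (expectation (\<lambda>\<omega>. (Y g m \<omega>)\<^sup>2)) * sqrt (expectation (\<lambda>\<omega>. (?d F \<omega>)\<^sup>2)))"
  proof (rule always_eventually, rule allI)
    fix F
    have i: "integrable M (\<lambda>\<omega>. (?d F \<omega>)\<^sup>2 + 2 * \<bar>Y g m \<omega> * ?d F \<omega>\<bar>)"
      by (intro Bochner_Integration.integrable_add square_integrable_power2 sd integrable_mult_right integrable_abs square_integrable_mult_integrable square_integrable_Y)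
    have "expectation (\<lambda>\<omega>. \<bar>(Y g m \<omega>)\<^sup>2 - (?L F \<omega>)\<^sup>2\<bar>) \<le> expectation (\<lambda>\<omega>. (?d F \<omega>)\<^sup>2 + 2 * \<bar>Y g m \<omega> * ?d F \<omega>\<bar>)"
    proof (rule integral_mono[OF _ i])
      show "integrable M (\<lambda>\<omega>. \<bar>(Y g m \<omega>)\<^sup>2 - (?L F \<omega>)\<^sup>2\<bar>)"
        by (intro integrable_abs Bochner_Integration.integrable_diff square_integrable_power2 square_integrable_Y square_integrable_lin)
      fix \<omega>
      have "(Y g m \<omega>)\<^sup>2 - (?L F \<omega>)\<^sup>2 = 2 * (Y g m \<omega> * ?d F \<omega>) - (?d F \<omega>)\<^sup>2" by (simp add: power2_eq_square algebra_simps)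
      then show "\<bar>(Y g m \<omega>)\<^sup>2 - (?L F \<omega>)\<^sup>2\<bar> \<le> (?d F \<omega>)\<^sup>2 + 2 * \<bar>Y g m \<omega> * ?d F \<omega>\<bar>"
        using abs_triangle_ineq4[of "2 * (Y g m \<omega> * ?d F \<omega>)" "(?d F \<omega>)\<^sup>2"] by (simp add: abs_mult)
    qed
    also have "\<dots> = expectation (\<lambda>\<omega>. (?d F \<omega>)\<^sup>2) + 2 * expectation (\<lambda>\<omega>. \<bar>Y g m \<omega> * ?d F \<omega>\<bar>)"
      using square_integrable_power2[OF sd] integrable_abs[OF square_integrable_mult_integrable[OF square_integrable_Y sd]]
      by (simp only: Bochner_Integration.integral_add integrable_mult_right integral_mult_right_zero)
    also have "\<dots> \<le> expectation (\<lambda>\<omega>. (?d F \<omega>)\<^sup>2) + 2 * (sqrt (expectation (\<lambda>\<omega>. (Y g m \<omega>)\<^sup>2)) * sqrt (expectation (\<lambda>\<omega>. (?d F \<omega>)\<^sup>2)))"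
      using square_integrable_Cauchy_Schwarz[OF square_integrable_Y sd] by simp
    finally show "expectation (\<lambda>\<omega>. \<bar>(Y g m \<omega>)\<^sup>2 - (?L F \<omega>)\<^sup>2\<bar>)
     \<le> expectation (\<lambda>\<omega>. (?d F \<omega>)\<^sup>2) + 2 * (sqrt (expectation (\<lambda>\<omega>. (Y g m \<omega>)\<^sup>2)) * sqrt (expectation (\<lambda>\<omega>. (?d F \<omega>)\<^sup>2)))" .
  qed
  show "((\<lambda>F. expectation (\<lambda>\<omega>. (?d F \<omega>)\<^sup>2) + 2 * (sqrt (expectation (\<lambda>\<omega>. (Y g m \<omega>)\<^sup>2)) * sqrt (expectation (\<lambda>\<omega>. (?d F \<omega>)\<^sup>2)))) \<longlongrightarrow> 0) (finite_subsets_at_top UNIV)"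
    using tendsto_add[OF lim tendsto_mult[OF tendsto_const[of 2] tendsto_mult[OF tendsto_const tendsto_real_sqrt[OF lim]]]] by simp
qed auto

text \<open>With N blocks and \<rho> = sqrt (n / g) / N this is the centered and scaled
  estimator.\<close>

definition T :: "real \<Rightarrow> nat \<Rightarrow> nat \<Rightarrow> 'a \<Rightarrow> real" where
  "T \<rho> g N \<omega> = \<rho> * ((\<Sum>k<N. (Y g (int (k * g)) \<omega>)\<^sup>2) - real N * S g 0)"

definition "char_bound \<eta> \<theta> K = \<bar>\<theta>\<bar> * (sqrt (\<kappa> + 1) * \<eta>)
  + \<eta> * sqrt (3 + 15 * K) * (3 * \<theta>\<^sup>2 * \<kappa> * (K + 3 * \<kappa>) + 2 * \<bar>\<theta>\<bar> * sqrt (\<kappa> + 1)) * \<bar>\<theta>\<bar> * exp (\<theta>\<^sup>2 * K) + \<theta>\<^sup>2 * \<eta>\<^sup>2"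

lemma integrable_T: "integrable M (T \<rho> g N)"
  unfolding T_def[abs_def]
  by (intro integrable_mult_right Bochner_Integration.integrable_diff Bochner_Integration.integrable_sum square_integrable_power2 square_integrable_Y) auto

text \<open>The finite estimate is applied to the noise in a finite set F, and then F exhausts the
  integers. The hypotheses on the trace and on K are strict so that they persist for all large F;
  the diagonal hypothesis passes to every finite F because partial sums of squares are dominated by
  full ones.\<close>

lemma T_char_approx:
  assumes g: "g > 0" and \<eta>: "\<eta> > 0"
    and T4: "\<rho>^4 * (\<Sum>k<N. \<Sum>l<N. (\<Sum>m<N. Gam g k m * Gam g m l)\<^sup>2) < \<eta>\<^sup>2"
    and D: "\<rho>\<^sup>2 * (diag_bound g * (real N * S g 0)) \<le> \<eta>\<^sup>2"
    and K: "\<rho>\<^sup>2 * (\<Sum>k<N. \<Sum>l<N. (Gam g k l)\<^sup>2) < K"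
  shows "cmod ((CLINT \<omega>|M. iexp (\<theta> * T \<rho> g N \<omega>)) - exp (- (\<theta>\<^sup>2 * (\<rho>\<^sup>2 * (\<Sum>k<N. \<Sum>l<N. (Gam g k l)\<^sup>2)))))
    \<le> char_bound \<eta> \<theta> K"
proof -
  let ?A = "finite_subsets_at_top (UNIV :: int set)"
  define G where "G F k l = (\<Sum>t\<in>F. V g k t * V g l t)" for F k l
  have G_lim: "((\<lambda>F. G F k l) \<longlongrightarrow> Gam g k l) ?A" for k l
    using V_cov[of g k l] unfolding has_sum_def G_def[abs_def] .
  let ?b = "bmat \<rho> g N"
  define sF where "sF F = (\<Sum>s\<in>F. \<Sum>t\<in>F. (?b s t)\<^sup>2)" for F
  define TF where "TF F \<omega> = qf ?b F (\<lambda>s. \<xi> s \<omega>) - (\<Sum>s\<in>F. ?b s s)" for F \<omega>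
  have sF: "sF F = \<rho>\<^sup>2 * (\<Sum>k<N. \<Sum>l<N. (G F k l)\<^sup>2)" for F
    unfolding sF_def bmat_def G_def power_mult_distrib sum_distrib_left[symmetric]
    by (subst Gram_Frobenius(1)) auto
  have tF: "(\<Sum>s\<in>F. \<Sum>t\<in>F. (\<Sum>r\<in>F. ?b s r * ?b r t)\<^sup>2) = \<rho>^4 * (\<Sum>k<N. \<Sum>l<N. (\<Sum>m<N. G F k m * G F m l)\<^sup>2)" for F
  proof -
    define R where "R s t = (\<Sum>r\<in>F. (\<Sum>k<N. V g k s * V g k r) * (\<Sum>k<N. V g k r * V g k t))" for s t
    have "(\<Sum>r\<in>F. ?b s r * ?b r t) = \<rho>\<^sup>2 * R s t" for s t
      unfolding bmat_def R_def sum_distrib_left[of "\<rho>\<^sup>2"] by (intro sum.cong refl) (simp add: power2_eq_square)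
    then have "(\<Sum>s\<in>F. \<Sum>t\<in>F. (\<Sum>r\<in>F. ?b s r * ?b r t)\<^sup>2) = \<rho>^4 * (\<Sum>s\<in>F. \<Sum>t\<in>F. (R s t)\<^sup>2)"
      by (simp add: power_mult_distrib sum_distrib_left)
    then show ?thesis unfolding G_def R_def by (subst (asm) Gram_Frobenius(2)) auto
  qed
  \<comment> \<open>One factor of each squared diagonal entry is bounded uniformly by
    \<open>diag_bound g\<close>; the other, summed over the noise indices, gives at most
    \<open>S g 0\<close> per block.\<close>
  have dF: "(\<Sum>s\<in>F. (?b s s)\<^sup>2) \<le> \<eta>\<^sup>2" if F: "finite F" for F
  proof -
    have db: "(\<Sum>k<N. (V g k s)\<^sup>2) \<le> diag_bound g" for s unfolding V_def by (rule v_decimated_sum_le[OF g])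
    have db0: "diag_bound g \<ge> 0" using order_trans[OF sum_nonneg db] by auto
    have "(\<Sum>s\<in>F. (?b s s)\<^sup>2) = \<rho>\<^sup>2 * (\<Sum>s\<in>F. (\<Sum>k<N. (V g k s)\<^sup>2) * (\<Sum>k<N. (V g k s)\<^sup>2))"
    proof -
      define A where "A s = (\<Sum>k<N. (V g k s)\<^sup>2)" for s
      have "?b s s = \<rho> * A s" for s by (simp add: bmat_def A_def power2_eq_square)
      then have "(\<Sum>s\<in>F. (?b s s)\<^sup>2) = \<rho>\<^sup>2 * (\<Sum>s\<in>F. A s * A s)"
        by (simp add: power_mult_distrib sum_distrib_left power2_eq_square[of "A _"])
      then show ?thesis unfolding A_def .
    qed
    also have "\<dots> \<le> \<rho>\<^sup>2 * (\<Sum>s\<in>F. diag_bound g * (\<Sum>k<N. (V g k s)\<^sup>2))"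
      by (intro mult_left_mono sum_mono mult_right_mono db sum_nonneg) auto
    also have "\<dots> = \<rho>\<^sup>2 * (diag_bound g * (\<Sum>k<N. \<Sum>s\<in>F. (V g k s)\<^sup>2))"
      unfolding sum_distrib_left[symmetric] by (subst sum.swap) simp
    also have "\<dots> \<le> \<rho>\<^sup>2 * (diag_bound g * (\<Sum>k<N. S g 0))"
    proof (intro mult_left_mono sum_mono db0)
      fix k
      show "(\<Sum>s\<in>F. (V g k s)\<^sup>2) \<le> S g 0"
        using finite_sum_le_has_sum[OF V_cov[of g k k] F] by (auto simp: power2_eq_square Gam_def)
    qed auto
    also have "\<dots> \<le> \<eta>\<^sup>2" using D by simp
    finally show ?thesis .
  qed
  have lim_T4: "((\<lambda>F. \<rho>^4 * (\<Sum>k<N. \<Sum>l<N. (\<Sum>m<N. G F k m * G F m l)\<^sup>2)) \<longlongrightarrow> \<rho>^4 * (\<Sum>k<N. \<Sum>l<N. (\<Sum>m<N. Gam g k m * Gam g m l)\<^sup>2)) ?A"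
    by (intro tendsto_intros G_lim)
  have lim_s: "(sF \<longlongrightarrow> \<rho>\<^sup>2 * (\<Sum>k<N. \<Sum>l<N. (Gam g k l)\<^sup>2)) ?A"
    unfolding sF[abs_def] by (intro tendsto_intros G_lim)
  have fin: "\<forall>\<^sub>F F in ?A. finite F" by (rule eventually_finite_subsets_at_top_weakI)
  have ev: "\<forall>\<^sub>F F in ?A. cmod ((CLINT \<omega>|M. iexp (\<theta> * TF F \<omega>)) - exp (- (\<theta>\<^sup>2 * sF F))) \<le> char_bound \<eta> \<theta> K"
    using order_tendstoD(2)[OF lim_T4 T4] order_tendstoD(2)[OF lim_s K] fin
  proof eventually_elim
    case (elim F)
    have bs: "?b s r = ?b r s" for s r by (simp add: bmat_def mult.commute)
    show ?case
      unfolding TF_def sF_def char_bound_def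
    proof (rule centered_qf_char_approx[OF _ bs \<eta>])
      show "(\<Sum>s\<in>F. \<Sum>t\<in>F. (\<Sum>r\<in>F. ?b s r * ?b r t)\<^sup>2) \<le> \<eta>\<^sup>2" unfolding tF using elim(1) by simp
      show "(\<Sum>s\<in>F. (?b s s)\<^sup>2) \<le> \<eta>\<^sup>2" by (rule dF) (use elim in auto)
      show "(\<Sum>s\<in>F. \<Sum>t\<in>F. (?b s t)\<^sup>2) \<le> K" using elim(2) by (simp add: sF_def)
    qed (use elim in auto)
  qed
  have lim_char: "((\<lambda>F. CLINT \<omega>|M. iexp (\<theta> * TF F \<omega>)) \<longlongrightarrow> (CLINT \<omega>|M. iexp (\<theta> * T \<rho> g N \<omega>))) ?A"
  proof (rule Lim_null[THEN iffD2], rule Lim_null_comparison)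
    have iTF: "integrable M (TF F)" for F
      unfolding TF_def[abs_def] by (intro square_integrable_integrable square_integrable_diff square_integrable_qf square_integrable_const)
    let ?L = "\<lambda>k F \<omega>. lin (V g k) F (\<lambda>s. \<xi> s \<omega>)"
    let ?e = "\<lambda>k F. expectation (\<lambda>\<omega>. \<bar>(Y g (int (k * g)) \<omega>)\<^sup>2 - (?L k F \<omega>)\<^sup>2\<bar>)"
    let ?c = "\<lambda>k F. \<bar>S g 0 - (\<Sum>s\<in>F. V g k s * V g k s)\<bar>"
    show "\<forall>\<^sub>F F in ?A. cmod ((CLINT \<omega>|M. iexp (\<theta> * TF F \<omega>)) - (CLINT \<omega>|M. iexp (\<theta> * T \<rho> g N \<omega>)))
       \<le> \<bar>\<theta>\<bar> * (\<bar>\<rho>\<bar> * (\<Sum>k<N. ?e k F + ?c k F))"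
    proof (rule always_eventually, rule allI)
      fix F
      have ie: "integrable M (\<lambda>\<omega>. \<bar>(Y g (int (k * g)) \<omega>)\<^sup>2 - (?L k F \<omega>)\<^sup>2\<bar> + ?c k F)" for k
        by (intro Bochner_Integration.integrable_add integrable_abs Bochner_Integration.integrable_diff square_integrable_power2 square_integrable_Y square_integrable_lin) auto
      have pt: "\<bar>TF F \<omega> - T \<rho> g N \<omega>\<bar> \<le> \<bar>\<rho>\<bar> * (\<Sum>k<N. \<bar>(Y g (int (k * g)) \<omega>)\<^sup>2 - (?L k F \<omega>)\<^sup>2\<bar> + ?c k F)" for \<omega>
      proof -
        have e: "T \<rho> g N \<omega> - TF F \<omega> = \<rho> * (\<Sum>k<N. ((Y g (int (k * g)) \<omega>)\<^sup>2 - (?L k F \<omega>)\<^sup>2) - (S g 0 - (\<Sum>s\<in>F. V g k s * V g k s)))"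
          unfolding T_def TF_def qf_bmat sum_bmat_diag by (simp add: sum_subtractf right_diff_distrib)
        have "\<bar>T \<rho> g N \<omega> - TF F \<omega>\<bar> \<le> \<bar>\<rho>\<bar> * (\<Sum>k<N. \<bar>(Y g (int (k * g)) \<omega>)\<^sup>2 - (?L k F \<omega>)\<^sup>2\<bar> + ?c k F)"
          unfolding e abs_mult
          by (intro mult_left_mono order_trans[OF sum_abs] sum_mono abs_triangle_ineq4) auto
        then show ?thesis by (simp only: abs_minus_commute)
      qed
      have "cmod ((CLINT \<omega>|M. iexp (\<theta> * TF F \<omega>)) - (CLINT \<omega>|M. iexp (\<theta> * T \<rho> g N \<omega>))) \<le> \<bar>\<theta>\<bar> * expectation (\<lambda>\<omega>. \<bar>TF F \<omega> - T \<rho> g N \<omega>\<bar>)"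
        by (intro char_diff_le iTF integrable_T)
      also have "\<dots> \<le> \<bar>\<theta>\<bar> * expectation (\<lambda>\<omega>. \<bar>\<rho>\<bar> * (\<Sum>k<N. \<bar>(Y g (int (k * g)) \<omega>)\<^sup>2 - (?L k F \<omega>)\<^sup>2\<bar> + ?c k F))"
      proof (intro mult_left_mono integral_mono)
        show "integrable M (\<lambda>\<omega>. \<bar>TF F \<omega> - T \<rho> g N \<omega>\<bar>)"
          by (intro integrable_abs Bochner_Integration.integrable_diff iTF integrable_T)
        show "integrable M (\<lambda>\<omega>. \<bar>\<rho>\<bar> * (\<Sum>k<N. \<bar>(Y g (int (k * g)) \<omega>)\<^sup>2 - (?L k F \<omega>)\<^sup>2\<bar> + ?c k F))"
          by (intro integrable_mult_right Bochner_Integration.integrable_sum ie)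
        show "\<bar>TF F \<omega> - T \<rho> g N \<omega>\<bar> \<le> \<bar>\<rho>\<bar> * (\<Sum>k<N. \<bar>(Y g (int (k * g)) \<omega>)\<^sup>2 - (?L k F \<omega>)\<^sup>2\<bar> + ?c k F)" for \<omega>
          by (rule pt)
      qed simp
      also have "expectation (\<lambda>\<omega>. \<bar>\<rho>\<bar> * (\<Sum>k<N. \<bar>(Y g (int (k * g)) \<omega>)\<^sup>2 - (?L k F \<omega>)\<^sup>2\<bar> + ?c k F)) = \<bar>\<rho>\<bar> * (\<Sum>k<N. expectation (\<lambda>\<omega>. \<bar>(Y g (int (k * g)) \<omega>)\<^sup>2 - (?L k F \<omega>)\<^sup>2\<bar> + ?c k F))"
        using ie by (simp only: Bochner_Integration.integral_sum integral_mult_right_zero)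
      also have "(\<Sum>k<N. expectation (\<lambda>\<omega>. \<bar>(Y g (int (k * g)) \<omega>)\<^sup>2 - (?L k F \<omega>)\<^sup>2\<bar> + ?c k F)) = (\<Sum>k<N. ?e k F + ?c k F)"
      proof (intro sum.cong refl)
        fix k
        have "integrable M (\<lambda>\<omega>. \<bar>(Y g (int (k * g)) \<omega>)\<^sup>2 - (?L k F \<omega>)\<^sup>2\<bar>)"
          by (intro integrable_abs Bochner_Integration.integrable_diff square_integrable_power2 square_integrable_Y square_integrable_lin)
        then show "expectation (\<lambda>\<omega>. \<bar>(Y g (int (k * g)) \<omega>)\<^sup>2 - (?L k F \<omega>)\<^sup>2\<bar> + ?c k F) = ?e k F + ?c k F"
          by (subst Bochner_Integration.integral_add) (auto simp: prob_space)
      qed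
      finally show "cmod ((CLINT \<omega>|M. iexp (\<theta> * TF F \<omega>)) - (CLINT \<omega>|M. iexp (\<theta> * T \<rho> g N \<omega>)))
       \<le> \<bar>\<theta>\<bar> * (\<bar>\<rho>\<bar> * (\<Sum>k<N. ?e k F + ?c k F))" .
    qed
    have e0: "(?e k \<longlongrightarrow> 0) ?A" for k using truncation_tendsto[of g "int (k * g)"] unfolding V_def[abs_def] .
    have c0: "(?c k \<longlongrightarrow> 0) ?A" for k
    proof -
      have "((\<lambda>F. \<bar>S g 0 - G F k k\<bar>) \<longlongrightarrow> \<bar>S g 0 - Gam g k k\<bar>) ?A" by (intro tendsto_intros G_lim)
      then show ?thesis by (simp add: Gam_def G_def)
    qed
    have "((\<lambda>F. \<bar>\<theta>\<bar> * (\<bar>\<rho>\<bar> * (\<Sum>k<N. ?e k F + ?c k F))) \<longlongrightarrow> \<bar>\<theta>\<bar> * (\<bar>\<rho>\<bar> * (\<Sum>k<N. 0 + 0))) ?A"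
      by (intro tendsto_mult tendsto_const tendsto_sum tendsto_add e0 c0)
    then show "((\<lambda>F. \<bar>\<theta>\<bar> * (\<bar>\<rho>\<bar> * (\<Sum>k<N. ?e k F + ?c k F))) \<longlongrightarrow> 0) ?A" by simp
  qed
  have "((\<lambda>F. cmod ((CLINT \<omega>|M. iexp (\<theta> * TF F \<omega>)) - exp (- (\<theta>\<^sup>2 * sF F)))) \<longlongrightarrow>
     cmod ((CLINT \<omega>|M. iexp (\<theta> * T \<rho> g N \<omega>)) - exp (- (\<theta>\<^sup>2 * (\<rho>\<^sup>2 * (\<Sum>k<N. \<Sum>l<N. (Gam g k l)\<^sup>2)))))) ?A"
    by (intro tendsto_intros lim_char lim_s)
  then show ?thesis by (rule tendsto_upperbound[OF _ ev]) simp
qed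

end

section \<open>The estimator in terms of block sums\<close>

context decimated
begin

text \<open>The support of W leaves u = k g + j with 0 \<le> j \<le> g, and j = g drops out because
  W vanishes at -1. Each statistic thus reads exactly one block, and the blocks are
  disjoint.\<close>

lemma Z1_eq_Y:
  assumes g: "\<gamma> n > 0"
  shows "Z1 W \<gamma> X n k \<omega> = Y (\<gamma> n) (int (k * \<gamma> n)) \<omega>"
proof -
  define g where "g = \<gamma> n"
  have g0: "real g > 0" using g by (simp add: g_def)
  define U where "U = (\<lambda>j. int (k * g) + int j) ` {..<g}"
  have out: "W (real k - of_int u / real g) = 0" if "u \<notin> U" for u
  proof -
    have "u < int (k * g) \<or> u \<ge> int (k * g) + int g"
    proof (rule ccontr)
      assume "\<not> ?thesis"
      then have "u = int (k * g) + int (nat (u - int (k * g)))" "nat (u - int (k * g)) < g" by auto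
      then show False using that unfolding U_def by blast
    qed
    then show ?thesis
    proof
      assume "u < int (k * g)"
      then have "real_of_int u < of_int (int (k * g))" by (simp only: of_int_less_iff)
      then have "of_int u < real k * real g" by simp
      then have "real k - of_int u / real g > 0" using g0 by (simp add: field_simps)
      then show ?thesis by (intro supp) auto
    next
      assume "u \<ge> int (k * g) + int g"
      then have "real_of_int u \<ge> of_int (int (k * g) + int g)" by (simp only: of_int_le_iff)
      then have "of_int u \<ge> real k * real g + real g" by simp
      then have "real k - of_int u / real g \<le> -1" using g0 by (simp add: field_simps)
      then show ?thesis using supp[of "real k - of_int u / real g"] W_ends by (cases "real k - of_int u / real g = -1") auto
    qed
  qed
  have "(\<Sum>\<^sub>\<infinity>u\<in>(UNIV :: int set). W (real k - of_int u / real g) * X u \<omega>) = (\<Sum>\<^sub>\<infinity>u\<in>U. W (real k - of_int u / real g) * X u \<omega>)"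
    by (rule infsum_cong_neutral) (use out in auto)
  also have "\<dots> = (\<Sum>u\<in>U. W (real k - of_int u / real g) * X u \<omega>)" by (simp add: U_def)
  also have "\<dots> = (\<Sum>j<g. W (- real j / real g) * X (int (k * g) + int j) \<omega>)"
    unfolding U_def using g0 by (subst sum.reindex) (auto simp: inj_on_def add_divide_distrib)
  finally have "Z1 W \<gamma> X n k \<omega> = real g powr (-1/2) * (\<Sum>j<g. W (- real j / real g) * X (int (k * g) + int j) \<omega>)"
    by (simp add: Z1_def g_def)
  moreover have "real g powr (-1/2) = 1 / sqrt g"
  proof -
    have "real g powr (-1/2) = inverse (real g powr (1/2))" by (simp flip: powr_minus)
    then show ?thesis using g0 by (simp add: powr_half_sqrt inverse_eq_divide)
  qed
  ultimately show ?thesis by (simp add: Y_def w_def g_def sum_divide_distrib)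
qed

lemma Z1_second_moment:
  assumes "\<gamma> n > 0"
  shows "expectation (\<lambda>\<omega>. (Z1 W \<gamma> X n k \<omega>)\<^sup>2) = S (\<gamma> n) 0"
  unfolding Z1_eq_Y[of \<gamma> n, OF assms] using Y_cov[of "\<gamma> n" "int (k * \<gamma> n)" "int (k * \<gamma> n)"] by (simp add: power2_eq_square)

lemma f_hat0_eq_Y:
  assumes "\<gamma> n > 0"
  shows "f_hat0 W \<gamma> X n \<omega> = (\<Sum>k<num_coeffs \<gamma> n. (Y (\<gamma> n) (int (k * \<gamma> n)) \<omega>)\<^sup>2) / real (num_coeffs \<gamma> n)"
  unfolding f_hat0_def Z1_eq_Y[of \<gamma> n, OF assms] ..

lemma f_hat0_mean:
  assumes "\<gamma> n > 0" "num_coeffs \<gamma> n > 0"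
  shows "expectation (f_hat0 W \<gamma> X n) = S (\<gamma> n) 0"
proof -
  have "expectation (\<lambda>\<omega>. \<Sum>k<num_coeffs \<gamma> n. (Z1 W \<gamma> X n k \<omega>)\<^sup>2) = (\<Sum>k<num_coeffs \<gamma> n. expectation (\<lambda>\<omega>. (Z1 W \<gamma> X n k \<omega>)\<^sup>2))"
    unfolding Z1_eq_Y[of \<gamma> n, OF assms(1)] by (intro Bochner_Integration.integral_sum square_integrable_power2 square_integrable_Y)
  then show ?thesis using assms by (simp add: f_hat0_def[abs_def] Z1_second_moment)
qed

end

lemma num_coeffs_bounds:
  assumes "\<gamma> n > 0"
  shows "real (num_coeffs \<gamma> n) \<le> (real n + 1) / real (\<gamma> n)" "(real n + 1) / real (\<gamma> n) - 1 < real (num_coeffs \<gamma> n)"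
proof -
  have "real (num_coeffs \<gamma> n) = of_int \<lfloor>(real n + 1) / real (\<gamma> n)\<rfloor>" by (simp add: num_coeffs_def)
  then show "real (num_coeffs \<gamma> n) \<le> (real n + 1) / real (\<gamma> n)" "(real n + 1) / real (\<gamma> n) - 1 < real (num_coeffs \<gamma> n)"
    by linarith+
qed

context
  fixes \<gamma> :: "nat \<Rightarrow> nat"
  assumes pos: "\<And>n. \<gamma> n > 0" and ratio: "filterlim (\<lambda>n. real n / real (\<gamma> n)) at_top sequentially"
begin

lemma num_coeffs_at_top: "filterlim (\<lambda>n. real (num_coeffs \<gamma> n)) at_top sequentially"
proof (rule filterlim_at_top_mono)
  show "filterlim (\<lambda>n. -1 + real n / real (\<gamma> n)) at_top sequentially"
    by (rule filterlim_tendsto_add_at_top[OF tendsto_const ratio])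
  have "-1 + real n / real (\<gamma> n) \<le> real (num_coeffs \<gamma> n)" for n
  proof -
    have "real n / real (\<gamma> n) \<le> (real n + 1) / real (\<gamma> n)" by (intro divide_right_mono) auto
    then show ?thesis using num_coeffs_bounds(2)[of \<gamma> n] pos by simp
  qed
  then show "\<forall>\<^sub>F n in sequentially. -1 + real n / real (\<gamma> n) \<le> real (num_coeffs \<gamma> n)" by simp
qed

lemma eventually_num_coeffs_pos: "\<forall>\<^sub>F n in sequentially. num_coeffs \<gamma> n > 0"
  using filterlim_at_top_dense[THEN iffD1, OF num_coeffs_at_top, rule_format, of 0] by simp

text \<open>Rounding and the replacement of n by n + 1 change the ratio by a bounded amount,
  negligible against the diverging \<open>n / \<gamma> n\<close>.\<close>

lemma num_coeffs_ratio: "(\<lambda>n. (real n / real (\<gamma> n)) / real (num_coeffs \<gamma> n)) \<longlonglongrightarrow> 1"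
proof -
  let ?x = "\<lambda>n. real n / real (\<gamma> n)"
  have "(\<lambda>n. real (num_coeffs \<gamma> n) / ?x n) \<longlonglongrightarrow> 1"
  proof (rule tendsto_sandwich)
    have inv: "(\<lambda>n. 1 / ?x n) \<longlonglongrightarrow> 0" using tendsto_divide_0[OF tendsto_const filterlim_at_top_imp_at_infinity[OF ratio]] .
    show "(\<lambda>n. (real n + 1) / real n - 1 / ?x n) \<longlonglongrightarrow> 1"
    proof -
      have "(\<lambda>n. (real n + 1) / real n) \<longlonglongrightarrow> 1" by real_asymp
      from tendsto_diff[OF this inv] show ?thesis by simp
    qed
    show "(\<lambda>n. (real n + 1) / real n) \<longlonglongrightarrow> 1" by real_asymp
    have b: "(real n + 1) / real n - 1 / ?x n \<le> real (num_coeffs \<gamma> n) / ?x n \<and> real (num_coeffs \<gamma> n) / ?x n \<le> (real n + 1) / real n" if n: "n > 0" for n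
    proof -
      have x: "?x n > 0" using n pos by simp
      have e: "((real n + 1) / real (\<gamma> n)) / ?x n = (real n + 1) / real n" using pos[of n] n by simp
      have "((real n + 1) / real (\<gamma> n) - 1) / ?x n \<le> real (num_coeffs \<gamma> n) / ?x n"
        using num_coeffs_bounds(2)[of \<gamma> n] pos x by (intro divide_right_mono) auto
      moreover have "real (num_coeffs \<gamma> n) / ?x n \<le> ((real n + 1) / real (\<gamma> n)) / ?x n"
        using num_coeffs_bounds(1)[of \<gamma> n] pos x by (intro divide_right_mono) auto
      ultimately show ?thesis unfolding diff_divide_distrib e by simp
    qed
    show "\<forall>\<^sub>F n in sequentially. (real n + 1) / real n - 1 / ?x n \<le> real (num_coeffs \<gamma> n) / ?x n"
      using eventually_gt_at_top[of 0] by eventually_elim (use b in blast)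
    show "\<forall>\<^sub>F n in sequentially. real (num_coeffs \<gamma> n) / ?x n \<le> (real n + 1) / real n"
      using eventually_gt_at_top[of 0] by eventually_elim (use b in blast)
  qed
  from tendsto_inverse[OF this] show ?thesis by (simp add: mult.commute)
qed

end

section \<open>Convergence of the characteristic functions\<close>

context decimated_iid
begin

text \<open>Within one row of the covariance matrix all lags are different, so
  \<open>S_offdiag\<close> bounds the row as a whole; N equal row bounds are then added.\<close>

lemma Gam_error_le:
  assumes g: "g > 0"
  shows "(\<Sum>k<N. \<Sum>l<N. (Gam g k l - (if k = l then spec 0 else 0))\<^sup>2)
    \<le> real N * ((KS0 / (real g)\<^sup>2)\<^sup>2 + 2 * (2 * pi * (Kf * K2\<^sup>2 / g))\<^sup>2 + 2 * (real N * (Ksp * far g)\<^sup>2))"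
proof -
  have "(\<Sum>l<N. (Gam g k l - (if k = l then spec 0 else 0))\<^sup>2) \<le> (KS0 / (real g)\<^sup>2)\<^sup>2 + 2 * (2 * pi * (Kf * K2\<^sup>2 / g))\<^sup>2 + 2 * (real N * (Ksp * far g)\<^sup>2)"
    if k: "k < N" for k
  proof -
    let ?H = "(\<lambda>l. int k - int l) ` ({..<N} - {k})"
    have "(\<Sum>l<N. (Gam g k l - (if k = l then spec 0 else 0))\<^sup>2) = (S g 0 - spec 0)\<^sup>2 + (\<Sum>l\<in>{..<N} - {k}. (S g (int g * (int k - int l)))\<^sup>2)"
      using k by (subst sum.remove[of _ k]) (auto simp: Gam_def intro!: sum.cong)
    also have "(\<Sum>l\<in>{..<N} - {k}. (S g (int g * (int k - int l)))\<^sup>2) = (\<Sum>h\<in>?H. (S g (int g * h))\<^sup>2)"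
      by (subst sum.reindex) (auto simp: inj_on_def)
    also have "\<dots> \<le> 2 * (2 * pi * (Kf * K2\<^sup>2 / g))\<^sup>2 + 2 * real (card ?H) * (Ksp * far g)\<^sup>2"
      by (rule S_offdiag[OF g]) auto
    also have "\<dots> \<le> 2 * (2 * pi * (Kf * K2\<^sup>2 / g))\<^sup>2 + 2 * real N * (Ksp * far g)\<^sup>2"
    proof -
      have "card ?H \<le> card ({..<N} - {k})" by (rule card_image_le) auto
      also have "\<dots> \<le> N" by (metis card_Diff1_le card_lessThan)
      finally show ?thesis by (intro add_left_mono mult_right_mono) auto
    qed
    also have "(S g 0 - spec 0)\<^sup>2 \<le> (KS0 / (real g)\<^sup>2)\<^sup>2"
      using S_zero_approx[OF g] by (metis abs_ge_zero power2_abs power_mono)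
    finally show ?thesis by simp
  qed
  then have "(\<Sum>k<N. \<Sum>l<N. (Gam g k l - (if k = l then spec 0 else 0))\<^sup>2)
    \<le> (\<Sum>k<N. (KS0 / (real g)\<^sup>2)\<^sup>2 + 2 * (2 * pi * (Kf * K2\<^sup>2 / g))\<^sup>2 + 2 * (real N * (Ksp * far g)\<^sup>2))"
    by (intro sum_mono) auto
  then show ?thesis by simp
qed

lemma T_char_tendsto:
  fixes \<gamma> :: "nat \<Rightarrow> nat"
  assumes pos: "\<And>n. \<gamma> n > 0" and gam: "filterlim \<gamma> at_top sequentially"
    and ratio: "filterlim (\<lambda>n. real n / real (\<gamma> n)) at_top sequentially"
    and cond: "(\<lambda>n. real n powr (1/2) * real (\<gamma> n) powr (1/2 - 2 * \<beta>)) \<longlonglongrightarrow> 0"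
  shows "(\<lambda>n. CLINT \<omega>|M. iexp (\<theta> * T (sqrt (real n / real (\<gamma> n)) / real (num_coeffs \<gamma> n)) (\<gamma> n) (num_coeffs \<gamma> n) \<omega>))
    \<longlonglongrightarrow> exp (- (\<theta>\<^sup>2 * (spec 0)\<^sup>2))"
proof -
  define x where "x n = real n / real (\<gamma> n)" for n
  define N where "N n = num_coeffs \<gamma> n" for n
  define \<rho> where "\<rho> n = sqrt (x n) / real (N n)" for n
  define r where "r n = x n / real (N n)" for n
  define f0 where "f0 = spec 0"
  define E where "E n k l = Gam (\<gamma> n) k l - (if k = l then f0 else 0)" for n k l
  \<comment> \<open>The squared Frobenius error of the covariance matrix per block. Its convergence
    to zero drives the limits of \<sigma> and t below.\<close>
  define q where "q n = (\<Sum>k<N n. \<Sum>l<N n. (E n k l)\<^sup>2) / N n" for n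
  note Npos = eventually_num_coeffs_pos[OF pos ratio, folded N_def]
  have x0: "x n \<ge> 0" for n by (simp add: x_def)
  have r1: "r \<longlonglongrightarrow> 1" using num_coeffs_ratio[OF pos ratio] unfolding r_def x_def N_def .
  have invN: "(\<lambda>n. 1 / real (N n)) \<longlonglongrightarrow> 0"
    using tendsto_divide_0[OF tendsto_const filterlim_at_top_imp_at_infinity[OF num_coeffs_at_top[OF pos ratio]]] unfolding N_def .
  have invg: "(\<lambda>n. 1 / real (\<gamma> n)) \<longlonglongrightarrow> 0"
    using tendsto_divide_0[OF tendsto_const filterlim_at_top_imp_at_infinity[OF filterlim_compose[OF filterlim_real_sequentially gam]]] .
  have S0: "(\<lambda>n. S (\<gamma> n) 0) \<longlonglongrightarrow> f0"
  proof (rule Lim_null[THEN iffD2], rule Lim_null_comparison)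
    show "\<forall>\<^sub>F n in sequentially. norm (S (\<gamma> n) 0 - f0) \<le> KS0 * (1 / real (\<gamma> n))\<^sup>2"
      using S_zero_approx[OF pos] by (simp add: f0_def power_divide)
    show "(\<lambda>n. KS0 * (1 / real (\<gamma> n))\<^sup>2) \<longlonglongrightarrow> 0"
      using tendsto_mult[OF tendsto_const tendsto_power[OF invg, of 2]] by simp
  qed
  have farN: "(\<lambda>n. real (N n) * (Ksp * far (\<gamma> n))\<^sup>2) \<longlonglongrightarrow> 0"
  proof (rule Lim_null_comparison)
    define c where "c = 2 * (Ksp * (K2\<^sup>2 * \<delta> powr (- (2 * \<beta>))))\<^sup>2"
    show "(\<lambda>n. c * (real n powr (1/2) * real (\<gamma> n) powr (1/2 - 2 * \<beta>))\<^sup>2) \<longlonglongrightarrow> 0"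
      using tendsto_mult[OF tendsto_const tendsto_power[OF cond, of 2]] by simp
    show "\<forall>\<^sub>F n in sequentially. norm (real (N n) * (Ksp * far (\<gamma> n))\<^sup>2) \<le> c * (real n powr (1/2) * real (\<gamma> n) powr (1/2 - 2 * \<beta>))\<^sup>2"
      using eventually_gt_at_top[of 0]
    proof eventually_elim
      case (elim n)
      have g: "real (\<gamma> n) > 0" using pos by simp
      have "real (N n) \<le> (real n + 1) / real (\<gamma> n)" unfolding N_def by (rule num_coeffs_bounds(1)[of \<gamma> n, OF pos])
      also have "\<dots> \<le> 2 * real n / real (\<gamma> n)" using elim by (intro divide_right_mono) auto
      finally have Nle: "real (N n) \<le> 2 * real n / real (\<gamma> n)" .
      \<comment> \<open>The growth condition enters through this identity: N times the squared far
        bound is at most a constant times the square of the sequence in the condition.\<close>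
      have e: "(real n powr (1/2) * real (\<gamma> n) powr (1/2 - 2 * \<beta>))\<^sup>2 = real n / real (\<gamma> n) * (real (\<gamma> n) powr (1 - 2 * \<beta>))\<^sup>2"
      proof -
        have "(real n powr (1/2))\<^sup>2 = real n" using elim by (simp add: powr_half_sqrt)
        moreover have "real (\<gamma> n) powr (1 - 2 * \<beta>) = real (\<gamma> n) powr (1/2) * real (\<gamma> n) powr (1/2 - 2 * \<beta>)"
          by (simp flip: powr_add)
        moreover have "(real (\<gamma> n) powr (1/2))\<^sup>2 = real (\<gamma> n)" using g by (simp add: powr_half_sqrt)
        ultimately show ?thesis using g by (simp add: power_mult_distrib)
      qed
      have "real (N n) * (Ksp * far (\<gamma> n))\<^sup>2 \<le> 2 * real n / real (\<gamma> n) * (Ksp * far (\<gamma> n))\<^sup>2"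
        using Nle by (rule mult_right_mono) simp
      also have "\<dots> = c * (real n powr (1/2) * real (\<gamma> n) powr (1/2 - 2 * \<beta>))\<^sup>2"
        unfolding e far_def c_def by (simp add: power_mult_distrib)
      finally show ?case by simp
    qed
  qed
  have q0: "q \<longlonglongrightarrow> 0"
  proof (rule Lim_null_comparison)
    let ?u = "\<lambda>n. (KS0 * (1 / real (\<gamma> n))\<^sup>2)\<^sup>2 + 2 * (2 * pi * (Kf * K2\<^sup>2 * (1 / real (\<gamma> n))))\<^sup>2 + 2 * (real (N n) * (Ksp * far (\<gamma> n))\<^sup>2)"
    have "?u \<longlonglongrightarrow> (KS0 * 0\<^sup>2)\<^sup>2 + 2 * (2 * pi * (Kf * K2\<^sup>2 * 0))\<^sup>2 + 2 * 0"
      by (intro tendsto_intros invg farN)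
    then show "?u \<longlonglongrightarrow> 0" by simp
    show "\<forall>\<^sub>F n in sequentially. norm (q n) \<le> ?u n"
      using Npos
    proof eventually_elim
      case (elim n)
      have "0 \<le> q n" unfolding q_def by (intro divide_nonneg_nonneg sum_nonneg) auto
      moreover have "q n \<le> ?u n"
        unfolding q_def E_def f0_def using elim Gam_error_le[OF pos, of n "N n"] by (simp add: divide_le_eq power_divide mult_ac)
      ultimately show ?case by simp
    qed
  qed
  define \<sigma> where "\<sigma> n = (\<rho> n)\<^sup>2 * (\<Sum>k<N n. \<Sum>l<N n. (Gam (\<gamma> n) k l)\<^sup>2)" for n
  define t where "t n = (\<rho> n)^4 * (\<Sum>k<N n. \<Sum>l<N n. (\<Sum>m<N n. Gam (\<gamma> n) k m * Gam (\<gamma> n) m l)\<^sup>2)" for n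
  define d where "d n = (\<rho> n)\<^sup>2 * (diag_bound (\<gamma> n) * (real (N n) * S (\<gamma> n) 0))" for n
  have G: "Gam (\<gamma> n) k l = (if k = l then f0 else 0) + E n k l" for n k l by (simp add: E_def)
  \<comment> \<open>The scaling enters \<sigma>, t and d only through this product, which tends to
    1.\<close>
  have rho2: "(\<rho> n)\<^sup>2 * real (N n) = r n" if "N n > 0" for n
    using that x0[of n] by (simp add: \<rho>_def r_def power_divide power2_eq_square)
  have sig: "\<sigma> \<longlonglongrightarrow> f0\<^sup>2"
  proof (rule Lim_transform_eventually)
    have "(\<lambda>n. r n * (f0\<^sup>2 + 2 * f0 * (S (\<gamma> n) 0 - f0) + q n)) \<longlonglongrightarrow> 1 * (f0\<^sup>2 + 2 * f0 * (f0 - f0) + 0)"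
      by (intro tendsto_intros r1 S0 q0)
    then show "(\<lambda>n. r n * (f0\<^sup>2 + 2 * f0 * (S (\<gamma> n) 0 - f0) + q n)) \<longlonglongrightarrow> f0\<^sup>2" by simp
    show "\<forall>\<^sub>F n in sequentially. r n * (f0\<^sup>2 + 2 * f0 * (S (\<gamma> n) 0 - f0) + q n) = \<sigma> n"
      using Npos
    proof eventually_elim
      case (elim n)
      have "(\<Sum>k<N n. \<Sum>l<N n. (Gam (\<gamma> n) k l)\<^sup>2) = f0\<^sup>2 * card {..<N n} + 2 * f0 * (\<Sum>k<N n. E n k k) + (\<Sum>k<N n. \<Sum>l<N n. (E n k l)\<^sup>2)"
        by (rule near_scalar_Frobenius(2)[OF _ G]) simp
      also have "\<dots> = real (N n) * (f0\<^sup>2 + 2 * f0 * (S (\<gamma> n) 0 - f0) + q n)"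
        using elim by (simp add: q_def E_def Gam_def algebra_simps)
      finally show ?case using rho2[OF elim] by (simp add: \<sigma>_def flip: mult.assoc)
    qed
  qed
  have t0: "t \<longlonglongrightarrow> 0"
  proof (rule Lim_null_comparison)
    have "(\<lambda>n. 3 * (r n)\<^sup>2 * (f0^4 * (1 / real (N n)) + 4 * f0\<^sup>2 * q n * (1 / real (N n)) + (q n)\<^sup>2)) \<longlonglongrightarrow> 3 * 1\<^sup>2 * (f0^4 * 0 + 4 * f0\<^sup>2 * 0 * 0 + 0\<^sup>2)"
      by (intro tendsto_intros r1 q0 invN)
    then show "(\<lambda>n. 3 * (r n)\<^sup>2 * (f0^4 * (1 / real (N n)) + 4 * f0\<^sup>2 * q n * (1 / real (N n)) + (q n)\<^sup>2)) \<longlonglongrightarrow> 0" by simp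
    show "\<forall>\<^sub>F n in sequentially. norm (t n) \<le> 3 * (r n)\<^sup>2 * (f0^4 * (1 / real (N n)) + 4 * f0\<^sup>2 * q n * (1 / real (N n)) + (q n)\<^sup>2)"
      using Npos
    proof eventually_elim
      case (elim n)
      define e where "e = (\<Sum>k<N n. \<Sum>l<N n. (E n k l)\<^sup>2)"
      have eq: "e = q n * real (N n)" using elim by (simp add: e_def q_def)
      have "(\<Sum>k<N n. \<Sum>l<N n. (\<Sum>m<N n. Gam (\<gamma> n) k m * Gam (\<gamma> n) m l)\<^sup>2) \<le> 3 * (f0^4 * card {..<N n} + 4 * f0\<^sup>2 * e + e\<^sup>2)"
        unfolding e_def by (rule near_scalar_Frobenius(1)[OF _ G]) simp
      then have "t n \<le> (\<rho> n)^4 * (3 * (f0^4 * real (N n) + 4 * f0\<^sup>2 * e + e\<^sup>2))"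
        unfolding t_def by (intro mult_left_mono) auto
      also have "\<dots> = ((\<rho> n)\<^sup>2 * real (N n))\<^sup>2 * (3 * (f0^4 * (1 / real (N n)) + 4 * f0\<^sup>2 * q n * (1 / real (N n)) + (q n)\<^sup>2))"
      proof -
        have *: "p^4 * (3 * (A * m + B * (z * m) + (z * m)\<^sup>2)) = (p\<^sup>2 * m)\<^sup>2 * (3 * (A * (1 / m) + B * z * (1 / m) + z\<^sup>2))" if "m \<noteq> 0" for p A B z m :: real
          using that by (simp add: field_simps power2_eq_square power4_eq_xxxx)
        show ?thesis unfolding eq by (rule *) (use elim in simp)
      qed
      finally have "t n \<le> 3 * (r n)\<^sup>2 * (f0^4 * (1 / real (N n)) + 4 * f0\<^sup>2 * q n * (1 / real (N n)) + (q n)\<^sup>2)"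
        unfolding rho2[OF elim] by (simp only: mult_ac)
      moreover have "t n \<ge> 0" unfolding t_def by (intro mult_nonneg_nonneg sum_nonneg) auto
      ultimately show ?case by simp
    qed
  qed
  have diag0: "(\<lambda>n. diag_bound (\<gamma> n)) \<longlonglongrightarrow> 0"
  proof (rule Lim_null_comparison)
    let ?u = "\<lambda>n. S (\<gamma> n) 0 * (1 / real (\<gamma> n)) + 2 * sqrt (KS1 * (1 / real (\<gamma> n)) * S (\<gamma> n) 0)"
    have "?u \<longlonglongrightarrow> f0 * 0 + 2 * sqrt (KS1 * 0 * f0)" by (intro tendsto_intros S0 invg)
    then show "?u \<longlonglongrightarrow> 0" by simp
    have "norm (diag_bound (\<gamma> n)) \<le> ?u n" for n
    proof -
      have db0: "diag_bound (\<gamma> n) \<ge> 0" using v_decimated_sum_le[OF pos, where N = 0] by simp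
      have "2 * (S (\<gamma> n) 0 - S (\<gamma> n) 1) * S (\<gamma> n) 0 \<le> KS1 * (1 / real (\<gamma> n)) * S (\<gamma> n) 0"
        using S_increment[OF pos[of n]] by (intro mult_right_mono S0_nonneg) simp
      then have "sqrt (2 * (S (\<gamma> n) 0 - S (\<gamma> n) 1) * S (\<gamma> n) 0) \<le> sqrt (KS1 * (1 / real (\<gamma> n)) * S (\<gamma> n) 0)" by (rule real_sqrt_le_mono)
      then show ?thesis using db0 by (simp add: diag_bound_def)
    qed
    then show "\<forall>\<^sub>F n in sequentially. norm (diag_bound (\<gamma> n)) \<le> ?u n" by (intro always_eventually allI)
  qed
  have d0: "d \<longlonglongrightarrow> 0"
  proof (rule Lim_transform_eventually)
    have "(\<lambda>n. r n * (diag_bound (\<gamma> n) * S (\<gamma> n) 0)) \<longlonglongrightarrow> 1 * (0 * f0)" by (intro tendsto_intros r1 diag0 S0)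
    then show "(\<lambda>n. r n * (diag_bound (\<gamma> n) * S (\<gamma> n) 0)) \<longlonglongrightarrow> 0" by simp
    show "\<forall>\<^sub>F n in sequentially. r n * (diag_bound (\<gamma> n) * S (\<gamma> n) 0) = d n"
      using Npos
    proof eventually_elim
      case (elim n)
      show ?case unfolding d_def rho2[OF elim, symmetric] by (simp only: mult_ac)
    qed
  qed
  define ch where "ch n = (CLINT \<omega>|M. iexp (\<theta> * T (\<rho> n) (\<gamma> n) (N n) \<omega>))" for n
  define K where "K = f0\<^sup>2 + 1"
  have "(\<lambda>n. ch n - exp (- (\<theta>\<^sup>2 * \<sigma> n))) \<longlonglongrightarrow> 0"
  proof (rule tendstoI)
    fix \<epsilon> :: real assume \<epsilon>: "\<epsilon> > 0"
    \<comment> \<open>First \<eta> is fixed so that the bound, which vanishes at 0, is below the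
      tolerance; only then is n taken large. The choice \<open>K = f0\<^sup>2 + 1\<close> leaves
      room above the limit of \<sigma>.\<close>
    have "((\<lambda>\<eta>. char_bound \<eta> \<theta> K) \<longlongrightarrow> char_bound 0 \<theta> K) (at_right 0)"
      unfolding char_bound_def by (intro tendsto_intros)
    then have "((\<lambda>\<eta>. char_bound \<eta> \<theta> K) \<longlongrightarrow> 0) (at_right 0)" by (simp add: char_bound_def)
    then have "\<forall>\<^sub>F \<eta> in at_right 0. char_bound \<eta> \<theta> K < \<epsilon> \<and> \<eta> > 0"
      using \<epsilon> by (intro eventually_conj order_tendstoD(2)) (auto simp: eventually_at_right_less)
    then obtain \<eta> where \<eta>: "char_bound \<eta> \<theta> K < \<epsilon>" "\<eta> > 0"
      using eventually_happens'[OF trivial_limit_at_right_real] by blast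
    have \<eta>2: "\<eta>\<^sup>2 > 0" using \<eta> by simp
    have fK: "f0\<^sup>2 < K" by (simp add: K_def)
    show "\<forall>\<^sub>F n in sequentially. dist (ch n - exp (- (\<theta>\<^sup>2 * \<sigma> n))) 0 < \<epsilon>"
      using order_tendstoD(2)[OF t0 \<eta>2] order_tendstoD(2)[OF d0 \<eta>2] order_tendstoD(2)[OF sig fK]
    proof eventually_elim
      case (elim n)
      have "cmod (ch n - exp (- (\<theta>\<^sup>2 * \<sigma> n))) \<le> char_bound \<eta> \<theta> K"
        unfolding ch_def \<sigma>_def
      proof (rule T_char_approx[OF pos \<eta>(2)])
        show "(\<rho> n)^4 * (\<Sum>k<N n. \<Sum>l<N n. (\<Sum>m<N n. Gam (\<gamma> n) k m * Gam (\<gamma> n) m l)\<^sup>2) < \<eta>\<^sup>2"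
          using elim(1) unfolding t_def .
        show "(\<rho> n)\<^sup>2 * (diag_bound (\<gamma> n) * (real (N n) * S (\<gamma> n) 0)) \<le> \<eta>\<^sup>2"
          using elim(2) unfolding d_def by (rule less_imp_le)
        show "(\<rho> n)\<^sup>2 * (\<Sum>k<N n. \<Sum>l<N n. (Gam (\<gamma> n) k l)\<^sup>2) < K"
          using elim(3) unfolding \<sigma>_def .
      qed
      then show ?case using \<eta>(1) unfolding dist_norm diff_zero by (rule le_less_trans)
    qed
  qed
  moreover have "(\<lambda>n. complex_of_real (exp (- (\<theta>\<^sup>2 * \<sigma> n)))) \<longlonglongrightarrow> exp (- (\<theta>\<^sup>2 * f0\<^sup>2))"
    by (intro tendsto_intros sig)
  ultimately have "ch \<longlonglongrightarrow> exp (- (\<theta>\<^sup>2 * f0\<^sup>2))"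
    using tendsto_add[of "\<lambda>n. ch n - exp (- (\<theta>\<^sup>2 * \<sigma> n))" 0 sequentially "\<lambda>n. complex_of_real (exp (- (\<theta>\<^sup>2 * \<sigma> n)))"] by simp
  then show ?thesis unfolding ch_def[abs_def] \<rho>_def x_def N_def f0_def .
qed

end

section \<open>The limit law\<close>

lemma char_normal_law:
  assumes "v \<ge> 0"
  shows "char (normal_law 0 v) t = exp (- (t\<^sup>2 * v / 2))"
proof -
  have "char (normal_law 0 v) t = (CLINT x|std_normal_distribution. iexp (t * (sqrt v * x)))"
    unfolding char_def normal_law_def by (subst integral_distr) auto
  also have "\<dots> = char std_normal_distribution (t * sqrt v)" by (simp add: char_def mult.assoc)
  also have "\<dots> = exp (- (t\<^sup>2 * v / 2))"
    using assms by (simp add: char_std_normal_distribution power_mult_distrib)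
  finally show ?thesis .
qed

lemma real_distribution_normal_law: "real_distribution (normal_law m v)"
  unfolding normal_law_def
  by (rule real_distribution.intro, rule prob_space.prob_space_distr)
     (auto simp: real_distribution_axioms_def intro: prob_space_normal_density)

text \<open>Parseval makes the sum independent of l; its value comes from the normalized total
  energy.\<close>

lemma (in window) periodized_FT: "(\<Sum>\<^sub>\<infinity>p\<in>(UNIV :: int set). (cmod (FT (l + 2 * of_int p * pi)))\<^sup>2) = 1 / (2 * pi)"
proof -
  have "(\<Sum>\<^sub>\<infinity>p\<in>(UNIV :: int set). (cmod (FT (l + 2 * pi * of_int p)))\<^sup>2) = integral\<^sup>L (ival (-1) 0) (\<lambda>x. (W x)\<^sup>2)"
    by (rule infsumI[OF FT_Parseval])
  also have "\<dots> = 1 / (2 * pi)" using W_energy by (simp add: field_simps)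
  finally show ?thesis by (simp add: mult_ac)
qed

text \<open>The factor 4\<pi> meets an integral equal to 2\<pi> / (2\<pi>)^2. The limit variance is
  therefore the same for every window.\<close>

lemma (in window) asymp_variance_eq: "asymp_variance f W = 2 * (f 0)\<^sup>2"
proof -
  have "(LBINT l:{-pi..pi}. (1 / (2 * pi))\<^sup>2) = 2 * pi * (1 / (2 * pi))\<^sup>2"
    unfolding integral_ival[symmetric] by (subst integral_ival_const) auto
  then show ?thesis unfolding asymp_variance_def periodized_FT by (simp add: power2_eq_square)
qed

theorem theorem3:
  fixes M :: "'a measure"
    and \<xi> X :: "int \<Rightarrow> 'a \<Rightarrow> real"
    and a :: "int \<Rightarrow> real"
    and a_star :: "real \<Rightarrow> complex"
    and f W :: "real \<Rightarrow> real"
    and \<beta> :: real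
    and \<gamma> :: "nat \<Rightarrow> nat"
  assumes "prob_space M"
    and "weak_white_noise M \<xi>"
    and "(\<lambda>t. (a t)\<^sup>2) summable_on UNIV"
    and "linear_process M a \<xi> X"
    and "is_fourier_series a a_star"
    and "\<And>l. f l = (cmod (a_star l))\<^sup>2"
    and "(\<lambda>l. f l - f 0) \<in> O[at 0](\<lambda>l. \<bar>l\<bar>\<^sup>2)"
    and "continuous_on UNIV W"
    and "bounded (range W)"
    and "{t. W t \<noteq> 0} \<subseteq> {-1..0}"
    and "\<beta> > 2"
    and "bdd_above (range (\<lambda>x. cmod (fourier_transform W x) * (1 + \<bar>x\<bar>) powr \<beta>))"
    and "(LBINT l. (cmod (fourier_transform W l))\<^sup>2) = 1"
    and "\<And>n. \<gamma> n > 0 \<and> even (\<gamma> n)"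
    and "filterlim \<gamma> at_top sequentially"
    and "filterlim (\<lambda>n. real n / real (\<gamma> n)) at_top sequentially"
  shows
    "(\<forall>\<^sub>F n in sequentially.
        (\<integral>\<omega>. f_hat0 W \<gamma> X n \<omega> \<partial>M) = (\<integral>\<omega>. (Z1 W \<gamma> X n 0 \<omega>)\<^sup>2 \<partial>M)) \<and>
     (\<lambda>n. (\<integral>\<omega>. (Z1 W \<gamma> X n 0 \<omega>)\<^sup>2 \<partial>M) - f 0) \<in> O(\<lambda>n. real (\<gamma> n) powr (-2)) \<and>
     (iid M \<xi> \<and> (\<integral>\<omega>. \<xi> 0 \<omega> \<partial>M) = 0 \<and> (\<integral>\<omega>. (\<xi> 0 \<omega>)\<^sup>2 \<partial>M) = 1 \<and>
      integrable M (\<lambda>\<omega>. (\<xi> 0 \<omega>) ^ 4) \<and>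
      (\<lambda>n. real n powr (1/2) * real (\<gamma> n) powr (1/2 - 2 * \<beta>)) \<longlonglongrightarrow> 0
      \<longrightarrow>
      weak_conv_m
        (\<lambda>n. distr M borel (\<lambda>\<omega>. (real n / real (\<gamma> n)) powr (1/2) *
                (f_hat0 W \<gamma> X n \<omega> - (\<integral>\<omega>'. (Z1 W \<gamma> X n 0 \<omega>')\<^sup>2 \<partial>M))))
        (normal_law 0 (asymp_variance f W)))"
proof -
  interpret prob_space M by fact
  obtain C where C: "\<And>x. cmod (fourier_transform W x) * (1 + \<bar>x\<bar>) powr \<beta> \<le> C"
    using assms(12) by (auto simp: bdd_above_def)
  interpret window W \<beta> C
    by unfold_locales (use assms C in auto)
  interpret linear_series M \<xi> X a a_star
    by unfold_locales fact+
  have f_spec: "f = spec" by (simp add: fun_eq_iff spec_def assms(6))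
  obtain c where c: "c > 0" "\<forall>\<^sub>F l in at 0. norm (f l - f 0) \<le> c * norm (\<bar>l\<bar>\<^sup>2)"
    using landau_o.bigE[OF assms(7)] by blast
  then obtain d where d: "d > 0" "\<And>l. l \<noteq> 0 \<Longrightarrow> \<bar>l\<bar> < d \<Longrightarrow> \<bar>f l - f 0\<bar> \<le> c * l\<^sup>2"
    unfolding eventually_at by (auto simp: dist_real_def)
  \<comment> \<open>Half of d, because the estimate holds only for |l| < d; the minimum with \<pi>
    keeps \<delta> within the period.\<close>
  define \<delta> where "\<delta> = min (d / 2) pi"
  have \<delta>: "\<delta> > 0" "\<delta> \<le> pi" "\<delta> < d" using d(1) by (auto simp: \<delta>_def)
  have quad: "\<bar>spec l - spec 0\<bar> \<le> c * l\<^sup>2" if "\<bar>l\<bar> \<le> \<delta>" for l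
    using d(2)[of l] that \<delta> unfolding f_spec by (cases "l = 0") auto
  interpret decimated M \<xi> X a a_star W \<beta> C c \<delta>
    by unfold_locales (use c(1) \<delta> quad in auto)
  have pos: "\<gamma> n > 0" for n using assms(14) by simp
  note ratio = assms(16)
  have EZ: "(\<integral>\<omega>. (Z1 W \<gamma> X n 0 \<omega>)\<^sup>2 \<partial>M) = S (\<gamma> n) 0" for n
    by (rule Z1_second_moment[of \<gamma> n, OF pos])
  have part1: "\<forall>\<^sub>F n in sequentially. (\<integral>\<omega>. f_hat0 W \<gamma> X n \<omega> \<partial>M) = (\<integral>\<omega>. (Z1 W \<gamma> X n 0 \<omega>)\<^sup>2 \<partial>M)"
    using eventually_num_coeffs_pos[OF pos ratio]
  proof eventually_elim
    case (elim n)
    then show ?case unfolding EZ by (rule f_hat0_mean[of \<gamma> n, OF pos])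
  qed
  have part2: "(\<lambda>n. (\<integral>\<omega>. (Z1 W \<gamma> X n 0 \<omega>)\<^sup>2 \<partial>M) - f 0) \<in> O(\<lambda>n. real (\<gamma> n) powr (-2))"
  proof (rule bigoI[of _ KS0], rule always_eventually, rule allI)
    fix n
    have "real (\<gamma> n) powr (-2) = 1 / (real (\<gamma> n))\<^sup>2" using pos[of n] by (simp add: powr_minus powr_numeral field_simps)
    then show "norm ((\<integral>\<omega>. (Z1 W \<gamma> X n 0 \<omega>)\<^sup>2 \<partial>M) - f 0) \<le> KS0 * norm (real (\<gamma> n) powr (-2))"
      using S_zero_approx[OF pos[of n]] unfolding EZ f_spec by simp
  qed
  have part3: "weak_conv_m
        (\<lambda>n. distr M borel (\<lambda>\<omega>. (real n / real (\<gamma> n)) powr (1/2) *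
                (f_hat0 W \<gamma> X n \<omega> - (\<integral>\<omega>'. (Z1 W \<gamma> X n 0 \<omega>')\<^sup>2 \<partial>M))))
        (normal_law 0 (asymp_variance f W))"
    if iid: "iid M \<xi>" and four: "integrable M (\<lambda>\<omega>. (\<xi> 0 \<omega>) ^ 4)"
      and cond: "(\<lambda>n. real n powr (1/2) * real (\<gamma> n) powr (1/2 - 2 * \<beta>)) \<longlonglongrightarrow> 0"
  proof -
    have xm [measurable]: "\<xi> t \<in> borel_measurable M" for t using assms(2) by (simp add: weak_white_noise_def)
    have same: "distr M borel (\<xi> t) = distr M borel (\<xi> 0)" for t using iid unfolding iid_def by blast
    define \<kappa> where "\<kappa> = expectation (\<lambda>\<omega>. (\<xi> 0 \<omega>) ^ 4)"
    have fourth: "integrable M (\<lambda>\<omega>. (\<xi> t \<omega>) ^ 4)" for t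
      using four integrable_distr_eq[of "\<xi> t" M borel "\<lambda>x. x ^ 4"] integrable_distr_eq[of "\<xi> 0" M borel "\<lambda>x. x ^ 4"] same[of t] by simp
    have kurt: "expectation (\<lambda>\<omega>. (\<xi> t \<omega>) ^ 4) = \<kappa>" for t
      using integral_distr[of "\<xi> t" M borel "\<lambda>x. x ^ 4"] integral_distr[of "\<xi> 0" M borel "\<lambda>x. x ^ 4"] same[of t] by (simp add: \<kappa>_def)
    interpret decimated_iid M \<xi> X a a_star W \<beta> C c \<delta> \<kappa>
      by unfold_locales (use iid fourth kurt assms(2) in \<open>auto simp: iid_def weak_white_noise_def\<close>)
    define h where "h n \<omega> = (real n / real (\<gamma> n)) powr (1/2) * (f_hat0 W \<gamma> X n \<omega> - S (\<gamma> n) 0)" for n \<omega>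
    define \<rho> where "\<rho> n = sqrt (real n / real (\<gamma> n)) / real (num_coeffs \<gamma> n)" for n
    have hm [measurable]: "h n \<in> borel_measurable M" for n
    proof -
      have [measurable]: "Y (\<gamma> n) m \<in> borel_measurable M" for m by (rule square_integrable_measurable[OF square_integrable_Y])
      show ?thesis unfolding h_def[abs_def] f_hat0_eq_Y[of \<gamma> n, OF pos] by measurable
    qed
    \<comment> \<open>With no blocks the estimator and T are both 0 by division by zero, but h keeps
      the centering term; hence the restriction to a positive number of blocks.\<close>
    have hT: "h n \<omega> = T (\<rho> n) (\<gamma> n) (num_coeffs \<gamma> n) \<omega>" if "num_coeffs \<gamma> n > 0" for n \<omega>
      using that unfolding h_def T_def \<rho>_def f_hat0_eq_Y[of \<gamma> n, OF pos]
      by (simp add: powr_half_sqrt field_simps)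
    have var: "asymp_variance f W = 2 * (spec 0)\<^sup>2" unfolding asymp_variance_eq f_spec ..
    have "weak_conv_m (\<lambda>n. distr M borel (h n)) (normal_law 0 (asymp_variance f W))"
    proof (rule levy_continuity)
      show "real_distribution (distr M borel (h n))" for n by (rule real_distribution_distr) (rule hm)
      show "real_distribution (normal_law 0 (asymp_variance f W))" by (rule real_distribution_normal_law)
      fix \<theta> :: real
      have "(\<lambda>n. CLINT \<omega>|M. iexp (\<theta> * T (\<rho> n) (\<gamma> n) (num_coeffs \<gamma> n) \<omega>)) \<longlonglongrightarrow> exp (- (\<theta>\<^sup>2 * (spec 0)\<^sup>2))"
        unfolding \<rho>_def by (rule T_char_tendsto[OF pos assms(15) ratio cond])
      moreover have "\<forall>\<^sub>F n in sequentially. (CLINT \<omega>|M. iexp (\<theta> * T (\<rho> n) (\<gamma> n) (num_coeffs \<gamma> n) \<omega>)) = char (distr M borel (h n)) \<theta>"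
        using eventually_num_coeffs_pos[OF pos ratio]
      proof eventually_elim
        case (elim n)
        have "char (distr M borel (h n)) \<theta> = (CLINT \<omega>|M. iexp (\<theta> * h n \<omega>))"
          unfolding char_def by (subst integral_distr) auto
        then show ?case unfolding hT[OF elim] ..
      qed
      ultimately have "(\<lambda>n. char (distr M borel (h n)) \<theta>) \<longlonglongrightarrow> exp (- (\<theta>\<^sup>2 * (spec 0)\<^sup>2))"
        by (rule Lim_transform_eventually)
      \<comment> \<open>The 2 in the variance cancels the 1/2 in the Gaussian exponent.\<close>
      moreover have "char (normal_law 0 (asymp_variance f W)) \<theta> = exp (- (\<theta>\<^sup>2 * (spec 0)\<^sup>2))"
        unfolding var by (subst char_normal_law) auto
      ultimately show "(\<lambda>n. char (distr M borel (h n)) \<theta>) \<longlonglongrightarrow> char (normal_law 0 (asymp_variance f W)) \<theta>" by simp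
    qed
    then show ?thesis unfolding h_def[abs_def] EZ .
  qed
  show ?thesis using part1 part2 part3 by blast
qed

end
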